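(* Let $\mathbb D\colon\mathrm{finGpd}^{\mathrm{op}}\to\mathrm{CAT}$ be a strict 2-functor, and write $u^*=\mathbb D(u)$, $\lambda^*=\mathbb D(\lambda)$ for 1-cells $u$ and 2-cells $\lambda$. Suppose: (i) $\mathbb D(\emptyset)$ is equivalent to the one-object discrete category, and for all finite groupoids $\mathcal I,\mathcal J$ with coproduct $\mathcal I\xrightarrow{i}\mathcal I\amalg\mathcal J\xleftarrow{j}\mathcal J$, the functor $(i^*,j^* )\colon\mathbb D(\mathcal I\amalg\mathcal J)\to\mathbb D(\mathcal I)\times\mathbb D(\mathcal J)$ is an equivalence of categories. (ii) For every functor $u\colon\mathcal J\to\mathcal K$ of finite groupoids, $u^*\colon\mathbb D(\mathcal K)\to\mathbb D(\mathcal J)$ has a left adjoint $u_!$. (iii) For every comma square in $\mathrm{finGpd}$, given by functors $I\colon\mathcal I\to\mathcal K$, $J\colon\mathcal J\to\mathcal K$, projections $p_{\mathcal I}\colon\mathcal I/\mathcal J\to\mathcal I$, $p_{\mathcal J}\colon\mathcal I/\mathcal J\to\mathcal J$ and $\lambda\colon I\circ p_{\mathcal I}\Rightarrow J\circ p_{\mathcal J}$, the natural transformation $\lambda_!\colon(p_{\mathcal J})_!\circ p_{\mathcal I}^*\Rightarrow J^*\circ I_!$ is an isomorphism. Then one obtains a semi-Mackey functor $(M_!,M^* )$ on $\mathscr C$ by putting $M(\frac XG)=\mathfrak C(\mathbb D(\mathbb E(\frac XG)))$ for each object $\frac XG$ of $\mathscr C$, and $$M^*(\underline\alpha)=\mathfrak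 C(\mathbb E(\alpha)^* ),\qquad M_!(\underline\alpha)=\mathfrak C(\mathbb E(\alpha)_!)$$ for each morphism $\underline\alpha\in\mathscr C(\frac XG,\frac YH)$.
   Context: For a category $\mathscr K$, $\mathfrak C(\mathscr K)$ is the set of isomorphism classes of objects, and $\mathfrak C(F)$ is the map induced by a functor $F$. $\mathrm{finGpd}$ is the 2-category of finite groupoids (functors, natural transformations), $\mathrm{CAT}$ the 2-category of categories; $\mathbb D$ reverses 1-cells and preserves the direction of 2-cells. Size issues are ignored: $\mathit{Set}$ is taken in a universe large enough to contain the classes $\mathfrak C(\mathbb D(\mathcal I))$. The transformation $\lambda_!$ is the composite $(p_{\mathcal J})_!p_{\mathcal I}^*\Rightarrow(p_{\mathcal J})_!p_{\mathcal I}^*I^*I_!\xRightarrow{(p_{\mathcal J})_!\lambda^*I_!}(p_{\mathcal J})_!p_{\mathcal J}^*J^*I_!\Rightarrow J^*I_!$ of a unit, $\lambda^*$ and a counit. All groups are finite. The 2-category $\mathbb S$. 0-cells: pairs $\frac XG$ with $G$ a finite group and $X$ a finite left $G$-set. A 1-cell $\frac\alpha\theta\colon\frac XG\to\frac YH$ (often written $\alpha$) is a map $\alpha\colon X\to Y$ with maps $\theta_x\colon G\to H$ ($x\in X$) such that $\alpha(gx)=\theta_x(g)\alpha(x)$ and $\theta_x(gg')=\theta_{g'x}(g)\theta_x(g')$; composition is $\beta\circ\alpha$ with $(\tau\circ\theta)_x=\tau_{\alpha(x)}\circ\theta_x$. A 2-cell $\varepsilon\colon\frac\alpha\theta\Rightarrow\frac{\alpha'}{\theta'}$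 is a family $\varepsilon_x\in H$ with $\alpha'(x)=\varepsilon_x\alpha(x)$ and $\varepsilon_{gx}\theta_x(g)\varepsilon_x^{-1}=\theta'_x(g)$; vertical composition is $(\varepsilon'\cdot\varepsilon)_x=\varepsilon'_x\varepsilon_x$, whiskering is $(\frac\beta\tau\circ\varepsilon)_x=\tau_{\alpha(x)}(\varepsilon_x)$, $(\rho\circ\frac\alpha\theta)_x=\rho_{\alpha(x)}$. The strict 2-functor $\mathbb E\colon\mathbb S\to\mathrm{finGpd}$: $\mathbb E(\frac XG)$ has object set $X$ and morphisms $x\to x'$ the $g\in G$ with $gx=x'$; $\mathbb E(\frac\alpha\theta)$ is $\alpha$ on objects and sends $g\colon x\to gx$ to $\theta_x(g)$; $\mathbb E(\varepsilon)$ has components $\varepsilon_x$. The category $\mathscr C$. Objects: 0-cells of $\mathbb S$; morphisms: isomorphism classes $\underline\alpha$ of 1-cells under (always invertible) 2-cells. It has finite coproducts $\amalg$ (images of bicoproducts in $\mathbb S$), with initial object $\emptyset=\frac\emptyset e$. A natural weak pullback is a commutative square in $\mathscr C$ that is the image of a bipullback in $\mathbb S$; the bipullback of $\frac\alpha\theta\colon\frac XG\to\frac ZK$ and $\frac\beta\tau\colon\frac YH\to\frac ZK$ is $\frac F{G\times H}$ with $F=\{(x,y,c)\in X\times Y\times K\mid\beta(y)=c\,\alpha(x)\}$, $(g,h)(x,y,c)=(gx,hy,\tau_y(h)c\,\theta_x(g)^{-1})$, the projections, and the 2-cell with components $c$. A semi-Mackey functor on $\mathscr C$ is a pair $M=(M_!,M^*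 )$ of a covariant functor $M_!\colon\mathscr C\to\mathit{Set}$ and a contravariant functor $M^*\colon\mathscr C\to\mathit{Set}$ with: (0) $M_!(\frac XG)=M^*(\frac XG)=:M(\frac XG)$ on objects; (1) for every coproduct $\frac XG\xrightarrow{\underline{\upsilon_X}}\frac XG\amalg\frac YH\xleftarrow{\underline{\upsilon_Y}}\frac YH$ in $\mathscr C$ the map $(M^*(\underline{\upsilon_X}),M^*(\underline{\upsilon_Y}))\colon M(\frac XG\amalg\frac YH)\to M(\frac XG)\times M(\frac YH)$ is bijective, and $M(\emptyset)$ is a one-element set; (2) for every natural weak pullback with $\underline\gamma\colon\frac WL\to\frac XG$, $\underline\delta\colon\frac WL\to\frac YH$ over $\underline\alpha\colon\frac XG\to\frac ZK$, $\underline\beta\colon\frac YH\to\frac ZK$, one has $M^*(\underline\alpha)M_!(\underline\beta)=M_!(\underline\gamma)M^*(\underline\delta)$. *)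

theory Defs
  imports "HOL-Library.FuncSet" "HOL-Algebra.Group_Action"
begin

section \<open>Categories, functors, natural transformations\<close>

text \<open>
  Categories are given by hom-sets indexed by pairs of objects; hom-sets of different pairs need
  not be disjoint, so composition and the action of a functor on arrows also take the objects as
  arguments. \<open>Cmp C x y z g f\<close> is the composite of \<open>f : x \<rightarrow> y\<close> followed by \<open>g : y \<rightarrow> z\<close>.
  As for the structures of HOL-Algebra, values outside the carriers are irrelevant. The maps making up
  functors and transformations are extensional, so that HOL equality of functors and of
  transformations is their actual equality; this is what strictness of a 2-functor refers to.
\<close>

record ('o, 'm) category =
  Ob :: "'o set"
  Hom :: "'o \<Rightarrow> 'o \<Rightarrow> 'm set"
  Cmp :: "'o \<Rightarrow> 'o \<Rightarrow> 'o \<Rightarrow> 'm \<Rightarrow> 'm \<Rightarrow> 'm"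
  Idt :: "'o \<Rightarrow> 'm"

definition is_category :: "('o, 'm) category \<Rightarrow> bool" where
  "is_category C \<longleftrightarrow>
    (\<forall>x\<in>Ob C. Idt C x \<in> Hom C x x) \<and>
    (\<forall>x\<in>Ob C. \<forall>y\<in>Ob C. \<forall>z\<in>Ob C. \<forall>f\<in>Hom C x y. \<forall>g\<in>Hom C y z. Cmp C x y z g f \<in> Hom C x z) \<and>
    (\<forall>x\<in>Ob C. \<forall>y\<in>Ob C. \<forall>f\<in>Hom C x y.
       Cmp C x x y f (Idt C x) = f \<and> Cmp C x y y (Idt C y) f = f) \<and>
    (\<forall>w\<in>Ob C. \<forall>x\<in>Ob C. \<forall>y\<in>Ob C. \<forall>z\<in>Ob C. \<forall>f\<in>Hom C w x. \<forall>g\<in>Hom C x y. \<forall>h\<in>Hom C y z.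
       Cmp C w y z h (Cmp C w x y g f) = Cmp C w x z (Cmp C x y z h g) f)"

definition iso_arrow :: "('o, 'm) category \<Rightarrow> 'o \<Rightarrow> 'o \<Rightarrow> 'm \<Rightarrow> bool" where
  "iso_arrow C x y f \<longleftrightarrow> f \<in> Hom C x y \<and>
    (\<exists>g\<in>Hom C y x. Cmp C x y x g f = Idt C x \<and> Cmp C y x y f g = Idt C y)"

definition op_cat :: "('o, 'm) category \<Rightarrow> ('o, 'm) category" where
  "op_cat C = \<lparr>Ob = Ob C, Hom = (\<lambda>x y. Hom C y x),
     Cmp = (\<lambda>x y z g f. Cmp C z y x f g), Idt = Idt C\<rparr>"

definition prod_cat :: "('o, 'm) category \<Rightarrow> ('p, 'n) category \<Rightarrow> ('o \<times> 'p, 'm \<times> 'n) category" where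
  "prod_cat A B = \<lparr>Ob = Ob A \<times> Ob B,
     Hom = (\<lambda>x y. Hom A (fst x) (fst y) \<times> Hom B (snd x) (snd y)),
     Cmp = (\<lambda>x y z g f. (Cmp A (fst x) (fst y) (fst z) (fst g) (fst f),
                         Cmp B (snd x) (snd y) (snd z) (snd g) (snd f))),
     Idt = (\<lambda>x. (Idt A (fst x), Idt B (snd x)))\<rparr>"

definition one_cat :: "(unit, unit) category" where
  "one_cat = \<lparr>Ob = {()}, Hom = (\<lambda>_ _. {()}), Cmp = (\<lambda>_ _ _ _ _. ()), Idt = (\<lambda>_. ())\<rparr>"

text \<open>The category of subsets of the type \<open>'e\<close>, which plays the role of the universe of \<open>Set\<close>.\<close>

definition set_cat :: "('e set, 'e \<Rightarrow> 'e) category" where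
  "set_cat = \<lparr>Ob = UNIV, Hom = (\<lambda>A B. A \<rightarrow>\<^sub>E B), Cmp = (\<lambda>A B C g f. compose A g f),
     Idt = (\<lambda>A. \<lambda>x\<in>A. x)\<rparr>"

definition is_coproduct ::
  "('o, 'm) category \<Rightarrow> 'o \<Rightarrow> 'o \<Rightarrow> 'o \<Rightarrow> 'm \<Rightarrow> 'm \<Rightarrow> bool" where
  "is_coproduct C x y s i j \<longleftrightarrow>
    x \<in> Ob C \<and> y \<in> Ob C \<and> s \<in> Ob C \<and> i \<in> Hom C x s \<and> j \<in> Hom C y s \<and>
    (\<forall>t\<in>Ob C. \<forall>f\<in>Hom C x t. \<forall>g\<in>Hom C y t.
       \<exists>!h. h \<in> Hom C s t \<and> Cmp C x s t h i = f \<and> Cmp C y s t h j = g)"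

record ('a, 'b, 'c, 'd) cat_functor =
  fdom :: "('a, 'b) category"
  fcod :: "('c, 'd) category"
  fob :: "'a \<Rightarrow> 'c"
  far :: "'a \<Rightarrow> 'a \<Rightarrow> 'b \<Rightarrow> 'd"

definition is_functor :: "('a, 'b, 'c, 'd) cat_functor \<Rightarrow> bool" where
  "is_functor F \<longleftrightarrow>
    is_category (fdom F) \<and> is_category (fcod F) \<and>
    fob F \<in> Ob (fdom F) \<rightarrow>\<^sub>E Ob (fcod F) \<and>
    far F \<in> (\<Pi>\<^sub>E x\<in>Ob (fdom F). \<Pi>\<^sub>E y\<in>Ob (fdom F).
               Hom (fdom F) x y \<rightarrow>\<^sub>E Hom (fcod F) (fob F x) (fob F y)) \<and>
    (\<forall>x\<in>Ob (fdom F). far F x x (Idt (fdom F) x) = Idt (fcod F) (fob F x)) \<and>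
    (\<forall>x\<in>Ob (fdom F). \<forall>y\<in>Ob (fdom F). \<forall>z\<in>Ob (fdom F).
      \<forall>f\<in>Hom (fdom F) x y. \<forall>g\<in>Hom (fdom F) y z.
       far F x z (Cmp (fdom F) x y z g f) =
         Cmp (fcod F) (fob F x) (fob F y) (fob F z) (far F y z g) (far F x y f))"

definition mk_functor ::
  "('a, 'b) category \<Rightarrow> ('c, 'd) category \<Rightarrow> ('a \<Rightarrow> 'c) \<Rightarrow> ('a \<Rightarrow> 'a \<Rightarrow> 'b \<Rightarrow> 'd) \<Rightarrow>
   ('a, 'b, 'c, 'd) cat_functor" where
  "mk_functor A B p q = \<lparr>fdom = A, fcod = B, fob = (\<lambda>x\<in>Ob A. p x),
     far = (\<lambda>x\<in>Ob A. \<lambda>y\<in>Ob A. \<lambda>f\<in>Hom A x y. q x y f)\<rparr>"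

definition fid :: "('a, 'b) category \<Rightarrow> ('a, 'b, 'a, 'b) cat_functor" where
  "fid A = mk_functor A A (\<lambda>x. x) (\<lambda>_ _ f. f)"

definition fcomp ::
  "('c, 'd, 'e, 'f) cat_functor \<Rightarrow> ('a, 'b, 'c, 'd) cat_functor \<Rightarrow> ('a, 'b, 'e, 'f) cat_functor" where
  "fcomp G F = mk_functor (fdom F) (fcod G) (\<lambda>x. fob G (fob F x))
     (\<lambda>x y f. far G (fob F x) (fob F y) (far F x y f))"

text \<open>The functor \<open>(F, G) : A \<rightarrow> B \<times> C\<close> induced by \<open>F : A \<rightarrow> B\<close> and \<open>G : A \<rightarrow> C\<close>.\<close>

definition fpair ::
  "('a, 'b, 'c, 'd) cat_functor \<Rightarrow> ('a, 'b, 'e, 'f) cat_functor \<Rightarrow>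
   ('a, 'b, 'c \<times> 'e, 'd \<times> 'f) cat_functor" where
  "fpair F G = mk_functor (fdom F) (prod_cat (fcod F) (fcod G)) (\<lambda>x. (fob F x, fob G x))
     (\<lambda>x y f. (far F x y f, far G x y f))"

record ('a, 'b, 'c, 'd) nat_trans =
  nsrc :: "('a, 'b, 'c, 'd) cat_functor"
  ntgt :: "('a, 'b, 'c, 'd) cat_functor"
  ncmp :: "'a \<Rightarrow> 'd"

definition is_nat :: "('a, 'b, 'c, 'd) nat_trans \<Rightarrow> bool" where
  "is_nat t \<longleftrightarrow> (let F = nsrc t; G = ntgt t; A = fdom F; B = fcod F in
    is_functor F \<and> is_functor G \<and> fdom G = A \<and> fcod G = B \<and>
    ncmp t \<in> (\<Pi>\<^sub>E x\<in>Ob A. Hom B (fob F x) (fob G x)) \<and>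
    (\<forall>x\<in>Ob A. \<forall>y\<in>Ob A. \<forall>f\<in>Hom A x y.
       Cmp B (fob F x) (fob F y) (fob G y) (ncmp t y) (far F x y f) =
       Cmp B (fob F x) (fob G x) (fob G y) (far G x y f) (ncmp t x)))"

definition is_nat_iso :: "('a, 'b, 'c, 'd) nat_trans \<Rightarrow> bool" where
  "is_nat_iso t \<longleftrightarrow> is_nat t \<and>
    (\<forall>x\<in>Ob (fdom (nsrc t)). iso_arrow (fcod (nsrc t)) (fob (nsrc t) x) (fob (ntgt t) x) (ncmp t x))"

definition nid :: "('a, 'b, 'c, 'd) cat_functor \<Rightarrow> ('a, 'b, 'c, 'd) nat_trans" where
  "nid F = \<lparr>nsrc = F, ntgt = F, ncmp = (\<lambda>x\<in>Ob (fdom F). Idt (fcod F) (fob F x))\<rparr>"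

text \<open>\<open>vcomp s t\<close> is \<open>t\<close> followed by \<open>s\<close>; \<open>whiskL H t\<close> is \<open>H \<circ> t\<close> and \<open>whiskR t K\<close> is \<open>t \<circ> K\<close>.\<close>

definition vcomp ::
  "('a, 'b, 'c, 'd) nat_trans \<Rightarrow> ('a, 'b, 'c, 'd) nat_trans \<Rightarrow> ('a, 'b, 'c, 'd) nat_trans" where
  "vcomp s t = \<lparr>nsrc = nsrc t, ntgt = ntgt s,
     ncmp = (\<lambda>x\<in>Ob (fdom (nsrc t)).
       Cmp (fcod (nsrc t)) (fob (nsrc t) x) (fob (ntgt t) x) (fob (ntgt s) x) (ncmp s x) (ncmp t x))\<rparr>"

definition whiskL ::
  "('c, 'd, 'e, 'f) cat_functor \<Rightarrow> ('a, 'b, 'c, 'd) nat_trans \<Rightarrow> ('a, 'b, 'e, 'f) nat_trans" where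
  "whiskL H t = \<lparr>nsrc = fcomp H (nsrc t), ntgt = fcomp H (ntgt t),
     ncmp = (\<lambda>x\<in>Ob (fdom (nsrc t)). far H (fob (nsrc t) x) (fob (ntgt t) x) (ncmp t x))\<rparr>"

definition whiskR ::
  "('c, 'd, 'e, 'f) nat_trans \<Rightarrow> ('a, 'b, 'c, 'd) cat_functor \<Rightarrow> ('a, 'b, 'e, 'f) nat_trans" where
  "whiskR t K = \<lparr>nsrc = fcomp (nsrc t) K, ntgt = fcomp (ntgt t) K,
     ncmp = (\<lambda>x\<in>Ob (fdom K). ncmp t (fob K x))\<rparr>"

definition is_equivalence :: "('a, 'b, 'c, 'd) cat_functor \<Rightarrow> bool" where
  "is_equivalence F \<longleftrightarrow> is_functor F \<and>
    (\<exists>G s t. is_functor G \<and> fdom G = fcod F \<and> fcod G = fdom F \<and>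
       is_nat_iso s \<and> nsrc s = fcomp G F \<and> ntgt s = fid (fdom F) \<and>
       is_nat_iso t \<and> nsrc t = fcomp F G \<and> ntgt t = fid (fcod F))"

definition equivalent_cats :: "('a, 'b) category \<Rightarrow> ('c, 'd) category \<Rightarrow> bool" where
  "equivalent_cats A B \<longleftrightarrow> (\<exists>F. is_equivalence F \<and> fdom F = A \<and> fcod F = B)"

definition is_iso_functor :: "('a, 'b, 'c, 'd) cat_functor \<Rightarrow> bool" where
  "is_iso_functor F \<longleftrightarrow> is_functor F \<and> bij_betw (fob F) (Ob (fdom F)) (Ob (fcod F)) \<and>
    (\<forall>x\<in>Ob (fdom F). \<forall>y\<in>Ob (fdom F).
       bij_betw (far F x y) (Hom (fdom F) x y) (Hom (fcod F) (fob F x) (fob F y)))"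

text \<open>\<open>is_adjunction L R \<eta> \<epsilon>\<close>: \<open>L\<close> is left adjoint to \<open>R\<close> with unit \<open>\<eta>\<close> and counit \<open>\<epsilon>\<close>.\<close>

definition is_adjunction ::
  "('a, 'b, 'c, 'd) cat_functor \<Rightarrow> ('c, 'd, 'a, 'b) cat_functor \<Rightarrow>
   ('a, 'b, 'a, 'b) nat_trans \<Rightarrow> ('c, 'd, 'c, 'd) nat_trans \<Rightarrow> bool" where
  "is_adjunction L R \<eta> \<epsilon> \<longleftrightarrow>
    is_functor L \<and> is_functor R \<and> fdom R = fcod L \<and> fcod R = fdom L \<and>
    is_nat \<eta> \<and> nsrc \<eta> = fid (fdom L) \<and> ntgt \<eta> = fcomp R L \<and>
    is_nat \<epsilon> \<and> nsrc \<epsilon> = fcomp L R \<and> ntgt \<epsilon> = fid (fdom R) \<and>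
    vcomp (whiskR \<epsilon> L) (whiskL L \<eta>) = nid L \<and>
    vcomp (whiskL R \<epsilon>) (whiskR \<eta> R) = nid R"

section \<open>Isomorphism classes of objects\<close>

definition iso_class :: "('o, 'm) category \<Rightarrow> 'o \<Rightarrow> 'o set" where
  "iso_class C x = {y \<in> Ob C. \<exists>f. iso_arrow C x y f}"

definition iso_classes :: "('o, 'm) category \<Rightarrow> 'o set set" where
  "iso_classes C = iso_class C ` Ob C"

text \<open>On an isomorphism class \<open>c\<close>, the union below is the class of \<open>F x\<close> for any \<open>x \<in> c\<close>.\<close>

definition iso_classes_map :: "('a, 'b, 'c, 'd) cat_functor \<Rightarrow> 'a set \<Rightarrow> 'c set" where
  "iso_classes_map F = (\<lambda>c\<in>iso_classes (fdom F). \<Union>x\<in>c. iso_class (fcod F) (fob F x))"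

section \<open>Finite groupoids and 2-functors on them\<close>

text \<open>
  Finite groupoids have their objects and arrows in a fixed type \<open>'u\<close>. When \<open>'u\<close> is infinite,
  every finite groupoid is isomorphic to one of these.
\<close>

definition fin_groupoid :: "('u, 'u) category \<Rightarrow> bool" where
  "fin_groupoid K \<longleftrightarrow> is_category K \<and> finite (Ob K) \<and>
    (\<forall>x\<in>Ob K. \<forall>y\<in>Ob K. finite (Hom K x y) \<and> (\<forall>f\<in>Hom K x y. iso_arrow K x y f))"

definition gpd_functor :: "('u, 'u, 'u, 'u) cat_functor \<Rightarrow> bool" where
  "gpd_functor u \<longleftrightarrow> is_functor u \<and> fin_groupoid (fdom u) \<and> fin_groupoid (fcod u)"

definition gpd_nat :: "('u, 'u, 'u, 'u) nat_trans \<Rightarrow> bool" where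
  "gpd_nat t \<longleftrightarrow> is_nat t \<and> gpd_functor (nsrc t)"

definition finGpd :: "(('u, 'u) category, ('u, 'u, 'u, 'u) cat_functor) category" where
  "finGpd = \<lparr>Ob = {K. fin_groupoid K},
     Hom = (\<lambda>J K. {u. gpd_functor u \<and> fdom u = J \<and> fcod u = K}),
     Cmp = (\<lambda>_ _ _ v u. fcomp v u), Idt = fid\<rparr>"

text \<open>
  The comma category \<open>I/J\<close>: objects are \<open>(x, y, k)\<close> with \<open>k : I x \<rightarrow> J y\<close>, arrows are pairs \<open>(f, g)\<close>
  making the evident square commute. A comma square is a square isomorphic, over the
  two projections and the 2-cell, to this one.
\<close>

definition comma_cat ::
  "('a, 'b, 'e, 'f) cat_functor \<Rightarrow> ('c, 'd, 'e, 'f) cat_functor \<Rightarrow>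
   ('a \<times> 'c \<times> 'f, 'b \<times> 'd) category" where
  "comma_cat I J = (let A = fdom I; B = fdom J; K = fcod I in
    \<lparr>Ob = {(x, y, k). x \<in> Ob A \<and> y \<in> Ob B \<and> k \<in> Hom K (fob I x) (fob J y)},
     Hom = (\<lambda>(x, y, k) (x', y', k'). {(f, g). f \<in> Hom A x x' \<and> g \<in> Hom B y y' \<and>
        Cmp K (fob I x) (fob I x') (fob J y') k' (far I x x' f) =
        Cmp K (fob I x) (fob J y) (fob J y') (far J y y' g) k}),
     Cmp = (\<lambda>(x, y, k) (x', y', k') (x'', y'', k'') (f', g') (f, g).
        (Cmp A x x' x'' f' f, Cmp B y y' y'' g' g)),
     Idt = (\<lambda>(x, y, k). (Idt A x, Idt B y))\<rparr>)"

definition comma_comparison ::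
  "('a, 'b, 'e, 'f) cat_functor \<Rightarrow> ('c, 'd, 'e, 'f) cat_functor \<Rightarrow>
   ('l, 'm, 'a, 'b) cat_functor \<Rightarrow> ('l, 'm, 'c, 'd) cat_functor \<Rightarrow> ('l, 'm, 'e, 'f) nat_trans \<Rightarrow>
   ('l, 'm, 'a \<times> 'c \<times> 'f, 'b \<times> 'd) cat_functor" where
  "comma_comparison I J p q l = mk_functor (fdom p) (comma_cat I J)
     (\<lambda>x. (fob p x, fob q x, ncmp l x)) (\<lambda>x y f. (far p x y f, far q x y f))"

definition gpd_comma_square ::
  "('u, 'u, 'u, 'u) cat_functor \<Rightarrow> ('u, 'u, 'u, 'u) cat_functor \<Rightarrow>
   ('u, 'u, 'u, 'u) cat_functor \<Rightarrow> ('u, 'u, 'u, 'u) cat_functor \<Rightarrow>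
   ('u, 'u, 'u, 'u) nat_trans \<Rightarrow> bool" where
  "gpd_comma_square I J p q l \<longleftrightarrow>
    gpd_functor I \<and> gpd_functor J \<and> gpd_functor p \<and> gpd_functor q \<and>
    fcod I = fcod J \<and> fcod p = fdom I \<and> fcod q = fdom J \<and> fdom p = fdom q \<and>
    gpd_nat l \<and> nsrc l = fcomp I p \<and> ntgt l = fcomp J q \<and>
    is_iso_functor (comma_comparison I J p q l)"

text \<open>
  Data of a 2-functor from \<open>finGpd\<^sup>o\<^sup>p\<close> (1-cells reversed) to the 2-category of categories with objects
  in \<open>'o\<close> and arrows in \<open>'m\<close>.
\<close>

record ('u, 'o, 'm) gpd_2functor =
  D0 :: "('u, 'u) category \<Rightarrow> ('o, 'm) category"
  D1 :: "('u, 'u, 'u, 'u) cat_functor \<Rightarrow> ('o, 'm, 'o, 'm) cat_functor"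
  D2 :: "('u, 'u, 'u, 'u) nat_trans \<Rightarrow> ('o, 'm, 'o, 'm) nat_trans"

definition strict_2functor :: "('u, 'o, 'm) gpd_2functor \<Rightarrow> bool" where
  "strict_2functor D \<longleftrightarrow>
    (\<forall>K. fin_groupoid K \<longrightarrow> is_category (D0 D K) \<and> D1 D (fid K) = fid (D0 D K)) \<and>
    (\<forall>u. gpd_functor u \<longrightarrow>
       is_functor (D1 D u) \<and> fdom (D1 D u) = D0 D (fcod u) \<and> fcod (D1 D u) = D0 D (fdom u) \<and>
       D2 D (nid u) = nid (D1 D u)) \<and>
    (\<forall>u v. gpd_functor u \<and> gpd_functor v \<and> fcod u = fdom v \<longrightarrow>
       D1 D (fcomp v u) = fcomp (D1 D u) (D1 D v)) \<and>
    (\<forall>t. gpd_nat t \<longrightarrow>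
       is_nat (D2 D t) \<and> nsrc (D2 D t) = D1 D (nsrc t) \<and> ntgt (D2 D t) = D1 D (ntgt t)) \<and>
    (\<forall>s t. gpd_nat s \<and> gpd_nat t \<and> ntgt t = nsrc s \<longrightarrow>
       D2 D (vcomp s t) = vcomp (D2 D s) (D2 D t)) \<and>
    (\<forall>v t. gpd_functor v \<and> gpd_nat t \<and> fcod (nsrc t) = fdom v \<longrightarrow>
       D2 D (whiskL v t) = whiskR (D2 D t) (D1 D v)) \<and>
    (\<forall>t w. gpd_nat t \<and> gpd_functor w \<and> fcod w = fdom (nsrc t) \<longrightarrow>
       D2 D (whiskR t w) = whiskL (D1 D w) (D2 D t))"

text \<open>
  Given chosen left adjoints \<open>u\<^sub>!\<close> (\<open>shr u\<close>) of \<open>u\<^sup>*\<close> with units \<open>\<eta> u\<close> and counits \<open>\<epsilon> u\<close>, the composite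
  \<open>q\<^sub>! p\<^sup>* \<Rightarrow> q\<^sub>! p\<^sup>* I\<^sup>* I\<^sub>! \<Rightarrow> q\<^sub>! q\<^sup>* J\<^sup>* I\<^sub>! \<Rightarrow> J\<^sup>* I\<^sub>!\<close>.
\<close>

definition lambda_shriek ::
  "('u, 'o, 'm) gpd_2functor \<Rightarrow>
   (('u, 'u, 'u, 'u) cat_functor \<Rightarrow> ('o, 'm, 'o, 'm) cat_functor) \<Rightarrow>
   (('u, 'u, 'u, 'u) cat_functor \<Rightarrow> ('o, 'm, 'o, 'm) nat_trans) \<Rightarrow>
   (('u, 'u, 'u, 'u) cat_functor \<Rightarrow> ('o, 'm, 'o, 'm) nat_trans) \<Rightarrow>
   ('u, 'u, 'u, 'u) cat_functor \<Rightarrow> ('u, 'u, 'u, 'u) cat_functor \<Rightarrow>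
   ('u, 'u, 'u, 'u) cat_functor \<Rightarrow> ('u, 'u, 'u, 'u) cat_functor \<Rightarrow>
   ('u, 'u, 'u, 'u) nat_trans \<Rightarrow> ('o, 'm, 'o, 'm) nat_trans" where
  "lambda_shriek D shr \<eta> \<epsilon> I J p q l =
    vcomp (whiskR (\<epsilon> q) (fcomp (D1 D J) (shr I)))
     (vcomp (whiskL (shr q) (whiskR (D2 D l) (shr I)))
       (whiskL (fcomp (shr q) (D1 D p)) (\<eta> I)))"

section \<open>The 2-category of finite sets with variable finite group action\<close>

text \<open>
  A 0-cell \<open>X/G\<close>. In \<open>group_action G X \<phi>\<close> the map \<open>\<phi>\<close> is a homomorphism from \<open>G\<close> to
  the bijections of \<open>X\<close>, i.e. a left action \<open>g x = \<phi> g x\<close>.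
\<close>

record 'u cell0 =
  grp :: "'u monoid"
  pts :: "'u set"
  act :: "'u \<Rightarrow> 'u \<Rightarrow> 'u"

definition is_cell0 :: "'u cell0 \<Rightarrow> bool" where
  "is_cell0 X \<longleftrightarrow> group (grp X) \<and> finite (carrier (grp X)) \<and> finite (pts X) \<and>
    group_action (grp X) (pts X) (act X)"

record 'u cell1 =
  dom1 :: "'u cell0"
  cod1 :: "'u cell0"
  map1 :: "'u \<Rightarrow> 'u"
  tw1 :: "'u \<Rightarrow> 'u \<Rightarrow> 'u" \<comment> \<open>\<open>tw1 a x g\<close> is \<open>\<theta>\<^sub>x(g)\<close>\<close>

definition is_cell1 :: "'u cell1 \<Rightarrow> bool" where
  "is_cell1 a \<longleftrightarrow> (let X = dom1 a; Y = cod1 a; G = grp X; H = grp Y in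
    is_cell0 X \<and> is_cell0 Y \<and>
    map1 a \<in> pts X \<rightarrow>\<^sub>E pts Y \<and>
    tw1 a \<in> pts X \<rightarrow>\<^sub>E (carrier G \<rightarrow>\<^sub>E carrier H) \<and>
    (\<forall>x\<in>pts X. \<forall>g\<in>carrier G. map1 a (act X g x) = act Y (tw1 a x g) (map1 a x)) \<and>
    (\<forall>x\<in>pts X. \<forall>g\<in>carrier G. \<forall>g'\<in>carrier G.
       tw1 a x (g \<otimes>\<^bsub>G\<^esub> g') = tw1 a (act X g' x) g \<otimes>\<^bsub>H\<^esub> tw1 a x g'))"

definition id1 :: "'u cell0 \<Rightarrow> 'u cell1" where
  "id1 X = \<lparr>dom1 = X, cod1 = X, map1 = (\<lambda>x\<in>pts X. x),
     tw1 = (\<lambda>x\<in>pts X. \<lambda>g\<in>carrier (grp X). g)\<rparr>"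

definition comp1 :: "'u cell1 \<Rightarrow> 'u cell1 \<Rightarrow> 'u cell1" where
  "comp1 b a = \<lparr>dom1 = dom1 a, cod1 = cod1 b, map1 = (\<lambda>x\<in>pts (dom1 a). map1 b (map1 a x)),
     tw1 = (\<lambda>x\<in>pts (dom1 a). \<lambda>g\<in>carrier (grp (dom1 a)). tw1 b (map1 a x) (tw1 a x g))\<rparr>"

record 'u cell2 =
  src2 :: "'u cell1"
  tgt2 :: "'u cell1"
  cmp2 :: "'u \<Rightarrow> 'u"

definition is_cell2 :: "'u cell2 \<Rightarrow> bool" where
  "is_cell2 e \<longleftrightarrow> (let a = src2 e; a' = tgt2 e; X = dom1 a; Y = cod1 a; H = grp Y in
    is_cell1 a \<and> is_cell1 a' \<and> dom1 a' = X \<and> cod1 a' = Y \<and>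
    cmp2 e \<in> pts X \<rightarrow>\<^sub>E carrier H \<and>
    (\<forall>x\<in>pts X. map1 a' x = act Y (cmp2 e x) (map1 a x)) \<and>
    (\<forall>x\<in>pts X. \<forall>g\<in>carrier (grp X).
       cmp2 e (act X g x) \<otimes>\<^bsub>H\<^esub> tw1 a x g \<otimes>\<^bsub>H\<^esub> inv\<^bsub>H\<^esub> (cmp2 e x) = tw1 a' x g))"

definition vcomp2 :: "'u cell2 \<Rightarrow> 'u cell2 \<Rightarrow> 'u cell2" where
  "vcomp2 e' e = \<lparr>src2 = src2 e, tgt2 = tgt2 e',
     cmp2 = (\<lambda>x\<in>pts (dom1 (src2 e)). cmp2 e' x \<otimes>\<^bsub>grp (cod1 (src2 e))\<^esub> cmp2 e x)\<rparr>"

definition whiskL2 :: "'u cell1 \<Rightarrow> 'u cell2 \<Rightarrow> 'u cell2" where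
  "whiskL2 b e = \<lparr>src2 = comp1 b (src2 e), tgt2 = comp1 b (tgt2 e),
     cmp2 = (\<lambda>x\<in>pts (dom1 (src2 e)). tw1 b (map1 (src2 e) x) (cmp2 e x))\<rparr>"

definition whiskR2 :: "'u cell2 \<Rightarrow> 'u cell1 \<Rightarrow> 'u cell2" where
  "whiskR2 r a = \<lparr>src2 = comp1 (src2 r) a, tgt2 = comp1 (tgt2 r) a,
     cmp2 = (\<lambda>x\<in>pts (dom1 a). cmp2 r (map1 a x))\<rparr>"

text \<open>
  Bipullbacks, by their universal property: \<open>k : a c \<Rightarrow> b d\<close> is a bipullback of \<open>a\<close> and \<open>b\<close> if every
  2-cell \<open>f : a s \<Rightarrow> b t\<close> is induced, up to (invertible) 2-cells \<open>m, n\<close>, by some \<open>h\<close>, and compatible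
  pairs of 2-cells \<open>c h \<Rightarrow> c h'\<close>, \<open>d h \<Rightarrow> d h'\<close> are induced by unique 2-cells \<open>h \<Rightarrow> h'\<close>.
\<close>

definition is_bipullback ::
  "'u cell1 \<Rightarrow> 'u cell1 \<Rightarrow> 'u cell1 \<Rightarrow> 'u cell1 \<Rightarrow> 'u cell2 \<Rightarrow> bool" where
  "is_bipullback a b c d k \<longleftrightarrow>
    is_cell1 a \<and> is_cell1 b \<and> is_cell1 c \<and> is_cell1 d \<and>
    cod1 a = cod1 b \<and> cod1 c = dom1 a \<and> cod1 d = dom1 b \<and> dom1 c = dom1 d \<and>
    is_cell2 k \<and> src2 k = comp1 a c \<and> tgt2 k = comp1 b d \<and>
    (\<forall>s t f. is_cell1 s \<and> is_cell1 t \<and> dom1 s = dom1 t \<and> cod1 s = dom1 a \<and> cod1 t = dom1 b \<and>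
       is_cell2 f \<and> src2 f = comp1 a s \<and> tgt2 f = comp1 b t \<longrightarrow>
       (\<exists>h m n. is_cell1 h \<and> dom1 h = dom1 s \<and> cod1 h = dom1 c \<and>
          is_cell2 m \<and> src2 m = comp1 c h \<and> tgt2 m = s \<and>
          is_cell2 n \<and> src2 n = comp1 d h \<and> tgt2 n = t \<and>
          vcomp2 f (whiskL2 a m) = vcomp2 (whiskL2 b n) (whiskR2 k h))) \<and>
    (\<forall>h h' m n. is_cell1 h \<and> is_cell1 h' \<and> dom1 h = dom1 h' \<and> cod1 h = dom1 c \<and> cod1 h' = dom1 c \<and>
       is_cell2 m \<and> src2 m = comp1 c h \<and> tgt2 m = comp1 c h' \<and>
       is_cell2 n \<and> src2 n = comp1 d h \<and> tgt2 n = comp1 d h' \<and>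
       vcomp2 (whiskR2 k h') (whiskL2 a m) = vcomp2 (whiskL2 b n) (whiskR2 k h) \<longrightarrow>
       (\<exists>!r. is_cell2 r \<and> src2 r = h \<and> tgt2 r = h' \<and> whiskL2 c r = m \<and> whiskL2 d r = n))"

text \<open>The 2-functor from 0-cells and 1-cells to finite groupoids (action groupoids).\<close>

definition E0 :: "'u cell0 \<Rightarrow> ('u, 'u) category" where
  "E0 X = \<lparr>Ob = pts X, Hom = (\<lambda>x x'. {g \<in> carrier (grp X). act X g x = x'}),
     Cmp = (\<lambda>_ _ _ g' g. g' \<otimes>\<^bsub>grp X\<^esub> g), Idt = (\<lambda>_. \<one>\<^bsub>grp X\<^esub>)\<rparr>"

definition E1 :: "'u cell1 \<Rightarrow> ('u, 'u, 'u, 'u) cat_functor" where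
  "E1 a = mk_functor (E0 (dom1 a)) (E0 (cod1 a)) (map1 a) (\<lambda>x _ g. tw1 a x g)"

section \<open>The category of 0-cells and classes of 1-cells; semi-Mackey functors\<close>

definition class1 :: "'u cell1 \<Rightarrow> 'u cell1 set" where
  "class1 a = {a'. \<exists>e. is_cell2 e \<and> src2 e = a \<and> tgt2 e = a'}"

definition scat :: "('u cell0, 'u cell1 set) category" where
  "scat = \<lparr>Ob = {X. is_cell0 X},
     Hom = (\<lambda>X Y. {class1 a | a. is_cell1 a \<and> dom1 a = X \<and> cod1 a = Y}),
     Cmp = (\<lambda>_ _ _ B A. \<Union>b\<in>B. \<Union>a\<in>A. class1 (comp1 b a)),
     Idt = (\<lambda>X. class1 (id1 X))\<rparr>"

definition empty_cell0 :: "'u cell0 \<Rightarrow> bool" where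
  "empty_cell0 X \<longleftrightarrow> is_cell0 X \<and> pts X = {} \<and> (\<exists>e. carrier (grp X) = {e})"

text \<open>
  The square of \<open>scat\<close> with \<open>C : W \<rightarrow> X\<close>, \<open>D : W \<rightarrow> Y\<close> over \<open>A : X \<rightarrow> Z\<close>, \<open>B : Y \<rightarrow> Z\<close>
  is the image of a bipullback.
\<close>

definition natural_weak_pullback ::
  "'u cell0 \<Rightarrow> 'u cell0 \<Rightarrow> 'u cell0 \<Rightarrow> 'u cell0 \<Rightarrow>
   'u cell1 set \<Rightarrow> 'u cell1 set \<Rightarrow> 'u cell1 set \<Rightarrow> 'u cell1 set \<Rightarrow> bool" where
  "natural_weak_pullback W X Y Z A B C D \<longleftrightarrow>
    (\<exists>a b c d k. is_bipullback a b c d k \<and>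
       dom1 c = W \<and> dom1 a = X \<and> dom1 b = Y \<and> cod1 a = Z \<and>
       A = class1 a \<and> B = class1 b \<and> C = class1 c \<and> D = class1 d)"

definition semi_mackey ::
  "('u cell0, 'u cell1 set, 'e set, 'e \<Rightarrow> 'e) cat_functor \<Rightarrow>
   ('u cell0, 'u cell1 set, 'e set, 'e \<Rightarrow> 'e) cat_functor \<Rightarrow> bool" where
  "semi_mackey Ml Mu \<longleftrightarrow>
    is_functor Ml \<and> fdom Ml = scat \<and> fcod Ml = set_cat \<and>
    is_functor Mu \<and> fdom Mu = op_cat scat \<and> fcod Mu = set_cat \<and>
    (\<forall>X. is_cell0 X \<longrightarrow> fob Ml X = fob Mu X) \<and>
    (\<forall>X Y S I J. is_coproduct scat X Y S I J \<longrightarrow>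
       bij_betw (\<lambda>m. (far Mu S X I m, far Mu S Y J m)) (fob Mu S) (fob Mu X \<times> fob Mu Y)) \<and>
    (\<forall>Z. empty_cell0 Z \<longrightarrow> (\<exists>m. fob Mu Z = {m})) \<and>
    (\<forall>W X Y Z A B C D. natural_weak_pullback W X Y Z A B C D \<longrightarrow>
       (\<forall>m\<in>fob Mu Y. far Mu Z X A (far Ml Y Z B m) = far Ml W X C (far Mu Y W D m)))"

end

theory Submission
  imports Defs
begin

text \<open>
  A left adjoint is determined objectwise, up to isomorphism, by universal arrows. Since universal arrows
  compose, are carried along natural isomorphisms and are trivial for fully faithful functors, the maps
  on isomorphism classes induced by \<open>u\<^sub>!\<close> are functorial, depend only on the isomorphism class of \<open>u\<close> and
  invert \<open>u\<^sup>*\<close> when \<open>u\<close> is an equivalence. The action groupoid of the explicit comma cell is a comma square,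
  so that (iii) yields the Mackey condition for it; any bipullback is equivalent to a comma cell and
  therefore satisfies the condition too. For coproducts, two cells are first inflated to a common group,
  where the coproduct is a disjoint union of sets and (i) applies; any other coproduct in the category of
  cells is isomorphic to this one.
\<close>

section \<open>Categories up to isomorphism\<close>

text \<open>Passing to isomorphism classes discards all coherence: an isomorphism at each single
  object is enough, with no naturality, so no calculus of mates is developed. A universal arrow out
  of \<open>x\<close> pins down \<open>u\<^sub>! x\<close> by itself, whichever adjoint has been
  chosen. Two mismatches shape the rest. The Mackey condition speaks of a square known only by a
  universal property, with a 2-cell \<open>a c \<Rightarrow> b d\<close>, whereas (iii) speaks of
  squares isomorphic to a comma category; taking \<open>I = E1 b\<close> and \<open>J = E1 a\<close>
  makes \<open>J\<^sup>* I\<^sub>!\<close> the required side, at the price of reversing the 2-cell.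
  Condition (1) starts from a coproduct in \<open>scat\<close>, whose arrows are classes, while (i)
  asks for a strict coproduct of groupoids. Each time a model that fits the hypothesis strictly is
  joined to the given cell by an equivalence of cells, along which \<open>pull\<close> is bijective
  and \<open>push\<close> undoes it. All products of groups and of sets must stay inside the one
  type \<open>'u\<close>; since it is infinite, an injection of \<open>'u \<times> 'u\<close> into
  \<open>'u\<close> encodes them.\<close>

lemma cat_id: "is_category C \<Longrightarrow> x \<in> Ob C \<Longrightarrow> Idt C x \<in> Hom C x x"
  by (simp add: is_category_def)

lemma cat_comp:
  "is_category C \<Longrightarrow> x \<in> Ob C \<Longrightarrow> y \<in> Ob C \<Longrightarrow> z \<in> Ob C \<Longrightarrow> f \<in> Hom C x y \<Longrightarrow> g \<in> Hom C y z \<Longrightarrow>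
    Cmp C x y z g f \<in> Hom C x z"
  by (simp add: is_category_def)

lemma cat_idr:
  "is_category C \<Longrightarrow> x \<in> Ob C \<Longrightarrow> y \<in> Ob C \<Longrightarrow> f \<in> Hom C x y \<Longrightarrow> Cmp C x x y f (Idt C x) = f"
  by (simp add: is_category_def)

lemma cat_idl:
  "is_category C \<Longrightarrow> x \<in> Ob C \<Longrightarrow> y \<in> Ob C \<Longrightarrow> f \<in> Hom C x y \<Longrightarrow> Cmp C x y y (Idt C y) f = f"
  by (simp add: is_category_def)

lemma cat_assoc:
  "is_category C \<Longrightarrow> w \<in> Ob C \<Longrightarrow> x \<in> Ob C \<Longrightarrow> y \<in> Ob C \<Longrightarrow> z \<in> Ob C \<Longrightarrow>
    f \<in> Hom C w x \<Longrightarrow> g \<in> Hom C x y \<Longrightarrow> h \<in> Hom C y z \<Longrightarrow>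
    Cmp C w y z h (Cmp C w x y g f) = Cmp C w x z (Cmp C x y z h g) f"
  by (simp add: is_category_def)

lemma is_categoryI:
  assumes "\<And>x. x \<in> Ob C \<Longrightarrow> Idt C x \<in> Hom C x x"
    and "\<And>x y z f g. x \<in> Ob C \<Longrightarrow> y \<in> Ob C \<Longrightarrow> z \<in> Ob C \<Longrightarrow> f \<in> Hom C x y \<Longrightarrow> g \<in> Hom C y z \<Longrightarrow>
      Cmp C x y z g f \<in> Hom C x z"
    and "\<And>x y f. x \<in> Ob C \<Longrightarrow> y \<in> Ob C \<Longrightarrow> f \<in> Hom C x y \<Longrightarrow> Cmp C x x y f (Idt C x) = f"
    and "\<And>x y f. x \<in> Ob C \<Longrightarrow> y \<in> Ob C \<Longrightarrow> f \<in> Hom C x y \<Longrightarrow> Cmp C x y y (Idt C y) f = f"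
    and "\<And>w x y z f g h. w \<in> Ob C \<Longrightarrow> x \<in> Ob C \<Longrightarrow> y \<in> Ob C \<Longrightarrow> z \<in> Ob C \<Longrightarrow>
      f \<in> Hom C w x \<Longrightarrow> g \<in> Hom C x y \<Longrightarrow> h \<in> Hom C y z \<Longrightarrow>
      Cmp C w y z h (Cmp C w x y g f) = Cmp C w x z (Cmp C x y z h g) f"
  shows "is_category C"
  unfolding is_category_def by (intro conjI ballI; rule assms; assumption)

definition isomorphic :: "('o, 'm) category \<Rightarrow> 'o \<Rightarrow> 'o \<Rightarrow> bool" where
  "isomorphic C x y \<longleftrightarrow> (\<exists>f. iso_arrow C x y f)"

lemma iso_arrowI:
  "f \<in> Hom C x y \<Longrightarrow> g \<in> Hom C y x \<Longrightarrow> Cmp C x y x g f = Idt C x \<Longrightarrow> Cmp C y x y f g = Idt C y \<Longrightarrow>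
    iso_arrow C x y f"
  by (auto simp: iso_arrow_def)

lemma isomorphicI:
  "f \<in> Hom C x y \<Longrightarrow> g \<in> Hom C y x \<Longrightarrow> Cmp C x y x g f = Idt C x \<Longrightarrow> Cmp C y x y f g = Idt C y \<Longrightarrow>
    isomorphic C x y"
  unfolding isomorphic_def by (blast intro: iso_arrowI)

lemma isomorphicE:
  assumes "isomorphic C x y"
  obtains f g where "f \<in> Hom C x y" "g \<in> Hom C y x"
    "Cmp C x y x g f = Idt C x" "Cmp C y x y f g = Idt C y"
  using assms by (auto simp: isomorphic_def iso_arrow_def)

lemma isomorphic_refl: "is_category C \<Longrightarrow> x \<in> Ob C \<Longrightarrow> isomorphic C x x"
  by (rule isomorphicI[of "Idt C x" _ _ _ "Idt C x"]) (auto simp: cat_id cat_idl)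

lemma isomorphic_sym: "isomorphic C x y \<Longrightarrow> isomorphic C y x"
  by (auto elim!: isomorphicE intro: isomorphicI)

lemma isomorphic_trans:
  assumes C: "is_category C" and ob: "x \<in> Ob C" "y \<in> Ob C" "z \<in> Ob C"
    and "isomorphic C x y" "isomorphic C y z"
  shows "isomorphic C x z"
proof -
  obtain f f' where f: "f \<in> Hom C x y" "f' \<in> Hom C y x"
    "Cmp C x y x f' f = Idt C x" "Cmp C y x y f f' = Idt C y"
    using assms(5) by (rule isomorphicE)
  obtain g g' where g: "g \<in> Hom C y z" "g' \<in> Hom C z y"
    "Cmp C y z y g' g = Idt C y" "Cmp C z y z g g' = Idt C z"
    using assms(6) by (rule isomorphicE)
  have 1: "Cmp C x z x (Cmp C z y x f' g') (Cmp C x y z g f) = Idt C x"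
  proof -
    have "Cmp C x z x (Cmp C z y x f' g') (Cmp C x y z g f) =
        Cmp C x y x f' (Cmp C x z y g' (Cmp C x y z g f))"
      using f g ob by (simp add: cat_assoc[OF C, symmetric] cat_comp[OF C])
    also have "Cmp C x z y g' (Cmp C x y z g f) = f"
      using f g ob by (simp add: cat_assoc[OF C] cat_idl[OF C])
    finally show ?thesis using f by simp
  qed
  have 2: "Cmp C z x z (Cmp C x y z g f) (Cmp C z y x f' g') = Idt C z"
  proof -
    have "Cmp C z x z (Cmp C x y z g f) (Cmp C z y x f' g') =
        Cmp C z y z g (Cmp C z x y f (Cmp C z y x f' g'))"
      using f g ob by (simp add: cat_assoc[OF C, symmetric] cat_comp[OF C])
    also have "Cmp C z x y f (Cmp C z y x f' g') = g'"
      using f g ob by (simp add: cat_assoc[OF C] cat_idl[OF C])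
    finally show ?thesis using g by simp
  qed
  show ?thesis
    using 1 2 f g ob by (intro isomorphicI) (auto intro: cat_comp[OF C])
qed

lemma iso_class_iff: "y \<in> iso_class C x \<longleftrightarrow> y \<in> Ob C \<and> isomorphic C x y"
  by (simp add: iso_class_def isomorphic_def)

lemma iso_class_eq_iff:
  assumes "is_category C" "x \<in> Ob C" "y \<in> Ob C"
  shows "iso_class C x = iso_class C y \<longleftrightarrow> isomorphic C x y"
  using assms isomorphic_refl isomorphic_sym isomorphic_trans
  by (smt (verit, ccfv_threshold) iso_class_iff set_eq_iff)

lemma iso_class_in [intro]: "x \<in> Ob C \<Longrightarrow> iso_class C x \<in> iso_classes C"
  by (simp add: iso_classes_def)

lemma iso_classesE:
  assumes "c \<in> iso_classes C" obtains x where "x \<in> Ob C" "c = iso_class C x"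
  using assms by (auto simp: iso_classes_def)

section \<open>Functors\<close>

lemma fun_dom: "is_functor F \<Longrightarrow> is_category (fdom F)"
  and fun_cod: "is_functor F \<Longrightarrow> is_category (fcod F)"
  by (simp_all add: is_functor_def)

lemma fun_ob: "is_functor F \<Longrightarrow> x \<in> Ob (fdom F) \<Longrightarrow> fob F x \<in> Ob (fcod F)"
  by (auto simp: is_functor_def)

lemma fun_ar:
  "is_functor F \<Longrightarrow> x \<in> Ob (fdom F) \<Longrightarrow> y \<in> Ob (fdom F) \<Longrightarrow> f \<in> Hom (fdom F) x y \<Longrightarrow>
    far F x y f \<in> Hom (fcod F) (fob F x) (fob F y)"
  unfolding is_functor_def by (elim conjE) (drule PiE_mem, assumption, drule PiE_mem, auto)

lemma fun_id: "is_functor F \<Longrightarrow> x \<in> Ob (fdom F) \<Longrightarrow> far F x x (Idt (fdom F) x) = Idt (fcod F) (fob F x)"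
  by (simp add: is_functor_def)

lemma fun_comp:
  "is_functor F \<Longrightarrow> x \<in> Ob (fdom F) \<Longrightarrow> y \<in> Ob (fdom F) \<Longrightarrow> z \<in> Ob (fdom F) \<Longrightarrow>
    f \<in> Hom (fdom F) x y \<Longrightarrow> g \<in> Hom (fdom F) y z \<Longrightarrow>
    far F x z (Cmp (fdom F) x y z g f) =
      Cmp (fcod F) (fob F x) (fob F y) (fob F z) (far F y z g) (far F x y f)"
  by (simp add: is_functor_def)

text \<open>Object and arrow maps are extensional in every argument, so values on the carriers
  decide HOL equality. This turns the pointwise laws of \<open>E1\<close> into the equalities that
  strictness of \<open>D\<close> speaks of.\<close>

lemma functor_eqI:
  assumes "is_functor F" "is_functor G" "fdom F = fdom G" "fcod F = fcod G"
    and ob: "\<And>x. x \<in> Ob (fdom F) \<Longrightarrow> fob F x = fob G x"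
    and ar: "\<And>x y f. x \<in> Ob (fdom F) \<Longrightarrow> y \<in> Ob (fdom F) \<Longrightarrow> f \<in> Hom (fdom F) x y \<Longrightarrow>
      far F x y f = far G x y f"
  shows "F = G"
proof -
  let ?A = "fdom F"
  have F: "far F \<in> (\<Pi>\<^sub>E x\<in>Ob ?A. \<Pi>\<^sub>E y\<in>Ob ?A. Hom ?A x y \<rightarrow>\<^sub>E Hom (fcod F) (fob F x) (fob F y))"
    "fob F \<in> Ob ?A \<rightarrow>\<^sub>E Ob (fcod F)"
    using assms(1) by (auto simp only: is_functor_def)
  have G: "far G \<in> (\<Pi>\<^sub>E x\<in>Ob ?A. \<Pi>\<^sub>E y\<in>Ob ?A. Hom ?A x y \<rightarrow>\<^sub>E Hom (fcod F) (fob G x) (fob G y))"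
    "fob G \<in> Ob ?A \<rightarrow>\<^sub>E Ob (fcod F)"
    using assms(2-4) by (auto simp only: is_functor_def)
  have o: "fob F = fob G" by (rule PiE_ext[OF F(2) G(2)]) (rule ob)
  note G = G(1)[folded o]
  have "far F = far G"
  proof (rule PiE_ext[OF F(1) G(1)])
    fix x assume x: "x \<in> Ob ?A"
    show "far F x = far G x"
    proof (rule PiE_ext[OF PiE_mem[OF F(1) x] PiE_mem[OF G(1) x]])
      fix y assume y: "y \<in> Ob ?A"
      show "far F x y = far G x y"
        by (rule PiE_ext[OF PiE_mem[OF PiE_mem[OF F(1) x] y] PiE_mem[OF PiE_mem[OF G(1) x] y]])
          (rule ar[OF x y])
    qed
  qed
  with o show ?thesis using assms(3,4) by simp
qed

lemma mk_functor_simps [simp]: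
  "fdom (mk_functor A B p q) = A" "fcod (mk_functor A B p q) = B"
  "x \<in> Ob A \<Longrightarrow> fob (mk_functor A B p q) x = p x"
  "x \<in> Ob A \<Longrightarrow> y \<in> Ob A \<Longrightarrow> f \<in> Hom A x y \<Longrightarrow> far (mk_functor A B p q) x y f = q x y f"
  by (simp_all add: mk_functor_def)

lemma is_functor_mk:
  assumes "is_category A" "is_category B"
    and "\<And>x. x \<in> Ob A \<Longrightarrow> p x \<in> Ob B"
    and "\<And>x y f. x \<in> Ob A \<Longrightarrow> y \<in> Ob A \<Longrightarrow> f \<in> Hom A x y \<Longrightarrow> q x y f \<in> Hom B (p x) (p y)"
    and "\<And>x. x \<in> Ob A \<Longrightarrow> q x x (Idt A x) = Idt B (p x)"
    and "\<And>x y z f g. x \<in> Ob A \<Longrightarrow> y \<in> Ob A \<Longrightarrow> z \<in> Ob A \<Longrightarrow> f \<in> Hom A x y \<Longrightarrow> g \<in> Hom A y z \<Longrightarrow>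
      q x z (Cmp A x y z g f) = Cmp B (p x) (p y) (p z) (q y z g) (q x y f)"
  shows "is_functor (mk_functor A B p q)"
  unfolding is_functor_def mk_functor_def
  using assms by (simp add: restrict_PiE_iff cat_id cat_comp)

lemma fid_simps [simp]:
  "fdom (fid A) = A" "fcod (fid A) = A" "x \<in> Ob A \<Longrightarrow> fob (fid A) x = x"
  "x \<in> Ob A \<Longrightarrow> y \<in> Ob A \<Longrightarrow> f \<in> Hom A x y \<Longrightarrow> far (fid A) x y f = f"
  by (simp_all add: fid_def)

lemma is_functor_fid: "is_category A \<Longrightarrow> is_functor (fid A)"
  unfolding fid_def by (rule is_functor_mk) auto

lemma fcomp_simps [simp]:
  "fdom (fcomp G F) = fdom F" "fcod (fcomp G F) = fcod G"
  "x \<in> Ob (fdom F) \<Longrightarrow> fob (fcomp G F) x = fob G (fob F x)"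
  "x \<in> Ob (fdom F) \<Longrightarrow> y \<in> Ob (fdom F) \<Longrightarrow> f \<in> Hom (fdom F) x y \<Longrightarrow>
    far (fcomp G F) x y f = far G (fob F x) (fob F y) (far F x y f)"
  by (simp_all add: fcomp_def)

lemma is_functor_fcomp:
  assumes "is_functor F" "is_functor G" "fcod F = fdom G"
  shows "is_functor (fcomp G F)"
  unfolding fcomp_def
proof (rule is_functor_mk)
  show "is_category (fdom F)" "is_category (fcod G)" using assms fun_dom fun_cod by auto
  note F = fun_ob[OF assms(1)] fun_ar[OF assms(1)] fun_id[OF assms(1)] fun_comp[OF assms(1)]
  note G = fun_ob[OF assms(2)] fun_ar[OF assms(2)] fun_id[OF assms(2)] fun_comp[OF assms(2)]
  show "\<And>x. x \<in> Ob (fdom F) \<Longrightarrow> fob G (fob F x) \<in> Ob (fcod G)"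
    using F G assms(3) by auto
  show "\<And>x y f. x \<in> Ob (fdom F) \<Longrightarrow> y \<in> Ob (fdom F) \<Longrightarrow> f \<in> Hom (fdom F) x y \<Longrightarrow>
       far G (fob F x) (fob F y) (far F x y f) \<in> Hom (fcod G) (fob G (fob F x)) (fob G (fob F y))"
    using F G assms(3) by metis
  show "\<And>x. x \<in> Ob (fdom F) \<Longrightarrow>
         far G (fob F x) (fob F x) (far F x x (Idt (fdom F) x)) = Idt (fcod G) (fob G (fob F x))"
    using F G assms(3) by metis
  show "\<And>x y z f g.
       x \<in> Ob (fdom F) \<Longrightarrow> y \<in> Ob (fdom F) \<Longrightarrow> z \<in> Ob (fdom F) \<Longrightarrow>
       f \<in> Hom (fdom F) x y \<Longrightarrow> g \<in> Hom (fdom F) y z \<Longrightarrow>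
       far G (fob F x) (fob F z) (far F x z (Cmp (fdom F) x y z g f)) =
       Cmp (fcod G) (fob G (fob F x)) (fob G (fob F y)) (fob G (fob F z))
        (far G (fob F y) (fob F z) (far F y z g)) (far G (fob F x) (fob F y) (far F x y f))"
    by (simp add: F G(4) F(1,2)[unfolded assms(3)] assms(3))
qed

section \<open>Functors on isomorphism classes\<close>

lemma isomorphic_fob:
  assumes F: "is_functor F" and ob: "x \<in> Ob (fdom F)" "y \<in> Ob (fdom F)"
    and "isomorphic (fdom F) x y"
  shows "isomorphic (fcod F) (fob F x) (fob F y)"
  using assms(4)
proof (rule isomorphicE)
  fix f g assume fg: "f \<in> Hom (fdom F) x y" "g \<in> Hom (fdom F) y x"
    "Cmp (fdom F) x y x g f = Idt (fdom F) x" "Cmp (fdom F) y x y f g = Idt (fdom F) y"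
  show ?thesis
    by (rule isomorphicI[OF fun_ar[OF F ob fg(1)] fun_ar[OF F ob(2,1) fg(2)]])
      (simp_all add: fun_comp[OF F, symmetric] fun_id[OF F] ob fg)
qed

text \<open>\<open>F\<close> preserves isomorphism, so all members of the class contribute one and
  the same set to the union.\<close>

lemma iso_classes_map_class:
  assumes F: "is_functor F" and x: "x \<in> Ob (fdom F)"
  shows "iso_classes_map F (iso_class (fdom F) x) = iso_class (fcod F) (fob F x)"
proof -
  have *: "y \<in> iso_class (fdom F) x \<Longrightarrow> iso_class (fcod F) (fob F y) = iso_class (fcod F) (fob F x)" for y
    using isomorphic_fob[OF F _ x] x
    by (auto simp: iso_class_iff iso_class_eq_iff[OF fun_cod[OF F]] fun_ob[OF F] isomorphic_sym)
  have "x \<in> iso_class (fdom F) x"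
    using x by (simp add: iso_class_iff isomorphic_refl[OF fun_dom[OF F]])
  with * have "(\<Union>y\<in>iso_class (fdom F) x. iso_class (fcod F) (fob F y)) = iso_class (fcod F) (fob F x)"
    by blast
  then show ?thesis using iso_class_in[OF x] by (simp add: iso_classes_map_def)
qed

lemma iso_classes_map_mem:
  "is_functor F \<Longrightarrow> iso_classes_map F \<in> iso_classes (fdom F) \<rightarrow>\<^sub>E iso_classes (fcod F)"
proof (rule PiE_I)
  fix c assume F: "is_functor F" and c: "c \<in> iso_classes (fdom F)"
  from c show "iso_classes_map F c \<in> iso_classes (fcod F)"
    by (rule iso_classesE) (use F in \<open>simp add: iso_classes_map_class fun_ob iso_class_in\<close>)
qed (simp add: iso_classes_map_def)

lemma iso_classes_map_fid:
  assumes "is_category C"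
  shows "iso_classes_map (fid C) = (\<lambda>c\<in>iso_classes C. c)"
proof
  fix c
  show "iso_classes_map (fid C) c = (\<lambda>c\<in>iso_classes C. c) c"
  proof (cases "c \<in> iso_classes C")
    case True
    then obtain x where "x \<in> Ob C" "c = iso_class C x" by (rule iso_classesE)
    with iso_classes_map_class[OF is_functor_fid[OF assms], of x] True show ?thesis by simp
  qed (simp add: iso_classes_map_def)
qed

lemma iso_classes_map_fcomp:
  assumes "is_functor F" "is_functor G" "fcod F = fdom G"
  shows "iso_classes_map (fcomp G F) = compose (iso_classes (fdom F)) (iso_classes_map G) (iso_classes_map F)"
proof
  fix c
  show "iso_classes_map (fcomp G F) c = compose (iso_classes (fdom F)) (iso_classes_map G) (iso_classes_map F) c"
  proof (cases "c \<in> iso_classes (fdom F)")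
    case True
    then obtain x where x: "x \<in> Ob (fdom F)" "c = iso_class (fdom F) x" by (rule iso_classesE)
    with iso_classes_map_class[OF is_functor_fcomp[OF assms], of x]
      iso_classes_map_class[OF assms(2), of "fob F x"] iso_classes_map_class[OF assms(1), of x] True
    show ?thesis
      using fun_ob[OF assms(1), of x] assms(3) by (simp add: compose_def)
  qed (simp add: iso_classes_map_def compose_def)
qed

text \<open>No naturality is asked of the isomorphisms, since a class only records whether one
  exists. This is why \<open>shr\<close> becomes strictly functorial on classes.\<close>

lemma iso_classes_map_eq:
  assumes "is_functor F" "is_functor G" "fdom F = fdom G" "fcod F = fcod G"
    and iso: "\<And>x. x \<in> Ob (fdom F) \<Longrightarrow> isomorphic (fcod F) (fob F x) (fob G x)"
  shows "iso_classes_map F = iso_classes_map G"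
proof
  fix c
  show "iso_classes_map F c = iso_classes_map G c"
  proof (cases "c \<in> iso_classes (fdom F)")
    case True
    then obtain x where x: "x \<in> Ob (fdom F)" "c = iso_class (fdom F) x" by (rule iso_classesE)
    with iso[OF x(1)] show ?thesis
      using iso_classes_map_class[OF assms(1), of x] iso_classes_map_class[OF assms(2), of x]
        iso_class_eq_iff[OF fun_cod[OF assms(1)], of "fob F x" "fob G x"] assms(3,4)
        fun_ob[OF assms(1), of x] fun_ob[OF assms(2), of x]
      by simp
  qed (simp add: iso_classes_map_def assms(3))
qed

lemma nat_isoD:
  assumes "is_nat_iso t" "nsrc t = F" "ntgt t = G"
  shows "is_functor F" "is_functor G" "fdom F = fdom G" "fcod F = fcod G"
    "x \<in> Ob (fdom F) \<Longrightarrow> isomorphic (fcod F) (fob F x) (fob G x)"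
  using assms by (auto simp: is_nat_iso_def is_nat_def Let_def isomorphic_def)

lemma iso_classes_map_nat_iso:
  assumes "is_nat_iso t"
  shows "iso_classes_map (nsrc t) = iso_classes_map (ntgt t)"
  by (rule iso_classes_map_eq) (use nat_isoD[OF assms refl refl] in auto)

section \<open>Universal arrows\<close>

text \<open>The pair \<open>(z, n)\<close> is an initial object of the category of arrows from
  \<open>x\<close> into \<open>R\<close>: the value at \<open>x\<close> of a left adjoint, described
  without having one at the other objects.\<close>

definition univ_arrow :: "('c, 'd, 'a, 'b) cat_functor \<Rightarrow> 'a \<Rightarrow> 'c \<Rightarrow> 'b \<Rightarrow> bool" where
  "univ_arrow R x z n \<longleftrightarrow> x \<in> Ob (fcod R) \<and> z \<in> Ob (fdom R) \<and> n \<in> Hom (fcod R) x (fob R z) \<and>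
    (\<forall>w\<in>Ob (fdom R). \<forall>f\<in>Hom (fcod R) x (fob R w).
      \<exists>!g. g \<in> Hom (fdom R) z w \<and> Cmp (fcod R) x (fob R z) (fob R w) (far R z w g) n = f)"

text \<open>Each of the two universal arrows factors through the other. Both composites are
  endomorphisms fixing a universal arrow, hence identities.\<close>

lemma univ_arrow_unique:
  assumes R: "is_functor R" and z: "univ_arrow R x z n" and w: "univ_arrow R x w m"
  shows "isomorphic (fdom R) z w"
proof -
  note A = fun_dom[OF R] and B = fun_cod[OF R]
  have ob: "x \<in> Ob (fcod R)" "z \<in> Ob (fdom R)" "w \<in> Ob (fdom R)"
    "n \<in> Hom (fcod R) x (fob R z)" "m \<in> Hom (fcod R) x (fob R w)"
    using z w by (auto simp: univ_arrow_def)
  note ob' = ob fun_ob[OF R ob(2)] fun_ob[OF R ob(3)]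
  obtain g where g: "g \<in> Hom (fdom R) z w"
    "Cmp (fcod R) x (fob R z) (fob R w) (far R z w g) n = m"
    using z ob unfolding univ_arrow_def by blast
  obtain h where h: "h \<in> Hom (fdom R) w z"
    "Cmp (fcod R) x (fob R w) (fob R z) (far R w z h) m = n"
    using w ob unfolding univ_arrow_def by blast
  \<comment> \<open>The identity also fixes \<open>l\<close>, and universality allows only one such
    endomorphism.\<close>
  have id: "k = Idt (fdom R) y"
    if u: "univ_arrow R x y l" and k: "k \<in> Hom (fdom R) y y"
      "Cmp (fcod R) x (fob R y) (fob R y) (far R y y k) l = l" for k y l
  proof -
    have y: "y \<in> Ob (fdom R)" "l \<in> Hom (fcod R) x (fob R y)" using u by (auto simp: univ_arrow_def)
    have "Cmp (fcod R) x (fob R y) (fob R y) (far R y y (Idt (fdom R) y)) l = l"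
      using y ob by (simp add: fun_id[OF R] cat_idl[OF B] fun_ob[OF R])
    moreover have "\<exists>!g. g \<in> Hom (fdom R) y y \<and> Cmp (fcod R) x (fob R y) (fob R y) (far R y y g) l = l"
      using u y unfolding univ_arrow_def by blast
    ultimately show ?thesis using k cat_id[OF A y(1)] by blast
  qed
  show ?thesis
  proof (rule isomorphicI[OF g(1) h(1)])
    show "Cmp (fdom R) z w z h g = Idt (fdom R) z"
      by (rule id[OF z]) (use ob' g h in \<open>simp_all add: cat_comp[OF A] fun_comp[OF R]
        cat_assoc[OF B, symmetric] fun_ar[OF R]\<close>)
    show "Cmp (fdom R) w z w g h = Idt (fdom R) w"
      by (rule id[OF w]) (use ob' g h in \<open>simp_all add: cat_comp[OF A] fun_comp[OF R]
        cat_assoc[OF B, symmetric] fun_ar[OF R]\<close>)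
  qed
qed

lemma univ_arrow_fid: "is_category C \<Longrightarrow> x \<in> Ob C \<Longrightarrow> univ_arrow (fid C) x x (Idt C x)"
  by (auto simp: univ_arrow_def cat_id cat_idr)

text \<open>The value of a composite left adjoint: \<open>f\<close> factors through \<open>n\<close>
  over \<open>S\<close>, and the resulting \<open>h\<close> factors through \<open>m\<close> over
  \<open>R\<close>.\<close>

lemma univ_arrow_fcomp:
  assumes R: "is_functor R" and S: "is_functor S" and RS: "fcod R = fdom S"
    and x: "univ_arrow S x z n" and z: "univ_arrow R z w m"
  shows "univ_arrow (fcomp S R) x w (Cmp (fcod S) x (fob S z) (fob S (fob R w)) (far S z (fob R w) m) n)"
proof -
  note A = fun_dom[OF R] and B = fun_dom[OF S] and C = fun_cod[OF S]
  have ob: "x \<in> Ob (fcod S)" "z \<in> Ob (fdom S)" "w \<in> Ob (fdom R)" "fob R w \<in> Ob (fdom S)"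
    "n \<in> Hom (fcod S) x (fob S z)" "m \<in> Hom (fdom S) z (fob R w)"
    using x z fun_ob[OF R] RS by (auto simp: univ_arrow_def)
  note sob = fun_ob[OF S] and sar = fun_ar[OF S]
  have ex: "\<exists>!g. g \<in> Hom (fdom R) w v \<and>
      Cmp (fcod S) x (fob S (fob R w)) (fob S (fob R v)) (far S (fob R w) (fob R v) (far R w v g))
        (Cmp (fcod S) x (fob S z) (fob S (fob R w)) (far S z (fob R w) m) n) = f"
    if v: "v \<in> Ob (fdom R)" and f: "f \<in> Hom (fcod S) x (fob S (fob R v))" for v f
  proof -
    have Rv: "fob R v \<in> Ob (fdom S)" using v fun_ob[OF R] RS by auto
    have "\<exists>!h. h \<in> Hom (fdom S) z (fob R v) \<and>
        Cmp (fcod S) x (fob S z) (fob S (fob R v)) (far S z (fob R v) h) n = f"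
      using x Rv f by (auto simp: univ_arrow_def)
    then obtain h where h: "h \<in> Hom (fdom S) z (fob R v)"
        "Cmp (fcod S) x (fob S z) (fob S (fob R v)) (far S z (fob R v) h) n = f"
      and hu: "\<And>h'. h' \<in> Hom (fdom S) z (fob R v) \<Longrightarrow>
        Cmp (fcod S) x (fob S z) (fob S (fob R v)) (far S z (fob R v) h') n = f \<Longrightarrow> h' = h"
      by blast
    have "\<exists>!g. g \<in> Hom (fdom R) w v \<and> Cmp (fdom S) z (fob R w) (fob R v) (far R w v g) m = h"
      using z v h unfolding univ_arrow_def RS by blast
    \<comment> \<open>Uniqueness of \<open>h\<close> makes the two factorization problems for
      \<open>g\<close> equivalent, so unique existence is inherited from \<open>R\<close>.\<close>
    moreover have "Cmp (fcod S) x (fob S (fob R w)) (fob S (fob R v)) (far S (fob R w) (fob R v) (far R w v g))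
        (Cmp (fcod S) x (fob S z) (fob S (fob R w)) (far S z (fob R w) m) n) = f \<longleftrightarrow>
        Cmp (fdom S) z (fob R w) (fob R v) (far R w v g) m = h" if g: "g \<in> Hom (fdom R) w v" for g
    proof -
      have Rg: "far R w v g \<in> Hom (fdom S) (fob R w) (fob R v)"
        using fun_ar[OF R ob(3) v g] RS by simp
      have "Cmp (fcod S) x (fob S (fob R w)) (fob S (fob R v)) (far S (fob R w) (fob R v) (far R w v g))
        (Cmp (fcod S) x (fob S z) (fob S (fob R w)) (far S z (fob R w) m) n) =
        Cmp (fcod S) x (fob S z) (fob S (fob R v))
          (far S z (fob R v) (Cmp (fdom S) z (fob R w) (fob R v) (far R w v g) m)) n"
        using ob Rv Rg by (simp add: fun_comp[OF S] cat_assoc[OF C] sob sar)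
      then show ?thesis
        using hu[OF cat_comp[OF B ob(2,4) Rv ob(6) Rg]] h(2) by metis
    qed
    ultimately show ?thesis by blast
  qed
  show ?thesis
    unfolding univ_arrow_def using ob
    by (simp add: ex cat_comp[OF C] sob sar cong: conj_cong)
qed

text \<open>The factorization of \<open>f\<close> through the unit is the transpose of
  \<open>f\<close>. It works by naturality of the unit and the triangle identity on
  \<open>R\<close>; it is unique by naturality of the counit and the triangle identity on
  \<open>L\<close>.\<close>

lemma univ_arrow_adjunction:
  assumes adj: "is_adjunction L R \<eta> \<epsilon>" and x: "x \<in> Ob (fdom L)"
  shows "univ_arrow R x (fob L x) (ncmp \<eta> x)"
proof -
  have L: "is_functor L" and R: "is_functor R" and RL: "fdom R = fcod L" "fcod R = fdom L"
    using adj by (auto simp: is_adjunction_def)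
  \<comment> \<open>One name for each category: \<open>fdom R\<close> and \<open>fcod L\<close> are
    the same, and rewriting needs a single form.\<close>
  define A where "A = fdom L"
  define B where "B = fcod L"
  have d: "fdom L = A" "fcod L = B" "fdom R = B" "fcod R = A" using RL by (simp_all add: A_def B_def)
  have A: "is_category A" and B: "is_category B" using fun_dom[OF L] fun_cod[OF L] d by auto
  note Lob = fun_ob[OF L, unfolded d] and Lar = fun_ar[OF L, unfolded d]
    and Lcomp = fun_comp[OF L, unfolded d]
  note Rob = fun_ob[OF R, unfolded d] and Rar = fun_ar[OF R, unfolded d]
    and Rcomp = fun_comp[OF R, unfolded d]
  have \<eta>: "is_nat \<eta>" "nsrc \<eta> = fid A" "ntgt \<eta> = fcomp R L"
    and \<epsilon>: "is_nat \<epsilon>" "nsrc \<epsilon> = fcomp L R" "ntgt \<epsilon> = fid B"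
    using adj d by (auto simp: is_adjunction_def)
  have \<eta>h: "ncmp \<eta> y \<in> Hom A y (fob R (fob L y))" if "y \<in> Ob A" for y
    using \<eta> that d by (auto simp: is_nat_def Let_def dest!: PiE_mem)
  have \<eta>n: "Cmp A y z (fob R (fob L z)) (ncmp \<eta> z) f =
      Cmp A y (fob R (fob L y)) (fob R (fob L z)) (far R (fob L y) (fob L z) (far L y z f)) (ncmp \<eta> y)"
    if "y \<in> Ob A" "z \<in> Ob A" "f \<in> Hom A y z" for y z f
    using \<eta> that d by (auto simp: is_nat_def Let_def)
  have \<epsilon>h: "ncmp \<epsilon> y \<in> Hom B (fob L (fob R y)) y" if "y \<in> Ob B" for y
    using \<epsilon> that d by (auto simp: is_nat_def Let_def dest!: PiE_mem)
  have \<epsilon>n: "Cmp B (fob L (fob R y)) (fob L (fob R z)) z (ncmp \<epsilon> z)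
        (far L (fob R y) (fob R z) (far R y z f)) = Cmp B (fob L (fob R y)) y z f (ncmp \<epsilon> y)"
    if "y \<in> Ob B" "z \<in> Ob B" "f \<in> Hom B y z" for y z f
    using \<epsilon> that d by (auto simp: is_nat_def Let_def)
  have t1: "Cmp B (fob L y) (fob L (fob R (fob L y))) (fob L y) (ncmp \<epsilon> (fob L y))
      (far L y (fob R (fob L y)) (ncmp \<eta> y)) = Idt B (fob L y)" if y: "y \<in> Ob A" for y
  proof -
    have "ncmp (vcomp (whiskR \<epsilon> L) (whiskL L \<eta>)) y = ncmp (nid L) y"
      using adj by (simp add: is_adjunction_def)
    then show ?thesis
      using y by (simp add: vcomp_def whiskR_def whiskL_def nid_def d \<eta> \<epsilon> Lob)
  qed
  have t2: "Cmp A (fob R y) (fob R (fob L (fob R y))) (fob R y)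
      (far R (fob L (fob R y)) y (ncmp \<epsilon> y)) (ncmp \<eta> (fob R y)) = Idt A (fob R y)" if y: "y \<in> Ob B" for y
  proof -
    have "ncmp (vcomp (whiskL R \<epsilon>) (whiskR \<eta> R)) y = ncmp (nid R) y"
      using adj by (simp add: is_adjunction_def)
    then show ?thesis
      using y by (simp add: vcomp_def whiskR_def whiskL_def nid_def d \<eta> \<epsilon> Rob)
  qed
  have xA: "x \<in> Ob A" using x d by simp
  note ob = xA Lob[OF xA] Rob[OF Lob[OF xA]] Lob[OF Rob[OF Lob[OF xA]]] \<eta>h[OF xA]
  have ex: "\<exists>!g. g \<in> Hom B (fob L x) w \<and>
      Cmp A x (fob R (fob L x)) (fob R w) (far R (fob L x) w g) (ncmp \<eta> x) = f"
    if w: "w \<in> Ob B" and f: "f \<in> Hom A x (fob R w)" for w f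
  proof (rule ex1I)
    note ow = w Rob[OF w] Lob[OF Rob[OF w]] Rob[OF Lob[OF Rob[OF w]]] \<epsilon>h[OF w]
    \<comment> \<open>The transpose: \<open>L f\<close> followed by the counit at
      \<open>w\<close>.\<close>
    let ?g = "Cmp B (fob L x) (fob L (fob R w)) w (ncmp \<epsilon> w) (far L x (fob R w) f)"
    have Lf: "far L x (fob R w) f \<in> Hom B (fob L x) (fob L (fob R w))" using Lar ob ow f by blast
    have "?g \<in> Hom B (fob L x) w" using cat_comp[OF B] ob ow Lf by blast
    moreover have "Cmp A x (fob R (fob L x)) (fob R w) (far R (fob L x) w ?g) (ncmp \<eta> x) = f"
    proof -
      have "Cmp A x (fob R (fob L x)) (fob R w) (far R (fob L x) w ?g) (ncmp \<eta> x) =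
        Cmp A x (fob R (fob L (fob R w))) (fob R w) (far R (fob L (fob R w)) w (ncmp \<epsilon> w))
          (Cmp A x (fob R (fob L x)) (fob R (fob L (fob R w)))
            (far R (fob L x) (fob L (fob R w)) (far L x (fob R w) f)) (ncmp \<eta> x))"
        using ob ow Lf by (simp add: Rcomp Rar cat_assoc[OF A])
      also have "\<dots> = Cmp A x (fob R w) (fob R w) (Cmp A (fob R w) (fob R (fob L (fob R w))) (fob R w)
          (far R (fob L (fob R w)) w (ncmp \<epsilon> w)) (ncmp \<eta> (fob R w))) f"
        using ob ow f by (simp add: \<eta>n[symmetric] cat_assoc[OF A] \<eta>h Rar)
      also have "\<dots> = f" using t2 ow f ob by (simp add: cat_idl[OF A])
      finally show ?thesis .
    qed
    ultimately show "?g \<in> Hom B (fob L x) w \<and>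
      Cmp A x (fob R (fob L x)) (fob R w) (far R (fob L x) w ?g) (ncmp \<eta> x) = f" by blast
    fix g assume g: "g \<in> Hom B (fob L x) w \<and>
      Cmp A x (fob R (fob L x)) (fob R w) (far R (fob L x) w g) (ncmp \<eta> x) = f"
    have Rg: "far R (fob L x) w g \<in> Hom A (fob R (fob L x)) (fob R w)" using Rar ob ow g by blast
    have "?g = Cmp B (fob L x) (fob L (fob R w)) w (ncmp \<epsilon> w)
        (Cmp B (fob L x) (fob L (fob R (fob L x))) (fob L (fob R w))
          (far L (fob R (fob L x)) (fob R w) (far R (fob L x) w g)) (far L x (fob R (fob L x)) (ncmp \<eta> x)))"
      using g ob ow Rg by (metis Lcomp)
    also have "\<dots> = Cmp B (fob L x) (fob L (fob R (fob L x))) w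
        (Cmp B (fob L (fob R (fob L x))) (fob L x) w g (ncmp \<epsilon> (fob L x)))
        (far L x (fob R (fob L x)) (ncmp \<eta> x))"
      using g ob ow Rg by (simp add: cat_assoc[OF B] Lar \<epsilon>n)
    also have "\<dots> = Cmp B (fob L x) (fob L x) w g (Idt B (fob L x))"
      using g ob ow by (simp add: cat_assoc[OF B, symmetric] Lar \<epsilon>h t1)
    also have "\<dots> = g" using g ob ow by (simp add: cat_idr[OF B])
    finally show "g = ?g" by simp
  qed
  show ?thesis unfolding univ_arrow_def d using ob ex by simp
qed

text \<open>Composing with the invertible component at \<open>w\<close> is a bijection from arrows
  into \<open>R w\<close> to arrows into \<open>S w\<close>; by naturality it respects the
  factorizations.\<close>

lemma univ_arrow_nat_iso:
  assumes t: "is_nat_iso t" and u: "univ_arrow (nsrc t) x z n"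
  shows "univ_arrow (ntgt t) x z (Cmp (fcod (nsrc t)) x (fob (nsrc t) z) (fob (ntgt t) z) (ncmp t z) n)"
proof -
  define R where "R = nsrc t"
  define S where "S = ntgt t"
  define A where "A = fdom R"
  define B where "B = fcod R"
  have R: "is_functor R" and S: "is_functor S"
    and d: "fdom R = A" "fcod R = B" "fdom S = A" "fcod S = B"
    using t by (auto simp: is_nat_iso_def is_nat_def Let_def R_def S_def A_def B_def)
  have th: "ncmp t y \<in> Hom B (fob R y) (fob S y)" if "y \<in> Ob A" for y
    using t that by (auto simp: is_nat_iso_def is_nat_def Let_def R_def S_def A_def B_def dest!: PiE_mem)
  have tn: "Cmp B (fob R y) (fob R z) (fob S z) (ncmp t z) (far R y z f) =
       Cmp B (fob R y) (fob S y) (fob S z) (far S y z f) (ncmp t y)"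
    if "y \<in> Ob A" "z \<in> Ob A" "f \<in> Hom A y z" for y z f
    using t that by (auto simp: is_nat_iso_def is_nat_def Let_def R_def S_def A_def B_def)
  have ti: "\<exists>g\<in>Hom B (fob S y) (fob R y). Cmp B (fob R y) (fob S y) (fob R y) g (ncmp t y) = Idt B (fob R y) \<and>
      Cmp B (fob S y) (fob R y) (fob S y) (ncmp t y) g = Idt B (fob S y)" if "y \<in> Ob A" for y
    using t that by (auto simp: is_nat_iso_def iso_arrow_def R_def S_def A_def B_def)
  have C: "is_category A" "is_category B" using fun_dom[OF R] fun_cod[OF R] d by auto
  have ob: "x \<in> Ob B" "z \<in> Ob A" "n \<in> Hom B x (fob R z)"
    and uu: "\<And>w f. w \<in> Ob A \<Longrightarrow> f \<in> Hom B x (fob R w) \<Longrightarrow>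
      \<exists>!g. g \<in> Hom A z w \<and> Cmp B x (fob R z) (fob R w) (far R z w g) n = f"
    using u unfolding univ_arrow_def R_def[symmetric] d by auto
  note Rob = fun_ob[OF R, unfolded d] and Rar = fun_ar[OF R, unfolded d]
    and Sob = fun_ob[OF S, unfolded d] and Sar = fun_ar[OF S, unfolded d]
  have ex: "\<exists>!g. g \<in> Hom A z w \<and> Cmp B x (fob S z) (fob S w) (far S z w g)
      (Cmp B x (fob R z) (fob S z) (ncmp t z) n) = f"
    if w: "w \<in> Ob A" and f: "f \<in> Hom B x (fob S w)" for w f
  proof -
    obtain s where s: "s \<in> Hom B (fob S w) (fob R w)"
      "Cmp B (fob R w) (fob S w) (fob R w) s (ncmp t w) = Idt B (fob R w)"
      "Cmp B (fob S w) (fob R w) (fob S w) (ncmp t w) s = Idt B (fob S w)"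
      using ti[OF w] by blast
    have sf: "Cmp B x (fob S w) (fob R w) s f \<in> Hom B x (fob R w)"
      using cat_comp[OF C(2)] ob w f s Rob Sob by blast
    have "Cmp B x (fob S z) (fob S w) (far S z w g) (Cmp B x (fob R z) (fob S z) (ncmp t z) n) = f \<longleftrightarrow>
        Cmp B x (fob R z) (fob R w) (far R z w g) n = Cmp B x (fob S w) (fob R w) s f" (is "?l = f \<longleftrightarrow> ?r = ?sf")
      if g: "g \<in> Hom A z w" for g
    proof -
      have r: "?r \<in> Hom B x (fob R w)" using cat_comp[OF C(2)] ob w g Rob Rar by blast
      have l: "?l = Cmp B x (fob R w) (fob S w) (ncmp t w) ?r"
        using ob w g by (simp add: cat_assoc[OF C(2)] Rob Rar Sob Sar th tn)
      have "Cmp B x (fob S w) (fob R w) s (Cmp B x (fob R w) (fob S w) (ncmp t w) ?r) = ?r"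
        using ob w r s by (simp add: cat_assoc[OF C(2)] Rob Sob th cat_idl[OF C(2)])
      moreover have "Cmp B x (fob R w) (fob S w) (ncmp t w) ?sf = f"
        using ob w s f by (simp add: cat_assoc[OF C(2)] Rob Sob th cat_idl[OF C(2)])
      ultimately show ?thesis using l by metis
    qed
    then show ?thesis using uu[OF w sf] by blast
  qed
  show ?thesis
    unfolding univ_arrow_def R_def[symmetric] S_def[symmetric] d
    using ob ex by (auto intro!: cat_comp[OF C(2)] Rob Sob th)
qed

text \<open>Exhibiting any universal arrow computes a left adjoint up to isomorphism;
  \<open>push_id1\<close>, \<open>push_comp1\<close>, \<open>push_iso1\<close> and
  \<open>push_pull_equivalence\<close> all rest on this.\<close>

lemma left_adjoint_unique:
  assumes "is_adjunction L R \<eta> \<epsilon>" "univ_arrow R x z n"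
  shows "isomorphic (fdom R) (fob L x) z"
proof -
  have "is_functor R" "x \<in> Ob (fdom L)"
    using assms by (auto simp: is_adjunction_def univ_arrow_def)
  then show ?thesis using univ_arrow_unique univ_arrow_adjunction assms by metis
qed

lemma bij_betwE_ex1: "bij_betw f A B \<Longrightarrow> y \<in> B \<Longrightarrow> \<exists>!x. x \<in> A \<and> f x = y"
  unfolding bij_betw_def inj_on_def by (elim conjE) blast

text \<open>Factoring an arrow \<open>R y \<rightarrow> R w\<close> through the identity means
  finding its preimage under \<open>R\<close>, and there is exactly one.\<close>

lemma univ_arrow_fully_faithful:
  assumes R: "is_functor R" and y: "y \<in> Ob (fdom R)"
    and bij: "\<And>w. w \<in> Ob (fdom R) \<Longrightarrow>
      bij_betw (far R y w) (Hom (fdom R) y w) (Hom (fcod R) (fob R y) (fob R w))"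
  shows "univ_arrow R (fob R y) y (Idt (fcod R) (fob R y))"
proof -
  have "\<exists>!g. g \<in> Hom (fdom R) y w \<and>
      Cmp (fcod R) (fob R y) (fob R y) (fob R w) (far R y w g) (Idt (fcod R) (fob R y)) = f"
    if w: "w \<in> Ob (fdom R)" and f: "f \<in> Hom (fcod R) (fob R y) (fob R w)" for w f
  proof -
    have "\<exists>!g. g \<in> Hom (fdom R) y w \<and> far R y w g = f"
      using bij_betwE_ex1[OF bij[OF w] f] .
    then show ?thesis
      using cat_idr[OF fun_cod[OF R]] y w fun_ob[OF R] fun_ar[OF R] by (metis (no_types, lifting))
  qed
  then show ?thesis
    unfolding univ_arrow_def using y fun_ob[OF R] cat_id[OF fun_cod[OF R]] by blast
qed

section \<open>Equivalences\<close>

text \<open>\<open>f\<close> can be read off from \<open>G (F f)\<close>: naturality determines the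
  composite of \<open>ncmp t x\<close> and \<open>f\<close>, and \<open>ncmp t x\<close> has a right
  inverse.\<close>

lemma nat_iso_id_faithful:
  assumes t: "is_nat_iso t" and st: "nsrc t = fcomp G F" "ntgt t = fid (fdom F)"
    and F: "is_functor F" and ob: "x \<in> Ob (fdom F)" "y \<in> Ob (fdom F)"
  shows "inj_on (far F x y) (Hom (fdom F) x y)"
proof (rule inj_onI)
  fix f g assume fg: "f \<in> Hom (fdom F) x y" "g \<in> Hom (fdom F) x y" "far F x y f = far F x y g"
  let ?A = "fdom F"
  have T: "is_nat t" using t by (simp add: is_nat_iso_def)
  then have GF: "is_functor (fcomp G F)" "fcod G = ?A"
    using st by (auto simp: is_nat_def Let_def)
  note A = fun_dom[OF F]
  have GFx: "fob G (fob F x) \<in> Ob ?A" using fun_ob[OF GF(1), of x] ob GF(2) by simp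
  have n: "Cmp ?A (fob G (fob F x)) (fob G (fob F y)) y (ncmp t y) (far G (fob F x) (fob F y) (far F x y f))
      = Cmp ?A (fob G (fob F x)) x y f (ncmp t x)" if "f \<in> Hom ?A x y" for f
    using T st ob that GF(2) by (auto simp: is_nat_def Let_def)
  have tx: "ncmp t x \<in> Hom ?A (fob G (fob F x)) x"
    using T st ob GF(2) by (auto simp: is_nat_def Let_def dest!: PiE_mem)
  obtain s where s: "s \<in> Hom ?A x (fob G (fob F x))" "Cmp ?A x (fob G (fob F x)) x (ncmp t x) s = Idt ?A x"
    using t st ob GF(2) by (auto simp: is_nat_iso_def iso_arrow_def)
  have "Cmp ?A x (fob G (fob F x)) y (Cmp ?A (fob G (fob F x)) x y f (ncmp t x)) s = f" if "f \<in> Hom ?A x y" for f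
    using cat_assoc[OF A ob(1) GFx ob(1,2) s(1) tx that] cat_idr[OF A ob that] s(2) by simp
  then show "f = g" using fg n by metis
qed

text \<open>Faithfulness comes from \<open>s\<close>. For fullness, \<open>G g\<close> is conjugated
  by \<open>s\<close>, and faithfulness of \<open>G\<close>, which comes from \<open>t\<close>, then
  removes the outer \<open>G\<close>.\<close>

lemma inverse_equivalence_bij_Hom:
  assumes s: "is_nat_iso s" "nsrc s = fcomp G F" "ntgt s = fid (fdom F)"
    and t: "is_nat_iso t" "nsrc t = fcomp F G" "ntgt t = fid (fdom G)"
    and F: "is_functor F" and G: "is_functor G" and FG: "fdom G = fcod F" "fcod G = fdom F"
    and ob: "x \<in> Ob (fdom F)" "y \<in> Ob (fdom F)"
  shows "bij_betw (far F x y) (Hom (fdom F) x y) (Hom (fcod F) (fob F x) (fob F y))"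
proof -
  let ?A = "fdom F" and ?B = "fcod F"
  note A = fun_dom[OF F]
  have ob': "fob F x \<in> Ob (fdom G)" "fob F y \<in> Ob (fdom G)" "fob G (fob F x) \<in> Ob ?A" "fob G (fob F y) \<in> Ob ?A"
    using fun_ob[OF F] fun_ob[OF G] ob FG by auto
  have S: "is_nat s" using s by (simp add: is_nat_iso_def)
  have inj: "inj_on (far F x y) (Hom ?A x y)" by (rule nat_iso_id_faithful[OF s F ob])
  have injG: "inj_on (far G (fob F x) (fob F y)) (Hom (fdom G) (fob F x) (fob F y))"
    by (rule nat_iso_id_faithful[OF t G ob'(1,2)])
  have n: "Cmp ?A (fob G (fob F x)) (fob G (fob F y)) y (ncmp s y) (far G (fob F x) (fob F y) (far F x y f))
      = Cmp ?A (fob G (fob F x)) x y f (ncmp s x)" if "f \<in> Hom ?A x y" for f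
    using S s ob that FG by (auto simp: is_nat_def Let_def)
  have sh: "ncmp s z \<in> Hom ?A (fob G (fob F z)) z" if "z \<in> Ob ?A" for z
    using S s that FG by (auto simp: is_nat_def Let_def dest!: PiE_mem)
  have si: "\<exists>r\<in>Hom ?A z (fob G (fob F z)). Cmp ?A z (fob G (fob F z)) z (ncmp s z) r = Idt ?A z \<and>
      Cmp ?A (fob G (fob F z)) z (fob G (fob F z)) r (ncmp s z) = Idt ?A (fob G (fob F z))" if "z \<in> Ob ?A" for z
    using s that FG by (auto simp: is_nat_iso_def iso_arrow_def)
  have "\<exists>f\<in>Hom ?A x y. far F x y f = g" if g: "g \<in> Hom ?B (fob F x) (fob F y)" for g
  proof -
    obtain r where r: "r \<in> Hom ?A x (fob G (fob F x))"
      "Cmp ?A (fob G (fob F x)) x (fob G (fob F x)) r (ncmp s x) = Idt ?A (fob G (fob F x))"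
      using si[OF ob(1)] by blast
    obtain r' where r': "r' \<in> Hom ?A y (fob G (fob F y))"
      "Cmp ?A (fob G (fob F y)) y (fob G (fob F y)) r' (ncmp s y) = Idt ?A (fob G (fob F y))"
      using si[OF ob(2)] by blast
    have Gg: "far G (fob F x) (fob F y) g \<in> Hom ?A (fob G (fob F x)) (fob G (fob F y))"
      using fun_ar[OF G ob'(1,2)] g FG by simp
    let ?sG = "Cmp ?A (fob G (fob F x)) (fob G (fob F y)) y (ncmp s y) (far G (fob F x) (fob F y) g)"
    \<comment> \<open>\<open>G g\<close> conjugated by \<open>s\<close>: by naturality the only
      possible preimage of \<open>g\<close>.\<close>
    let ?f = "Cmp ?A x (fob G (fob F x)) y ?sG r"
    have sG: "?sG \<in> Hom ?A (fob G (fob F x)) y" using cat_comp[OF A] ob ob' Gg sh by blast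
    have f: "?f \<in> Hom ?A x y" using cat_comp[OF A] ob ob' sG r by blast
    have GFf: "far G (fob F x) (fob F y) (far F x y ?f) \<in> Hom ?A (fob G (fob F x)) (fob G (fob F y))"
      using fun_ar[OF G ob'(1,2)] fun_ar[OF F ob f] FG by simp
    have "Cmp ?A (fob G (fob F x)) (fob G (fob F y)) y (ncmp s y) (far G (fob F x) (fob F y) (far F x y ?f))
        = Cmp ?A (fob G (fob F x)) x y ?f (ncmp s x)" by (rule n[OF f])
    also have "\<dots> = ?sG"
      using ob ob' sG r sh by (simp add: cat_assoc[OF A, symmetric] cat_idr[OF A])
    finally have e: "Cmp ?A (fob G (fob F x)) (fob G (fob F y)) y (ncmp s y) (far G (fob F x) (fob F y) (far F x y ?f)) = ?sG" .
    \<comment> \<open>The component of \<open>s\<close> at \<open>y\<close> is monic, so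
      \<open>e\<close> gives \<open>G (F ?f) = G g\<close>.\<close>
    have canc: "Cmp ?A (fob G (fob F x)) y (fob G (fob F y)) r'
        (Cmp ?A (fob G (fob F x)) (fob G (fob F y)) y (ncmp s y) k) = k"
      if "k \<in> Hom ?A (fob G (fob F x)) (fob G (fob F y))" for k
      using that ob ob' r' sh by (simp add: cat_assoc[OF A] cat_idl[OF A])
    have "far G (fob F x) (fob F y) (far F x y ?f) = far G (fob F x) (fob F y) g"
      using e canc[OF GFf] canc[OF Gg] by metis
    then have "far F x y ?f = g"
      using injG fun_ar[OF F ob f] g FG by (auto simp: inj_on_def)
    then show ?thesis using f by blast
  qed
  then show ?thesis
    using inj fun_ar[OF F ob] by (auto simp: bij_betw_def)
qed

lemma isomorphic_prod_cat:
  "isomorphic (prod_cat A B) (x, y) (x', y') \<longleftrightarrow> isomorphic A x x' \<and> isomorphic B y y'"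
proof
  assume "isomorphic (prod_cat A B) (x, y) (x', y')"
  then show "isomorphic A x x' \<and> isomorphic B y y'"
    by (auto elim!: isomorphicE simp: prod_cat_def intro: isomorphicI)
next
  assume *: "isomorphic A x x' \<and> isomorphic B y y'"
  obtain f g where fg: "f \<in> Hom A x x'" "g \<in> Hom A x' x"
    "Cmp A x x' x g f = Idt A x" "Cmp A x' x x' f g = Idt A x'" using * by (auto elim: isomorphicE)
  obtain h k where hk: "h \<in> Hom B y y'" "k \<in> Hom B y' y"
    "Cmp B y y' y k h = Idt B y" "Cmp B y' y y' h k = Idt B y'" using * by (auto elim: isomorphicE)
  show "isomorphic (prod_cat A B) (x, y) (x', y')"
    by (rule isomorphicI[of "(f, h)" _ _ _ "(g, k)"]) (use fg hk in \<open>simp_all add: prod_cat_def\<close>)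
qed

text \<open>Of an equivalence, isomorphism classes see only the objectwise isomorphisms.\<close>

lemma equivalence_inverse:
  assumes "is_equivalence F"
  obtains G where "is_functor F" "is_functor G" "fdom G = fcod F" "fcod G = fdom F"
    "\<And>x. x \<in> Ob (fdom F) \<Longrightarrow> isomorphic (fdom F) (fob G (fob F x)) x"
    "\<And>y. y \<in> Ob (fcod F) \<Longrightarrow> isomorphic (fcod F) (fob F (fob G y)) y"
proof -
  obtain G s t where G: "is_functor G" "fdom G = fcod F" "fcod G = fdom F"
    and s: "is_nat_iso s" "nsrc s = fcomp G F" "ntgt s = fid (fdom F)"
    and t: "is_nat_iso t" "nsrc t = fcomp F G" "ntgt t = fid (fcod F)"
    using assms by (auto simp: is_equivalence_def)
  show ?thesis
  proof (rule that[OF _ G])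
    show "is_functor F" using assms by (simp add: is_equivalence_def)
    show "isomorphic (fdom F) (fob G (fob F x)) x" if "x \<in> Ob (fdom F)" for x
      using nat_isoD(5)[OF s, of x] that G by simp
    show "isomorphic (fcod F) (fob F (fob G y)) y" if "y \<in> Ob (fcod F)" for y
      using nat_isoD(5)[OF t, of y] that G by simp
  qed
qed

text \<open>Every object \<open>y\<close> is isomorphic to \<open>G (F y)\<close>, and
  \<open>F y\<close> can only be \<open>()\<close>.\<close>

lemma iso_classes_equivalent_one_cat:
  assumes "equivalent_cats C one_cat" and C: "is_category C"
  shows "\<exists>m. iso_classes C = {m}"
proof -
  obtain F where F: "is_equivalence F" "fdom F = C" "fcod F = one_cat"
    using assms by (auto simp: equivalent_cats_def)
  obtain G where G: "is_functor F" "is_functor G" "fdom G = fcod F" "fcod G = fdom F"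
    "\<And>x. x \<in> Ob (fdom F) \<Longrightarrow> isomorphic (fdom F) (fob G (fob F x)) x"
    using equivalence_inverse[OF F(1)] by metis
  have o: "() \<in> Ob (fcod F)" by (simp add: F one_cat_def)
  let ?x = "fob G ()"
  have x: "?x \<in> Ob C" using fun_ob[OF G(2)] G o F by simp
  have "iso_class C y = iso_class C ?x" if "y \<in> Ob C" for y
  proof -
    have "isomorphic C ?x y" using G(5)[of y] that F by simp
    then have "isomorphic C y ?x" by (rule isomorphic_sym)
    then show ?thesis by (simp only: iso_class_eq_iff[OF C that x])
  qed
  then have "iso_classes C = {iso_class C ?x}" using x unfolding iso_classes_def by blast
  then show ?thesis by blast
qed

text \<open>A quasi-inverse \<open>H\<close> gives both halves: injectivity because
  \<open>H (F x, G x)\<close> is isomorphic to \<open>x\<close>, surjectivity because the images of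
  \<open>H (a, b)\<close> are isomorphic to \<open>a\<close> and \<open>b\<close>. Isomorphism in a
  product category is componentwise.\<close>

lemma bij_iso_classes_fpair:
  assumes eq: "is_equivalence (fpair F G)" and F: "is_functor F" and G: "is_functor G"
    and FG: "fdom F = fdom G"
  shows "bij_betw (\<lambda>c. (iso_classes_map F c, iso_classes_map G c)) (iso_classes (fdom F))
    (iso_classes (fcod F) \<times> iso_classes (fcod G))"
proof -
  let ?P = "fpair F G"
  have P: "fdom ?P = fdom F" "fcod ?P = prod_cat (fcod F) (fcod G)"
    "\<And>x. x \<in> Ob (fdom F) \<Longrightarrow> fob ?P x = (fob F x, fob G x)"
    by (simp_all add: fpair_def)
  obtain H where H: "is_functor ?P" "is_functor H" "fdom H = fcod ?P" "fcod H = fdom ?P"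
    "\<And>x. x \<in> Ob (fdom ?P) \<Longrightarrow> isomorphic (fdom ?P) (fob H (fob ?P x)) x"
    "\<And>y. y \<in> Ob (fcod ?P) \<Longrightarrow> isomorphic (fcod ?P) (fob ?P (fob H y)) y"
    using equivalence_inverse[OF eq] by metis
  note A = fun_dom[OF F]
  have FC: "iso_classes_map F (iso_class (fdom F) x) = iso_class (fcod F) (fob F x)"
    and GC: "iso_classes_map G (iso_class (fdom F) x) = iso_class (fcod G) (fob G x)"
    and Fo: "fob F x \<in> Ob (fcod F)" and Go: "fob G x \<in> Ob (fcod G)"
    if "x \<in> Ob (fdom F)" for x
    using iso_classes_map_class[OF F] iso_classes_map_class[OF G] fun_ob[OF F] fun_ob[OF G] that FG by auto
  show ?thesis
    unfolding bij_betw_def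
  proof (rule conjI[OF inj_onI equalityI[OF subsetI subsetI]])
    fix c c' assume c: "c \<in> iso_classes (fdom F)" "c' \<in> iso_classes (fdom F)"
      and e: "(iso_classes_map F c, iso_classes_map G c) = (iso_classes_map F c', iso_classes_map G c')"
    obtain x y where x: "x \<in> Ob (fdom F)" "c = iso_class (fdom F) x"
      and y: "y \<in> Ob (fdom F)" "c' = iso_class (fdom F) y"
      using c by (auto elim!: iso_classesE)
    have "isomorphic (fcod ?P) (fob ?P x) (fob ?P y)"
      using e x y by (simp add: P isomorphic_prod_cat FC GC Fo Go
        iso_class_eq_iff[OF fun_cod[OF F]] iso_class_eq_iff[OF fun_cod[OF G]])
    then have "isomorphic (fdom F) (fob H (fob ?P x)) (fob H (fob ?P y))"
      using isomorphic_fob[OF H(2)] H(3,4) P(1) fun_ob[OF H(1)] x y by metis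
    moreover have "fob H (fob ?P x) \<in> Ob (fdom F)" "fob H (fob ?P y) \<in> Ob (fdom F)"
      using H(3,4) P(1) fun_ob[OF H(1)] fun_ob[OF H(2)] x y by metis+
    ultimately have "isomorphic (fdom F) x y"
      using H(5)[unfolded P(1)] x y isomorphic_trans[OF A] isomorphic_sym by metis
    then show "c = c'" using x y by (simp add: iso_class_eq_iff[OF A])
  next
    fix d assume "d \<in> (\<lambda>c. (iso_classes_map F c, iso_classes_map G c)) ` iso_classes (fdom F)"
    then obtain x where x: "x \<in> Ob (fdom F)" "d = (iso_class (fcod F) (fob F x), iso_class (fcod G) (fob G x))"
      by (auto elim!: iso_classesE simp: FC GC)
    then show "d \<in> iso_classes (fcod F) \<times> iso_classes (fcod G)"
      by (simp add: Fo Go iso_class_in)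
  next
    fix d assume "d \<in> iso_classes (fcod F) \<times> iso_classes (fcod G)"
    then obtain a b where ab: "a \<in> Ob (fcod F)" "b \<in> Ob (fcod G)" "d = (iso_class (fcod F) a, iso_class (fcod G) b)"
      by (auto elim!: iso_classesE)
    let ?x = "fob H (a, b)"
    have o: "(a, b) \<in> Ob (fcod ?P)" using ab by (simp add: P prod_cat_def)
    then have x: "?x \<in> Ob (fdom F)" using fun_ob[OF H(2)] H(3,4) P(1) by metis
    have "isomorphic (fcod F) (fob F ?x) a \<and> isomorphic (fcod G) (fob G ?x) b"
      using H(6)[OF o] x by (simp add: P isomorphic_prod_cat)
    then have "d = (iso_classes_map F (iso_class (fdom F) ?x), iso_classes_map G (iso_class (fdom F) ?x))"
      using x ab by (simp add: FC GC Fo Go iso_class_eq_iff[OF fun_cod[OF F]] iso_class_eq_iff[OF fun_cod[OF G]]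
        isomorphic_sym)
    then show "d \<in> (\<lambda>c. (iso_classes_map F c, iso_classes_map G c)) ` iso_classes (fdom F)"
      by (rule image_eqI) (rule iso_class_in[OF x])
  qed
qed

section \<open>The 2-category of cells\<close>

lemma cell0_group: "is_cell0 X \<Longrightarrow> group (grp X)"
  by (simp add: is_cell0_def)

lemma act_closed: "is_cell0 X \<Longrightarrow> g \<in> carrier (grp X) \<Longrightarrow> x \<in> pts X \<Longrightarrow> act X g x \<in> pts X"
  using group_action.element_image[of "grp X" "pts X" "act X"] by (simp add: is_cell0_def)

lemma act_one: "is_cell0 X \<Longrightarrow> x \<in> pts X \<Longrightarrow> act X \<one>\<^bsub>grp X\<^esub> x = x"
  using fun_cong[OF group_action.id_eq_one[of "grp X" "pts X" "act X"], of x] by (simp add: is_cell0_def)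

lemma act_mult:
  "is_cell0 X \<Longrightarrow> g \<in> carrier (grp X) \<Longrightarrow> h \<in> carrier (grp X) \<Longrightarrow> x \<in> pts X \<Longrightarrow>
    act X (g \<otimes>\<^bsub>grp X\<^esub> h) x = act X g (act X h x)"
  using group_action.composition_rule[of "grp X" "pts X" "act X" x g h] by (simp add: is_cell0_def)

lemma act_inv:
  "is_cell0 X \<Longrightarrow> g \<in> carrier (grp X) \<Longrightarrow> x \<in> pts X \<Longrightarrow> act X (inv\<^bsub>grp X\<^esub> g) (act X g x) = x"
  by (metis act_mult act_one cell0_group group.inv_closed group.l_inv)

text \<open>\<open>group_action\<close> demands a homomorphism into the extensional bijections of
  \<open>pts X\<close>; the action of the inverse element shows bijectivity.\<close>

lemma is_cell0I:
  assumes G: "group (grp X)" and "finite (carrier (grp X))" "finite (pts X)"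
    and cl: "\<And>g x. g \<in> carrier (grp X) \<Longrightarrow> x \<in> pts X \<Longrightarrow> act X g x \<in> pts X"
    and one: "\<And>x. x \<in> pts X \<Longrightarrow> act X \<one>\<^bsub>grp X\<^esub> x = x"
    and mult: "\<And>g h x. g \<in> carrier (grp X) \<Longrightarrow> h \<in> carrier (grp X) \<Longrightarrow> x \<in> pts X \<Longrightarrow>
      act X (g \<otimes>\<^bsub>grp X\<^esub> h) x = act X g (act X h x)"
    and ext: "\<And>g. g \<in> carrier (grp X) \<Longrightarrow> act X g \<in> extensional (pts X)"
  shows "is_cell0 X"
proof -
  interpret G: group "grp X" by (rule G)
  have Bij: "act X g \<in> Bij (pts X)" if g: "g \<in> carrier (grp X)" for g
  proof -
    have "bij_betw (act X g) (pts X) (pts X)"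
    proof (rule bij_betw_byWitness[where f' = "act X (inv\<^bsub>grp X\<^esub> g)"])
      show "\<forall>x\<in>pts X. act X (inv\<^bsub>grp X\<^esub> g) (act X g x) = x"
        using g one mult by (metis G.inv_closed G.l_inv)
      show "\<forall>x\<in>pts X. act X g (act X (inv\<^bsub>grp X\<^esub> g) x) = x"
        using g one mult by (metis G.inv_closed G.r_inv)
    qed (use g cl G.inv_closed in auto)
    then show ?thesis using ext[OF g] by (simp add: Bij_def)
  qed
  have "group_action (grp X) (pts X) (act X)"
    unfolding group_action_def group_hom_def group_hom_axioms_def
  proof (intro conjI G group_BijGroup homI)
    fix g h assume gh: "g \<in> carrier (grp X)" "h \<in> carrier (grp X)"
    have "act X (g \<otimes>\<^bsub>grp X\<^esub> h) = compose (pts X) (act X g) (act X h)"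
      by (rule extensionalityI[OF ext]) (use gh mult in \<open>auto simp: compose_def\<close>)
    then show "act X (g \<otimes>\<^bsub>grp X\<^esub> h) = act X g \<otimes>\<^bsub>BijGroup (pts X)\<^esub> act X h"
      using Bij gh by (simp add: BijGroup_def)
  qed (simp add: Bij BijGroup_def)
  then show ?thesis using assms by (simp add: is_cell0_def)
qed

section \<open>1-cells and their composition\<close>

lemma c1_dom: "is_cell1 a \<Longrightarrow> is_cell0 (dom1 a)"
  and c1_cod: "is_cell1 a \<Longrightarrow> is_cell0 (cod1 a)"
  by (simp_all add: is_cell1_def Let_def)

lemma c1_map: "is_cell1 a \<Longrightarrow> x \<in> pts (dom1 a) \<Longrightarrow> map1 a x \<in> pts (cod1 a)"
  by (auto simp: is_cell1_def Let_def)

lemma c1_tw: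
  "is_cell1 a \<Longrightarrow> x \<in> pts (dom1 a) \<Longrightarrow> g \<in> carrier (grp (dom1 a)) \<Longrightarrow> tw1 a x g \<in> carrier (grp (cod1 a))"
  by (auto simp: is_cell1_def Let_def PiE_iff)

lemma c1_act:
  "is_cell1 a \<Longrightarrow> x \<in> pts (dom1 a) \<Longrightarrow> g \<in> carrier (grp (dom1 a)) \<Longrightarrow>
    map1 a (act (dom1 a) g x) = act (cod1 a) (tw1 a x g) (map1 a x)"
  by (auto simp: is_cell1_def Let_def)

lemma c1_mult:
  "is_cell1 a \<Longrightarrow> x \<in> pts (dom1 a) \<Longrightarrow> g \<in> carrier (grp (dom1 a)) \<Longrightarrow> g' \<in> carrier (grp (dom1 a)) \<Longrightarrow>
    tw1 a x (g \<otimes>\<^bsub>grp (dom1 a)\<^esub> g') = tw1 a (act (dom1 a) g' x) g \<otimes>\<^bsub>grp (cod1 a)\<^esub> tw1 a x g'"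
  by (auto simp: is_cell1_def Let_def)

text \<open>The cocycle identity at the unit, which fixes \<open>x\<close>, makes the value
  idempotent, and a group has only one idempotent.\<close>

lemma c1_one:
  assumes a: "is_cell1 a" and x: "x \<in> pts (dom1 a)"
  shows "tw1 a x \<one>\<^bsub>grp (dom1 a)\<^esub> = \<one>\<^bsub>grp (cod1 a)\<^esub>"
proof -
  interpret G: group "grp (dom1 a)" by (rule cell0_group[OF c1_dom[OF a]])
  interpret H: group "grp (cod1 a)" by (rule cell0_group[OF c1_cod[OF a]])
  have "tw1 a x \<one>\<^bsub>grp (dom1 a)\<^esub> = tw1 a x \<one>\<^bsub>grp (dom1 a)\<^esub> \<otimes>\<^bsub>grp (cod1 a)\<^esub> tw1 a x \<one>\<^bsub>grp (dom1 a)\<^esub>"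
    using c1_mult[OF a x G.one_closed G.one_closed] by (simp add: act_one[OF c1_dom[OF a] x])
  then show ?thesis using c1_tw[OF a x G.one_closed] by simp
qed

lemma is_cell1I:
  assumes "is_cell0 (dom1 a)" "is_cell0 (cod1 a)" "map1 a \<in> extensional (pts (dom1 a))"
    "tw1 a \<in> extensional (pts (dom1 a))"
    "\<And>x. x \<in> pts (dom1 a) \<Longrightarrow> tw1 a x \<in> extensional (carrier (grp (dom1 a)))"
    "\<And>x. x \<in> pts (dom1 a) \<Longrightarrow> map1 a x \<in> pts (cod1 a)"
    "\<And>x g. x \<in> pts (dom1 a) \<Longrightarrow> g \<in> carrier (grp (dom1 a)) \<Longrightarrow> tw1 a x g \<in> carrier (grp (cod1 a))"
    "\<And>x g. x \<in> pts (dom1 a) \<Longrightarrow> g \<in> carrier (grp (dom1 a)) \<Longrightarrow>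
      map1 a (act (dom1 a) g x) = act (cod1 a) (tw1 a x g) (map1 a x)"
    "\<And>x g g'. x \<in> pts (dom1 a) \<Longrightarrow> g \<in> carrier (grp (dom1 a)) \<Longrightarrow> g' \<in> carrier (grp (dom1 a)) \<Longrightarrow>
      tw1 a x (g \<otimes>\<^bsub>grp (dom1 a)\<^esub> g') = tw1 a (act (dom1 a) g' x) g \<otimes>\<^bsub>grp (cod1 a)\<^esub> tw1 a x g'"
  shows "is_cell1 a"
  unfolding is_cell1_def Let_def using assms by (auto simp: PiE_iff)

definition mk1 :: "'u cell0 \<Rightarrow> 'u cell0 \<Rightarrow> ('u \<Rightarrow> 'u) \<Rightarrow> ('u \<Rightarrow> 'u \<Rightarrow> 'u) \<Rightarrow> 'u cell1" where
  "mk1 X Y f \<theta> = \<lparr>dom1 = X, cod1 = Y, map1 = (\<lambda>x\<in>pts X. f x),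
     tw1 = (\<lambda>x\<in>pts X. \<lambda>g\<in>carrier (grp X). \<theta> x g)\<rparr>"

lemma mk1_simps [simp]:
  "dom1 (mk1 X Y f \<theta>) = X" "cod1 (mk1 X Y f \<theta>) = Y"
  "x \<in> pts X \<Longrightarrow> map1 (mk1 X Y f \<theta>) x = f x"
  "x \<in> pts X \<Longrightarrow> g \<in> carrier (grp X) \<Longrightarrow> tw1 (mk1 X Y f \<theta>) x g = \<theta> x g"
  by (simp_all add: mk1_def)

lemma is_cell1_mk1:
  assumes X: "is_cell0 X" and "is_cell0 Y"
    "\<And>x. x \<in> pts X \<Longrightarrow> f x \<in> pts Y"
    "\<And>x g. x \<in> pts X \<Longrightarrow> g \<in> carrier (grp X) \<Longrightarrow> \<theta> x g \<in> carrier (grp Y)"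
    "\<And>x g. x \<in> pts X \<Longrightarrow> g \<in> carrier (grp X) \<Longrightarrow> f (act X g x) = act Y (\<theta> x g) (f x)"
    "\<And>x g g'. x \<in> pts X \<Longrightarrow> g \<in> carrier (grp X) \<Longrightarrow> g' \<in> carrier (grp X) \<Longrightarrow>
      \<theta> x (g \<otimes>\<^bsub>grp X\<^esub> g') = \<theta> (act X g' x) g \<otimes>\<^bsub>grp Y\<^esub> \<theta> x g'"
  shows "is_cell1 (mk1 X Y f \<theta>)"
proof -
  interpret G: group "grp X" by (rule cell0_group[OF X])
  show ?thesis
    by (rule is_cell1I) (use assms act_closed[OF X] in \<open>simp_all add: mk1_def\<close>)
qed

lemma cell1_eqI:
  assumes a: "is_cell1 a" and b: "is_cell1 b" and d: "dom1 a = dom1 b" "cod1 a = cod1 b"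
    and m: "\<And>x. x \<in> pts (dom1 a) \<Longrightarrow> map1 a x = map1 b x"
    and t: "\<And>x g. x \<in> pts (dom1 a) \<Longrightarrow> g \<in> carrier (grp (dom1 a)) \<Longrightarrow> tw1 a x g = tw1 b x g"
  shows "a = b"
proof -
  let ?X = "dom1 a" and ?Y = "cod1 a"
  have A: "map1 a \<in> pts ?X \<rightarrow>\<^sub>E pts ?Y" "tw1 a \<in> pts ?X \<rightarrow>\<^sub>E (carrier (grp ?X) \<rightarrow>\<^sub>E carrier (grp ?Y))"
    using a by (auto simp only: is_cell1_def Let_def)
  have B: "map1 b \<in> pts ?X \<rightarrow>\<^sub>E pts ?Y" "tw1 b \<in> pts ?X \<rightarrow>\<^sub>E (carrier (grp ?X) \<rightarrow>\<^sub>E carrier (grp ?Y))"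
    using b d by (auto simp only: is_cell1_def Let_def)
  have "map1 a = map1 b" by (rule PiE_ext[OF A(1) B(1)]) (rule m)
  moreover have "tw1 a = tw1 b"
  proof (rule PiE_ext[OF A(2) B(2)])
    fix x assume x: "x \<in> pts ?X"
    show "tw1 a x = tw1 b x"
      by (rule PiE_ext[OF PiE_mem[OF A(2) x] PiE_mem[OF B(2) x]]) (rule t[OF x])
  qed
  ultimately show ?thesis using d by simp
qed

lemma id1_eq: "id1 X = mk1 X X (\<lambda>x. x) (\<lambda>_ g. g)"
  by (simp add: id1_def mk1_def)

lemma comp1_eq:
  "comp1 b a = mk1 (dom1 a) (cod1 b) (\<lambda>x. map1 b (map1 a x)) (\<lambda>x g. tw1 b (map1 a x) (tw1 a x g))"
  by (simp add: comp1_def mk1_def)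

lemma id1_simps [simp]:
  "dom1 (id1 X) = X" "cod1 (id1 X) = X" "x \<in> pts X \<Longrightarrow> map1 (id1 X) x = x"
  "x \<in> pts X \<Longrightarrow> g \<in> carrier (grp X) \<Longrightarrow> tw1 (id1 X) x g = g"
  by (simp_all add: id1_eq)

lemma comp1_simps [simp]:
  "dom1 (comp1 b a) = dom1 a" "cod1 (comp1 b a) = cod1 b"
  "x \<in> pts (dom1 a) \<Longrightarrow> map1 (comp1 b a) x = map1 b (map1 a x)"
  "x \<in> pts (dom1 a) \<Longrightarrow> g \<in> carrier (grp (dom1 a)) \<Longrightarrow>
    tw1 (comp1 b a) x g = tw1 b (map1 a x) (tw1 a x g)"
  by (simp_all add: comp1_eq)

lemma is_cell1_id1: "is_cell0 X \<Longrightarrow> is_cell1 (id1 X)"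
  unfolding id1_eq by (rule is_cell1_mk1) auto

lemma is_cell1_comp1:
  assumes a: "is_cell1 a" and b: "is_cell1 b" and ab: "cod1 a = dom1 b"
  shows "is_cell1 (comp1 b a)"
proof -
  note A = c1_map[OF a, unfolded ab] c1_tw[OF a, unfolded ab] c1_act[OF a, unfolded ab] c1_mult[OF a, unfolded ab]
  note B = c1_map[OF b] c1_tw[OF b] c1_act[OF b] c1_mult[OF b]
  show ?thesis
    unfolding comp1_eq by (rule is_cell1_mk1) (use A B c1_dom[OF a] c1_cod[OF b] act_closed[OF c1_dom[OF a]] in simp_all)
qed

lemma comp1_assoc:
  assumes "is_cell1 a" "is_cell1 b" "is_cell1 c" "cod1 a = dom1 b" "cod1 b = dom1 c"
  shows "comp1 c (comp1 b a) = comp1 (comp1 c b) a"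
  by (rule cell1_eqI) (use assms in \<open>simp_all add: is_cell1_comp1 c1_map[OF assms(1), simplified assms(4)]
    c1_tw[OF assms(1), simplified assms(4)]\<close>)

lemma comp1_id1:
  assumes "is_cell1 a"
  shows "comp1 a (id1 (dom1 a)) = a" "comp1 (id1 (cod1 a)) a = a"
  by (rule cell1_eqI; use assms in \<open>simp add: is_cell1_comp1 is_cell1_id1 c1_dom c1_cod c1_map c1_tw\<close>)+

section \<open>2-cells, their inverses and their compositions\<close>

definition mk2 :: "'u cell1 \<Rightarrow> 'u cell1 \<Rightarrow> ('u \<Rightarrow> 'u) \<Rightarrow> 'u cell2" where
  "mk2 a b \<epsilon> = \<lparr>src2 = a, tgt2 = b, cmp2 = (\<lambda>x\<in>pts (dom1 a). \<epsilon> x)\<rparr>"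

lemma mk2_simps [simp]:
  "src2 (mk2 a b \<epsilon>) = a" "tgt2 (mk2 a b \<epsilon>) = b"
  "x \<in> pts (dom1 a) \<Longrightarrow> cmp2 (mk2 a b \<epsilon>) x = \<epsilon> x"
  by (simp_all add: mk2_def)

lemma c2_src: "is_cell2 e \<Longrightarrow> is_cell1 (src2 e)"
  and c2_tgt: "is_cell2 e \<Longrightarrow> is_cell1 (tgt2 e)"
  and c2_dom: "is_cell2 e \<Longrightarrow> dom1 (tgt2 e) = dom1 (src2 e)"
  and c2_cod: "is_cell2 e \<Longrightarrow> cod1 (tgt2 e) = cod1 (src2 e)"
  by (simp_all add: is_cell2_def Let_def)

lemma c2_cmp: "is_cell2 e \<Longrightarrow> x \<in> pts (dom1 (src2 e)) \<Longrightarrow> cmp2 e x \<in> carrier (grp (cod1 (src2 e)))"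
  by (auto simp: is_cell2_def Let_def)

lemma c2_map:
  "is_cell2 e \<Longrightarrow> x \<in> pts (dom1 (src2 e)) \<Longrightarrow>
    map1 (tgt2 e) x = act (cod1 (src2 e)) (cmp2 e x) (map1 (src2 e) x)"
  by (auto simp: is_cell2_def Let_def)

text \<open>Clearing the inverse turns the condition on a 2-cell into a naturality square of action
  groupoids; \<open>is_cell2I\<close> goes the other way.\<close>

lemma c2_nat:
  assumes e: "is_cell2 e" and x: "x \<in> pts (dom1 (src2 e))" and g: "g \<in> carrier (grp (dom1 (src2 e)))"
  shows "cmp2 e (act (dom1 (src2 e)) g x) \<otimes>\<^bsub>grp (cod1 (src2 e))\<^esub> tw1 (src2 e) x g =
    tw1 (tgt2 e) x g \<otimes>\<^bsub>grp (cod1 (src2 e))\<^esub> cmp2 e x"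
proof -
  note a = c2_src[OF e]
  interpret H: group "grp (cod1 (src2 e))" by (rule cell0_group[OF c1_cod[OF a]])
  have "tw1 (tgt2 e) x g = cmp2 e (act (dom1 (src2 e)) g x) \<otimes>\<^bsub>grp (cod1 (src2 e))\<^esub> tw1 (src2 e) x g
      \<otimes>\<^bsub>grp (cod1 (src2 e))\<^esub> inv\<^bsub>grp (cod1 (src2 e))\<^esub> (cmp2 e x)"
    using e x g by (simp add: is_cell2_def Let_def)
  then show ?thesis
    using c2_cmp[OF e x] c2_cmp[OF e act_closed[OF c1_dom[OF a] g x]] c1_tw[OF a x g] by (simp add: H.m_assoc)
qed

lemma is_cell2I:
  assumes a: "is_cell1 (src2 e)" "is_cell1 (tgt2 e)" "dom1 (tgt2 e) = dom1 (src2 e)" "cod1 (tgt2 e) = cod1 (src2 e)"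
    and ext: "cmp2 e \<in> extensional (pts (dom1 (src2 e)))"
    and cmp: "\<And>x. x \<in> pts (dom1 (src2 e)) \<Longrightarrow> cmp2 e x \<in> carrier (grp (cod1 (src2 e)))"
    and "\<And>x. x \<in> pts (dom1 (src2 e)) \<Longrightarrow> map1 (tgt2 e) x = act (cod1 (src2 e)) (cmp2 e x) (map1 (src2 e) x)"
    and nat: "\<And>x g. x \<in> pts (dom1 (src2 e)) \<Longrightarrow> g \<in> carrier (grp (dom1 (src2 e))) \<Longrightarrow>
      cmp2 e (act (dom1 (src2 e)) g x) \<otimes>\<^bsub>grp (cod1 (src2 e))\<^esub> tw1 (src2 e) x g =
      tw1 (tgt2 e) x g \<otimes>\<^bsub>grp (cod1 (src2 e))\<^esub> cmp2 e x"
  shows "is_cell2 e"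
proof -
  interpret H: group "grp (cod1 (src2 e))" by (rule cell0_group[OF c1_cod[OF a(1)]])
  have "cmp2 e (act (dom1 (src2 e)) g x) \<otimes>\<^bsub>grp (cod1 (src2 e))\<^esub> tw1 (src2 e) x g
      \<otimes>\<^bsub>grp (cod1 (src2 e))\<^esub> inv\<^bsub>grp (cod1 (src2 e))\<^esub> (cmp2 e x) = tw1 (tgt2 e) x g"
    if "x \<in> pts (dom1 (src2 e))" "g \<in> carrier (grp (dom1 (src2 e)))" for x g
    using nat[OF that] cmp[OF that(1)] c1_tw[OF a(2), of x g] that a(3,4) by (simp add: H.m_assoc)
  then show ?thesis
    unfolding is_cell2_def Let_def using assms by (simp add: PiE_iff)
qed

lemma is_cell2_mk2:
  assumes a: "is_cell1 a" "is_cell1 b" "dom1 b = dom1 a" "cod1 b = cod1 a"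
    and "\<And>x. x \<in> pts (dom1 a) \<Longrightarrow> \<epsilon> x \<in> carrier (grp (cod1 a))"
    and "\<And>x. x \<in> pts (dom1 a) \<Longrightarrow> map1 b x = act (cod1 a) (\<epsilon> x) (map1 a x)"
    and "\<And>x g. x \<in> pts (dom1 a) \<Longrightarrow> g \<in> carrier (grp (dom1 a)) \<Longrightarrow>
      \<epsilon> (act (dom1 a) g x) \<otimes>\<^bsub>grp (cod1 a)\<^esub> tw1 a x g = tw1 b x g \<otimes>\<^bsub>grp (cod1 a)\<^esub> \<epsilon> x"
  shows "is_cell2 (mk2 a b \<epsilon>)"
  by (rule is_cell2I) (use assms act_closed[OF c1_dom[OF a(1)]] in \<open>simp_all add: mk2_def\<close>)

lemma cell2_eqI:
  assumes "is_cell2 e" "is_cell2 f" "src2 e = src2 f" "tgt2 e = tgt2 f"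
    and "\<And>x. x \<in> pts (dom1 (src2 e)) \<Longrightarrow> cmp2 e x = cmp2 f x"
  shows "e = f"
proof -
  have "cmp2 e = cmp2 f"
    by (rule PiE_ext[where k = "pts (dom1 (src2 e))" and s = "\<lambda>_. carrier (grp (cod1 (src2 e)))"])
      (use assms in \<open>auto simp: is_cell2_def Let_def\<close>)
  with assms show ?thesis by simp
qed

definition iso1 :: "'u cell1 \<Rightarrow> 'u cell1 \<Rightarrow> bool" where
  "iso1 a b \<longleftrightarrow> (\<exists>e. is_cell2 e \<and> src2 e = a \<and> tgt2 e = b)"

lemma iso1E:
  assumes "iso1 a b"
  obtains e where "is_cell2 e" "src2 e = a" "tgt2 e = b"
  using assms by (auto simp: iso1_def)

lemma iso1D:
  assumes "iso1 a b"
  shows "is_cell1 a" "is_cell1 b" "dom1 a = dom1 b" "cod1 a = cod1 b"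
  using assms by (auto elim!: iso1E simp: c2_src c2_tgt c2_dom c2_cod)

lemma iso1_mk2: "is_cell2 (mk2 a b \<epsilon>) \<Longrightarrow> iso1 a b"
  unfolding iso1_def using mk2_simps by blast

lemma iso1_refl:
  assumes "is_cell1 a"
  shows "iso1 a a"
proof -
  interpret H: group "grp (cod1 a)" by (rule cell0_group[OF c1_cod[OF assms]])
  show ?thesis
    by (rule iso1_mk2[where \<epsilon> = "\<lambda>_. \<one>\<^bsub>grp (cod1 a)\<^esub>"], rule is_cell2_mk2)
      (use assms in \<open>simp_all add: act_one c1_cod c1_map c1_tw\<close>)
qed

definition inv2 :: "'u cell2 \<Rightarrow> 'u cell2" where
  "inv2 e = mk2 (tgt2 e) (src2 e) (\<lambda>x. inv\<^bsub>grp (cod1 (src2 e))\<^esub> (cmp2 e x))"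

text \<open>The components are group elements, so they invert pointwise; multiplying the naturality
  square by inverses on both sides gives the reversed square.\<close>

lemma is_cell2_inv2:
  assumes e: "is_cell2 e"
  shows "is_cell2 (inv2 e)"
  unfolding inv2_def
proof (rule is_cell2_mk2)
  note a = c2_src[OF e] and b = c2_tgt[OF e] and d = c2_dom[OF e] c2_cod[OF e]
  interpret H: group "grp (cod1 (src2 e))" by (rule cell0_group[OF c1_cod[OF a]])
  show "is_cell1 (tgt2 e)" "is_cell1 (src2 e)" "dom1 (src2 e) = dom1 (tgt2 e)" "cod1 (src2 e) = cod1 (tgt2 e)"
    using a b d by simp_all
  fix x assume "x \<in> pts (dom1 (tgt2 e))"
  then have x: "x \<in> pts (dom1 (src2 e))" using d by simp
  show "inv\<^bsub>grp (cod1 (src2 e))\<^esub> cmp2 e x \<in> carrier (grp (cod1 (tgt2 e)))"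
    using c2_cmp[OF e x] d by simp
  show "map1 (src2 e) x = act (cod1 (tgt2 e)) (inv\<^bsub>grp (cod1 (src2 e))\<^esub> cmp2 e x) (map1 (tgt2 e) x)"
    using c2_cmp[OF e x] d c2_map[OF e x] c1_map[OF a x] by (simp add: act_inv c1_cod[OF a])
  fix g assume "g \<in> carrier (grp (dom1 (tgt2 e)))"
  then have g: "g \<in> carrier (grp (dom1 (src2 e)))" using d by simp
  have gx: "act (dom1 (src2 e)) g x \<in> pts (dom1 (src2 e))" by (rule act_closed[OF c1_dom[OF a] g x])
  let ?m = "\<lambda>u v. u \<otimes>\<^bsub>grp (cod1 (src2 e))\<^esub> v" and ?i = "\<lambda>u. inv\<^bsub>grp (cod1 (src2 e))\<^esub> u"
  let ?p = "cmp2 e (act (dom1 (src2 e)) g x)" and ?q = "cmp2 e x"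
  note cl = c2_cmp[OF e gx] c2_cmp[OF e x] c1_tw[OF a x g] c1_tw[OF b, of x g, unfolded d, OF x g]
  have "?m (?i ?p) (tw1 (tgt2 e) x g) = ?m (?i ?p) (?m (?m (tw1 (tgt2 e) x g) ?q) (?i ?q))"
    using cl by (simp add: H.m_assoc)
  also have "\<dots> = ?m (?i ?p) (?m (?m ?p (tw1 (src2 e) x g)) (?i ?q))"
    by (simp only: c2_nat[OF e x g])
  also have "\<dots> = ?m (tw1 (src2 e) x g) (?i ?q)"
    using cl by (simp add: H.m_assoc[symmetric])
  finally show "inv\<^bsub>grp (cod1 (src2 e))\<^esub> cmp2 e (act (dom1 (tgt2 e)) g x) \<otimes>\<^bsub>grp (cod1 (tgt2 e))\<^esub> tw1 (tgt2 e) x g =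
       tw1 (src2 e) x g \<otimes>\<^bsub>grp (cod1 (tgt2 e))\<^esub> inv\<^bsub>grp (cod1 (src2 e))\<^esub> cmp2 e x"
    by (simp add: d)
qed

lemma inv2_simps [simp]: "src2 (inv2 e) = tgt2 e" "tgt2 (inv2 e) = src2 e"
  by (simp_all add: inv2_def)

lemma cmp2_inv2: "is_cell2 e \<Longrightarrow> x \<in> pts (dom1 (src2 e)) \<Longrightarrow> cmp2 (inv2 e) x = inv\<^bsub>grp (cod1 (src2 e))\<^esub> (cmp2 e x)"
  by (simp add: inv2_def c2_dom)

lemma vcomp2_eq: "vcomp2 e' e = mk2 (src2 e) (tgt2 e') (\<lambda>x. cmp2 e' x \<otimes>\<^bsub>grp (cod1 (src2 e))\<^esub> cmp2 e x)"
  and whiskL2_eq: "whiskL2 b e = mk2 (comp1 b (src2 e)) (comp1 b (tgt2 e)) (\<lambda>x. tw1 b (map1 (src2 e) x) (cmp2 e x))"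
  and whiskR2_eq: "whiskR2 r a = mk2 (comp1 (src2 r) a) (comp1 (tgt2 r) a) (\<lambda>x. cmp2 r (map1 a x))"
  by (simp_all add: vcomp2_def whiskL2_def whiskR2_def mk2_def comp1_def)

lemma src2_tgt2_comp [simp]:
  "src2 (vcomp2 e' e) = src2 e" "tgt2 (vcomp2 e' e) = tgt2 e'"
  "src2 (whiskL2 b e) = comp1 b (src2 e)" "tgt2 (whiskL2 b e) = comp1 b (tgt2 e)"
  "src2 (whiskR2 r a) = comp1 (src2 r) a" "tgt2 (whiskR2 r a) = comp1 (tgt2 r) a"
  by (simp_all add: vcomp2_def whiskL2_def whiskR2_def)

lemma cmp2_comp [simp]:
  "x \<in> pts (dom1 (src2 e)) \<Longrightarrow> cmp2 (vcomp2 e' e) x = cmp2 e' x \<otimes>\<^bsub>grp (cod1 (src2 e))\<^esub> cmp2 e x"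
  "x \<in> pts (dom1 (src2 e)) \<Longrightarrow> cmp2 (whiskL2 b e) x = tw1 b (map1 (src2 e) x) (cmp2 e x)"
  "x \<in> pts (dom1 a) \<Longrightarrow> cmp2 (whiskR2 r a) x = cmp2 r (map1 a x)"
  by (simp_all add: vcomp2_def whiskL2_def whiskR2_def)

lemma is_cell2_vcomp2:
  assumes e: "is_cell2 e" and e': "is_cell2 e'" and "tgt2 e = src2 e'"
  shows "is_cell2 (vcomp2 e' e)"
  unfolding vcomp2_eq
proof (rule is_cell2_mk2)
  note s = assms(3)[symmetric]
  note a = c2_src[OF e] and b = c2_tgt[OF e] and c = c2_tgt[OF e']
    and d = c2_dom[OF e] c2_cod[OF e] and d' = c2_dom[OF e', unfolded s] c2_cod[OF e', unfolded s]
  interpret H: group "grp (cod1 (src2 e))" by (rule cell0_group[OF c1_cod[OF a]])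
  show "is_cell1 (src2 e)" "is_cell1 (tgt2 e')" "dom1 (tgt2 e') = dom1 (src2 e)" "cod1 (tgt2 e') = cod1 (src2 e)"
    using a c d d' by simp_all
  fix x assume x: "x \<in> pts (dom1 (src2 e))"
  note c' = c2_cmp[OF e', unfolded s d] c2_map[OF e', unfolded s d] c2_nat[OF e', unfolded s d]
  show "cmp2 e' x \<otimes>\<^bsub>grp (cod1 (src2 e))\<^esub> cmp2 e x \<in> carrier (grp (cod1 (src2 e)))"
    using c2_cmp[OF e x] c'(1)[OF x] by simp
  show "map1 (tgt2 e') x = act (cod1 (src2 e)) (cmp2 e' x \<otimes>\<^bsub>grp (cod1 (src2 e))\<^esub> cmp2 e x) (map1 (src2 e) x)"
    using c2_cmp[OF e x] c'(1)[OF x] c2_map[OF e x] c'(2)[OF x] c1_map[OF a x]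
    by (simp add: act_mult c1_cod[OF a])
  fix g assume g: "g \<in> carrier (grp (dom1 (src2 e)))"
  have gx: "act (dom1 (src2 e)) g x \<in> pts (dom1 (src2 e))" by (rule act_closed[OF c1_dom[OF a] g x])
  note cl = c2_cmp[OF e gx] c2_cmp[OF e x] c1_tw[OF a x g] c'(1)[OF gx] c'(1)[OF x]
    c1_tw[OF b, of x g, unfolded d, OF x g] c1_tw[OF c, of x g, unfolded d' d, OF x g]
  let ?m = "\<lambda>u v. u \<otimes>\<^bsub>grp (cod1 (src2 e))\<^esub> v"
  let ?gx = "act (dom1 (src2 e)) g x"
  have "?m (?m (cmp2 e' ?gx) (cmp2 e ?gx)) (tw1 (src2 e) x g) = ?m (cmp2 e' ?gx) (?m (tw1 (tgt2 e) x g) (cmp2 e x))"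
    using cl by (simp add: H.m_assoc c2_nat[OF e x g])
  also have "\<dots> = ?m (?m (tw1 (tgt2 e') x g) (cmp2 e' x)) (cmp2 e x)"
    using cl by (simp add: H.m_assoc[symmetric] c'(3)[OF x g])
  also have "\<dots> = ?m (tw1 (tgt2 e') x g) (?m (cmp2 e' x) (cmp2 e x))"
    using cl by (simp add: H.m_assoc)
  finally show "?m (?m (cmp2 e' ?gx) (cmp2 e ?gx)) (tw1 (src2 e) x g) = ?m (tw1 (tgt2 e') x g) (?m (cmp2 e' x) (cmp2 e x))" .
qed

lemma is_cell2_whiskL2:
  assumes e: "is_cell2 e" and b: "is_cell1 b" and eb: "cod1 (src2 e) = dom1 b"
  shows "is_cell2 (whiskL2 b e)"
  unfolding whiskL2_eq
proof (rule is_cell2_mk2)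
  note a = c2_src[OF e] and a' = c2_tgt[OF e] and d = c2_dom[OF e] c2_cod[OF e, unfolded eb]
  show "is_cell1 (comp1 b (src2 e))" "is_cell1 (comp1 b (tgt2 e))"
    "dom1 (comp1 b (tgt2 e)) = dom1 (comp1 b (src2 e))" "cod1 (comp1 b (tgt2 e)) = cod1 (comp1 b (src2 e))"
    using a a' b d eb by (simp_all add: is_cell1_comp1)
  fix x assume "x \<in> pts (dom1 (comp1 b (src2 e)))"
  then have x: "x \<in> pts (dom1 (src2 e))" by simp
  note A = c1_map[OF a, unfolded eb] c1_tw[OF a, unfolded eb] c1_act[OF a, unfolded eb]
    c1_map[OF a', unfolded d eb] c1_tw[OF a', unfolded d eb] c1_act[OF a', unfolded d eb]
  note c = c2_cmp[OF e, unfolded eb] c2_map[OF e, unfolded eb] c2_nat[OF e, unfolded eb]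
  show "tw1 b (map1 (src2 e) x) (cmp2 e x) \<in> carrier (grp (cod1 (comp1 b (src2 e))))"
    using A c x by (simp add: c1_tw[OF b])
  show "map1 (comp1 b (tgt2 e)) x = act (cod1 (comp1 b (src2 e))) (tw1 b (map1 (src2 e) x) (cmp2 e x)) (map1 (comp1 b (src2 e)) x)"
    using A c x d by (simp add: c1_act[OF b])
  fix g assume "g \<in> carrier (grp (dom1 (comp1 b (src2 e))))"
  then have g: "g \<in> carrier (grp (dom1 (src2 e)))" by simp
  have gx: "act (dom1 (src2 e)) g x \<in> pts (dom1 (src2 e))" by (rule act_closed[OF c1_dom[OF a] g x])
  have "tw1 b (map1 (src2 e) (act (dom1 (src2 e)) g x)) (cmp2 e (act (dom1 (src2 e)) g x)) \<otimes>\<^bsub>grp (cod1 b)\<^esub>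
     tw1 b (map1 (src2 e) x) (tw1 (src2 e) x g)
    = tw1 b (map1 (src2 e) x) (cmp2 e (act (dom1 (src2 e)) g x) \<otimes>\<^bsub>grp (dom1 b)\<^esub> tw1 (src2 e) x g)"
    using A c(1,2) x g gx by (simp add: c1_mult[OF b])
  also have "\<dots> = tw1 b (map1 (src2 e) x) (tw1 (tgt2 e) x g \<otimes>\<^bsub>grp (dom1 b)\<^esub> cmp2 e x)"
    using c(3) x g by simp
  \<comment> \<open>The base point of the first factor shifts, because acting by
    \<open>cmp2 e x\<close> carries \<open>map1 (src2 e) x\<close> to
    \<open>map1 (tgt2 e) x\<close>.\<close>
  also have "\<dots> = tw1 b (map1 (tgt2 e) x) (tw1 (tgt2 e) x g) \<otimes>\<^bsub>grp (cod1 b)\<^esub> tw1 b (map1 (src2 e) x) (cmp2 e x)"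
    using A c(1,2) x g by (simp add: c1_mult[OF b])
  finally show "tw1 b (map1 (src2 e) (act (dom1 (comp1 b (src2 e))) g x)) (cmp2 e (act (dom1 (comp1 b (src2 e))) g x))
       \<otimes>\<^bsub>grp (cod1 (comp1 b (src2 e)))\<^esub> tw1 (comp1 b (src2 e)) x g =
       tw1 (comp1 b (tgt2 e)) x g \<otimes>\<^bsub>grp (cod1 (comp1 b (src2 e)))\<^esub> tw1 b (map1 (src2 e) x) (cmp2 e x)"
    using x g d by simp
qed

lemma is_cell2_whiskR2:
  assumes r: "is_cell2 r" and a: "is_cell1 a" and ra: "cod1 a = dom1 (src2 r)"
  shows "is_cell2 (whiskR2 r a)"
  unfolding whiskR2_eq
proof (rule is_cell2_mk2)
  note b = c2_src[OF r] and b' = c2_tgt[OF r] and d = c2_dom[OF r] c2_cod[OF r]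
  show "is_cell1 (comp1 (src2 r) a)" "is_cell1 (comp1 (tgt2 r) a)"
    "dom1 (comp1 (tgt2 r) a) = dom1 (comp1 (src2 r) a)" "cod1 (comp1 (tgt2 r) a) = cod1 (comp1 (src2 r) a)"
    using a b b' d ra by (simp_all add: is_cell1_comp1)
  note A = c1_map[OF a, unfolded ra] c1_tw[OF a, unfolded ra] c1_act[OF a, unfolded ra]
  fix x assume "x \<in> pts (dom1 (comp1 (src2 r) a))"
  then have x: "x \<in> pts (dom1 a)" by simp
  show "cmp2 r (map1 a x) \<in> carrier (grp (cod1 (comp1 (src2 r) a)))"
    using A x by (simp add: c2_cmp[OF r])
  show "map1 (comp1 (tgt2 r) a) x = act (cod1 (comp1 (src2 r) a)) (cmp2 r (map1 a x)) (map1 (comp1 (src2 r) a) x)"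
    using A x by (simp add: c2_map[OF r])
  fix g assume "g \<in> carrier (grp (dom1 (comp1 (src2 r) a)))"
  then have g: "g \<in> carrier (grp (dom1 a))" by simp
  show "cmp2 r (map1 a (act (dom1 (comp1 (src2 r) a)) g x)) \<otimes>\<^bsub>grp (cod1 (comp1 (src2 r) a))\<^esub> tw1 (comp1 (src2 r) a) x g =
    tw1 (comp1 (tgt2 r) a) x g \<otimes>\<^bsub>grp (cod1 (comp1 (src2 r) a))\<^esub> cmp2 r (map1 a x)"
    using A x g by (simp add: c2_nat[OF r])
qed

lemma iso1_sym: "iso1 a b \<Longrightarrow> iso1 b a"
  unfolding iso1_def using is_cell2_inv2 inv2_simps by metis

lemma iso1_trans: "iso1 a b \<Longrightarrow> iso1 b c \<Longrightarrow> iso1 a c"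
  unfolding iso1_def using is_cell2_vcomp2 src2_tgt2_comp by metis

lemma iso1_compL: "iso1 a a' \<Longrightarrow> is_cell1 b \<Longrightarrow> cod1 a = dom1 b \<Longrightarrow> iso1 (comp1 b a) (comp1 b a')"
  unfolding iso1_def using is_cell2_whiskL2 src2_tgt2_comp by metis

lemma iso1_compR: "iso1 b b' \<Longrightarrow> is_cell1 a \<Longrightarrow> cod1 a = dom1 b \<Longrightarrow> iso1 (comp1 b a) (comp1 b' a)"
  unfolding iso1_def using is_cell2_whiskR2 src2_tgt2_comp by metis

lemma class1_iff: "b \<in> class1 a \<longleftrightarrow> iso1 a b"
  by (simp add: class1_def iso1_def)

text \<open>Without \<open>is_cell1 a\<close> both classes could be empty although no 2-cell joins
  the two.\<close>

lemma class1_eq_iff: "is_cell1 a \<Longrightarrow> class1 a = class1 b \<longleftrightarrow> iso1 a b"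
  using iso1_refl iso1_sym iso1_trans iso1D by (metis class1_iff subsetI subset_antisym)

section \<open>Action groupoids\<close>

lemma E0_simps [simp]:
  "Ob (E0 X) = pts X" "Hom (E0 X) x x' = {g \<in> carrier (grp X). act X g x = x'}"
  "Cmp (E0 X) x y z g' g = g' \<otimes>\<^bsub>grp X\<^esub> g" "Idt (E0 X) x = \<one>\<^bsub>grp X\<^esub>"
  by (simp_all add: E0_def)

lemma fin_groupoid_E0:
  assumes X: "is_cell0 X"
  shows "fin_groupoid (E0 X)"
proof -
  interpret G: group "grp X" by (rule cell0_group[OF X])
  have "is_category (E0 X)"
    by (rule is_categoryI) (auto simp: act_one[OF X] act_mult[OF X] G.m_assoc)
  moreover have "iso_arrow (E0 X) x y g" if "x \<in> pts X" "g \<in> Hom (E0 X) x y" for x y g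
    by (rule iso_arrowI[where g = "inv\<^bsub>grp X\<^esub> g"]) (use that act_inv[OF X] in auto)
  ultimately show ?thesis
    unfolding fin_groupoid_def using X by (auto simp: is_cell0_def)
qed

lemma is_category_E0: "is_cell0 X \<Longrightarrow> is_category (E0 X)"
  using fin_groupoid_E0[of X] by (simp add: fin_groupoid_def)

lemma E1_simps [simp]:
  "fdom (E1 a) = E0 (dom1 a)" "fcod (E1 a) = E0 (cod1 a)"
  "x \<in> pts (dom1 a) \<Longrightarrow> fob (E1 a) x = map1 a x"
  "x \<in> pts (dom1 a) \<Longrightarrow> y \<in> pts (dom1 a) \<Longrightarrow> g \<in> carrier (grp (dom1 a)) \<Longrightarrow> act (dom1 a) g x = y \<Longrightarrow>
    far (E1 a) x y g = tw1 a x g"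
  by (simp_all add: E1_def)

lemma gpd_functor_E1:
  assumes a: "is_cell1 a"
  shows "gpd_functor (E1 a)"
proof -
  have "is_functor (E1 a)"
    unfolding E1_def
    by (rule is_functor_mk)
      (auto simp: is_category_E0 c1_dom c1_cod a c1_map c1_tw c1_one c1_mult c1_act[symmetric])
  then show ?thesis by (simp add: gpd_functor_def fin_groupoid_E0 c1_dom c1_cod a)
qed

lemma is_functor_E1: "is_cell1 a \<Longrightarrow> is_functor (E1 a)"
  using gpd_functor_E1[of a] by (simp add: gpd_functor_def)

lemma E1_id1: "is_cell0 X \<Longrightarrow> E1 (id1 X) = fid (E0 X)"
  by (rule functor_eqI) (auto simp: is_functor_E1 is_cell1_id1 is_functor_fid is_category_E0)

lemma E1_comp1:
  assumes "is_cell1 a" "is_cell1 b" "cod1 a = dom1 b"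
  shows "E1 (comp1 b a) = fcomp (E1 b) (E1 a)"
  by (rule functor_eqI)
    (use assms c1_map[OF assms(1)] c1_tw[OF assms(1)] c1_act[OF assms(1), symmetric] in
      \<open>auto simp: is_functor_E1 is_cell1_comp1 is_functor_fcomp act_closed c1_dom\<close>)

text \<open>The components of a 2-cell carry over as they stand: they are already extensional on the
  points of the source, as \<open>is_nat\<close> demands.\<close>

definition E2 :: "'u cell2 \<Rightarrow> ('u, 'u, 'u, 'u) nat_trans" where
  "E2 e = \<lparr>nsrc = E1 (src2 e), ntgt = E1 (tgt2 e), ncmp = cmp2 e\<rparr>"

lemma E2_simps [simp]: "nsrc (E2 e) = E1 (src2 e)" "ntgt (E2 e) = E1 (tgt2 e)" "ncmp (E2 e) = cmp2 e"
  by (simp_all add: E2_def)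

lemma gpd_nat_E2:
  assumes e: "is_cell2 e"
  shows "gpd_nat (E2 e)"
proof -
  note a = c2_src[OF e] and b = c2_tgt[OF e] and d = c2_dom[OF e] c2_cod[OF e]
  have ext: "cmp2 e \<in> pts (dom1 (src2 e)) \<rightarrow>\<^sub>E carrier (grp (cod1 (src2 e)))"
    using e by (simp add: is_cell2_def Let_def)
  have "is_nat (E2 e)"
    unfolding is_nat_def Let_def E2_simps
  proof (intro conjI ballI)
    show "cmp2 e \<in> (\<Pi>\<^sub>E x\<in>Ob (fdom (E1 (src2 e))). Hom (fcod (E1 (src2 e))) (fob (E1 (src2 e)) x) (fob (E1 (tgt2 e)) x))"
      using ext c2_map[OF e] d by (auto simp: PiE_iff)
  qed (use c2_nat[OF e] d in \<open>auto simp: is_functor_E1 a b\<close>)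
  then show ?thesis by (simp add: gpd_nat_def gpd_functor_E1 a)
qed

section \<open>Transfer maps on isomorphism classes\<close>

text \<open>In a groupoid every component has an inverse, and the inverses are again natural. Having
  them as a transformation of groupoid functors lets \<open>D2\<close> carry the inverse
  over.\<close>

lemma gpd_nat_inverse:
  assumes t: "gpd_nat t"
  obtains s where "gpd_nat s" "nsrc s = ntgt t" "ntgt s = nsrc t"
    "vcomp s t = nid (nsrc t)" "vcomp t s = nid (ntgt t)"
proof -
  define F where "F = nsrc t"
  define G where "G = ntgt t"
  define A where "A = fdom F"
  define B where "B = fcod F"
  have F: "is_functor F" and G: "is_functor G" and d: "fdom F = A" "fdom G = A" "fcod F = B" "fcod G = B"
    and th: "\<And>x. x \<in> Ob A \<Longrightarrow> ncmp t x \<in> Hom B (fob F x) (fob G x)"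
    and tn: "\<And>x y f. x \<in> Ob A \<Longrightarrow> y \<in> Ob A \<Longrightarrow> f \<in> Hom A x y \<Longrightarrow>
      Cmp B (fob F x) (fob F y) (fob G y) (ncmp t y) (far F x y f) =
      Cmp B (fob F x) (fob G x) (fob G y) (far G x y f) (ncmp t x)"
    using t by (auto simp: gpd_nat_def is_nat_def Let_def F_def G_def A_def B_def dest!: PiE_mem)
  have g: "fin_groupoid A" "fin_groupoid B"
    using t by (auto simp: gpd_nat_def gpd_functor_def F_def A_def B_def)
  note C = fun_cod[OF F, unfolded d]
  note o = fun_ob[OF F, unfolded d] fun_ob[OF G, unfolded d]
  note a = fun_ar[OF F, unfolded d] fun_ar[OF G, unfolded d]
  have "\<exists>r. r \<in> Hom B (fob G x) (fob F x) \<and>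
      Cmp B (fob F x) (fob G x) (fob F x) r (ncmp t x) = Idt B (fob F x) \<and>
      Cmp B (fob G x) (fob F x) (fob G x) (ncmp t x) r = Idt B (fob G x)" if "x \<in> Ob A" for x
    using g(2) o[OF that] th[OF that] unfolding fin_groupoid_def iso_arrow_def by blast
  then obtain r where r: "\<And>x. x \<in> Ob A \<Longrightarrow> r x \<in> Hom B (fob G x) (fob F x)"
      "\<And>x. x \<in> Ob A \<Longrightarrow> Cmp B (fob F x) (fob G x) (fob F x) (r x) (ncmp t x) = Idt B (fob F x)"
      "\<And>x. x \<in> Ob A \<Longrightarrow> Cmp B (fob G x) (fob F x) (fob G x) (ncmp t x) (r x) = Idt B (fob G x)"
    by metis
  define s where "s = \<lparr>nsrc = G, ntgt = F, ncmp = (\<lambda>x\<in>Ob A. r x)\<rparr>"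
  have s: "nsrc s = G" "ntgt s = F" "\<And>x. x \<in> Ob A \<Longrightarrow> ncmp s x = r x" by (simp_all add: s_def)
  have nat: "Cmp B (fob G x) (fob G y) (fob F y) (r y) (far G x y f) =
      Cmp B (fob G x) (fob F x) (fob F y) (far F x y f) (r x)"
    if x: "x \<in> Ob A" and y: "y \<in> Ob A" and f: "f \<in> Hom A x y" for x y f
  proof -
    note ox = o[OF x] o[OF y] a[OF x y f] r(1)[OF x] r(1)[OF y] th[OF x] th[OF y]
    \<comment> \<open>\<open>G f\<close> is written as a conjugate so that naturality of
      \<open>t\<close> can replace the inner composite.\<close>
    have 1: "Cmp B (fob G x) (fob F x) (fob G y) (Cmp B (fob F x) (fob G x) (fob G y) (far G x y f) (ncmp t x)) (r x)
        = far G x y f"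
      using ox r(3)[OF x] by (simp add: cat_assoc[OF C, symmetric] cat_idr[OF C])
    have "Cmp B (fob G x) (fob G y) (fob F y) (r y) (far G x y f) =
       Cmp B (fob G x) (fob G y) (fob F y) (r y)
         (Cmp B (fob G x) (fob F x) (fob G y) (Cmp B (fob F x) (fob F y) (fob G y) (ncmp t y) (far F x y f)) (r x))"
      using tn[OF x y f] 1 by simp
    also have "\<dots> = Cmp B (fob G x) (fob F x) (fob F y) (Cmp B (fob F x) (fob F y) (fob F y)
        (Cmp B (fob F y) (fob G y) (fob F y) (r y) (ncmp t y)) (far F x y f)) (r x)"
      using ox by (simp add: cat_assoc[OF C] cat_comp[OF C])
    also have "\<dots> = Cmp B (fob G x) (fob F x) (fob F y) (far F x y f) (r x)"
      using ox r(2)[OF y] by (simp add: cat_idl[OF C])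
    finally show ?thesis .
  qed
  show ?thesis
  proof (rule that)
    have "is_nat s"
      unfolding is_nat_def Let_def s d
    proof (intro conjI ballI)
      show "ncmp s \<in> (\<Pi>\<^sub>E x\<in>Ob A. Hom B (fob G x) (fob F x))"
        using r(1) by (auto simp: s_def)
    qed (use F G d nat s in auto)
    then show "gpd_nat s" using g G d by (simp add: gpd_nat_def gpd_functor_def s)
    show "nsrc s = ntgt t" "ntgt s = nsrc t" by (simp_all add: s F_def G_def)
    show "vcomp s t = nid (nsrc t)" "vcomp t s = nid (ntgt t)"
      using r(2,3) s(3) unfolding vcomp_def nid_def s F_def[symmetric] G_def[symmetric] d
      by (auto intro!: restrict_ext)
  qed
qed

text \<open>The adjoints enter as chosen data because \<open>lambda_shriek\<close> is built from a
  unit and a counit. Condition (i) on coproducts joins in \<open>transfer\<close>.\<close>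

locale derivator =
  fixes D :: "('u, 'o, 'm) gpd_2functor"
    and shr :: "('u, 'u, 'u, 'u) cat_functor \<Rightarrow> ('o, 'm, 'o, 'm) cat_functor"
    and \<eta> \<epsilon> :: "('u, 'u, 'u, 'u) cat_functor \<Rightarrow> ('o, 'm, 'o, 'm) nat_trans"
  assumes D: "strict_2functor D"
    and adjunction: "\<And>u. gpd_functor u \<Longrightarrow> is_adjunction (shr u) (D1 D u) (\<eta> u) (\<epsilon> u)"
    and base_change: "\<And>I J p q l. gpd_comma_square I J p q l \<Longrightarrow>
          is_nat_iso (lambda_shriek D shr \<eta> \<epsilon> I J p q l)"
begin

lemma D0_category: "fin_groupoid K \<Longrightarrow> is_category (D0 D K)"
  using D by (simp add: strict_2functor_def)

lemma D1_functor:
  "gpd_functor u \<Longrightarrow> is_functor (D1 D u)"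
  "gpd_functor u \<Longrightarrow> fdom (D1 D u) = D0 D (fcod u)"
  "gpd_functor u \<Longrightarrow> fcod (D1 D u) = D0 D (fdom u)"
  using D by (simp_all add: strict_2functor_def)

lemma D1_fid: "fin_groupoid K \<Longrightarrow> D1 D (fid K) = fid (D0 D K)"
  using D by (simp add: strict_2functor_def)

lemma D1_fcomp:
  "gpd_functor u \<Longrightarrow> gpd_functor v \<Longrightarrow> fcod u = fdom v \<Longrightarrow> D1 D (fcomp v u) = fcomp (D1 D u) (D1 D v)"
  using D by (simp add: strict_2functor_def)

lemma shr_functor:
  assumes "gpd_functor u"
  shows "is_functor (shr u)" "fdom (shr u) = D0 D (fdom u)" "fcod (shr u) = D0 D (fcod u)"
  using adjunction[OF assms] D1_functor[OF assms] by (auto simp: is_adjunction_def)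

text \<open>\<open>D2\<close> preserves vertical composition and identities, so it sends the inverse
  of \<open>t\<close> to an inverse; comparing components gives invertibility at each
  object.\<close>

lemma D2_nat_iso:
  assumes t: "gpd_nat t"
  shows "is_nat_iso (D2 D t)" "nsrc (D2 D t) = D1 D (nsrc t)" "ntgt (D2 D t) = D1 D (ntgt t)"
proof -
  have D2: "is_nat (D2 D t) \<and> nsrc (D2 D t) = D1 D (nsrc t) \<and> ntgt (D2 D t) = D1 D (ntgt t)" if "gpd_nat t" for t
    using D that by (simp add: strict_2functor_def)
  show "nsrc (D2 D t) = D1 D (nsrc t)" "ntgt (D2 D t) = D1 D (ntgt t)" using D2[OF t] by simp_all
  obtain s where s: "gpd_nat s" "nsrc s = ntgt t" "ntgt s = nsrc t"
    "vcomp s t = nid (nsrc t)" "vcomp t s = nid (ntgt t)" using gpd_nat_inverse[OF t] .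
  have g: "gpd_functor (nsrc t)" "gpd_functor (ntgt t)" using s t by (auto simp: gpd_nat_def)
  have v: "vcomp (D2 D s) (D2 D t) = nid (D1 D (nsrc t))" "vcomp (D2 D t) (D2 D s) = nid (D1 D (ntgt t))"
  proof -
    have "D2 D (vcomp s t) = vcomp (D2 D s) (D2 D t)" "D2 D (vcomp t s) = vcomp (D2 D t) (D2 D s)"
      using D s(1-3) t by (simp_all add: strict_2functor_def)
    moreover have "D2 D (nid (nsrc t)) = nid (D1 D (nsrc t))" "D2 D (nid (ntgt t)) = nid (D1 D (ntgt t))"
      using D g unfolding strict_2functor_def by blast+
    ultimately show "vcomp (D2 D s) (D2 D t) = nid (D1 D (nsrc t))" "vcomp (D2 D t) (D2 D s) = nid (D1 D (ntgt t))"
      using s by simp_all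
  qed
  let ?F = "D1 D (nsrc t)" and ?G = "D1 D (ntgt t)"
  have N: "is_nat (D2 D t)" "nsrc (D2 D t) = ?F" "ntgt (D2 D t) = ?G" 
    "is_nat (D2 D s)" "nsrc (D2 D s) = ?G" "ntgt (D2 D s) = ?F" 
    using D2[OF t] D2[OF s(1)] s by simp_all
  then have d: "fdom ?G = fdom ?F" "fcod ?G = fcod ?F" 
    by (auto simp: is_nat_def Let_def)
  have "iso_arrow (fcod ?F) (fob ?F x) (fob ?G x) (ncmp (D2 D t) x)" if x: "x \<in> Ob (fdom ?F)" for x
  proof (rule iso_arrowI)
    show "ncmp (D2 D t) x \<in> Hom (fcod ?F) (fob ?F x) (fob ?G x)"
      using N(1-3) x by (auto simp: is_nat_def Let_def dest!: PiE_mem)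
    show "ncmp (D2 D s) x \<in> Hom (fcod ?F) (fob ?G x) (fob ?F x)"
      using N(4-6) x d by (auto simp: is_nat_def Let_def dest!: PiE_mem)
    have "ncmp (vcomp (D2 D s) (D2 D t)) x = ncmp (nid ?F) x" using v by simp
    then show "Cmp (fcod ?F) (fob ?F x) (fob ?G x) (fob ?F x) (ncmp (D2 D s) x) (ncmp (D2 D t) x) = Idt (fcod ?F) (fob ?F x)"
      using x N d by (simp add: vcomp_def nid_def)
    have "ncmp (vcomp (D2 D t) (D2 D s)) x = ncmp (nid ?G) x" using v by simp
    then show "Cmp (fcod ?F) (fob ?G x) (fob ?F x) (fob ?G x) (ncmp (D2 D t) x) (ncmp (D2 D s) x) = Idt (fcod ?F) (fob ?G x)"
      using x N d by (simp add: vcomp_def nid_def)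
  qed
  then show "is_nat_iso (D2 D t)" using N by (simp add: is_nat_iso_def)
qed

section \<open>Restriction and transfer along a 1-cell\<close>

definition M :: "'u cell0 \<Rightarrow> 'o set set" where
  "M X = iso_classes (D0 D (E0 X))"

definition pull :: "'u cell1 \<Rightarrow> 'o set \<Rightarrow> 'o set" where
  "pull a = iso_classes_map (D1 D (E1 a))"

definition push :: "'u cell1 \<Rightarrow> 'o set \<Rightarrow> 'o set" where
  "push a = iso_classes_map (shr (E1 a))"

lemma D1_E1:
  assumes "is_cell1 a"
  shows "is_functor (D1 D (E1 a))" "fdom (D1 D (E1 a)) = D0 D (E0 (cod1 a))" "fcod (D1 D (E1 a)) = D0 D (E0 (dom1 a))"
  using D1_functor[OF gpd_functor_E1[OF assms]] by simp_all

lemma shr_E1: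
  assumes "is_cell1 a"
  shows "is_functor (shr (E1 a))" "fdom (shr (E1 a)) = D0 D (E0 (dom1 a))" "fcod (shr (E1 a)) = D0 D (E0 (cod1 a))"
  using shr_functor[OF gpd_functor_E1[OF assms]] by simp_all

lemma D1_E1_id1: "is_cell0 X \<Longrightarrow> D1 D (E1 (id1 X)) = fid (D0 D (E0 X))"
  by (simp add: E1_id1 D1_fid fin_groupoid_E0)

lemma D1_E1_comp1:
  "is_cell1 a \<Longrightarrow> is_cell1 b \<Longrightarrow> cod1 a = dom1 b \<Longrightarrow> D1 D (E1 (comp1 b a)) = fcomp (D1 D (E1 a)) (D1 D (E1 b))"
  by (simp add: E1_comp1 D1_fcomp gpd_functor_E1)

lemma univ_arrow_shr:
  assumes a: "is_cell1 a" and x: "x \<in> Ob (D0 D (E0 (dom1 a)))"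
  shows "univ_arrow (D1 D (E1 a)) x (fob (shr (E1 a)) x) (ncmp (\<eta> (E1 a)) x)"
  using univ_arrow_adjunction[OF adjunction[OF gpd_functor_E1[OF a]], of x] x shr_E1[OF a] by simp

lemma isomorphic_shr:
  assumes a: "is_cell1 a" and u: "univ_arrow (D1 D (E1 a)) x z n"
  shows "isomorphic (D0 D (E0 (cod1 a))) (fob (shr (E1 a)) x) z"
  using left_adjoint_unique[OF adjunction[OF gpd_functor_E1[OF a]] u] D1_E1[OF a] by simp

lemma pull_mem: "is_cell1 a \<Longrightarrow> pull a \<in> M (cod1 a) \<rightarrow>\<^sub>E M (dom1 a)"
  using iso_classes_map_mem[of "D1 D (E1 a)"] by (simp add: pull_def M_def D1_E1)

lemma push_mem: "is_cell1 a \<Longrightarrow> push a \<in> M (dom1 a) \<rightarrow>\<^sub>E M (cod1 a)"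
  using iso_classes_map_mem[of "shr (E1 a)"] by (simp add: push_def M_def shr_E1)

lemma pull_in: "is_cell1 a \<Longrightarrow> c \<in> M (cod1 a) \<Longrightarrow> pull a c \<in> M (dom1 a)"
  using pull_mem by blast

lemma pull_id1: "is_cell0 X \<Longrightarrow> pull (id1 X) = (\<lambda>c\<in>M X. c)"
  by (simp add: pull_def D1_E1_id1 iso_classes_map_fid D0_category fin_groupoid_E0 M_def)

lemma pull_comp1:
  "is_cell1 a \<Longrightarrow> is_cell1 b \<Longrightarrow> cod1 a = dom1 b \<Longrightarrow> pull (comp1 b a) = compose (M (cod1 b)) (pull a) (pull b)"
  by (simp add: pull_def D1_E1_comp1 iso_classes_map_fcomp D1_E1 M_def)

lemma pull_iso1: "iso1 a b \<Longrightarrow> pull a = pull b"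
  using iso_classes_map_nat_iso[OF D2_nat_iso(1)] D2_nat_iso(2,3) gpd_nat_E2
  by (fastforce elim!: iso1E simp: pull_def)

lemma push_id1:
  assumes X: "is_cell0 X"
  shows "push (id1 X) = (\<lambda>c\<in>M X. c)"
proof -
  let ?C = "D0 D (E0 X)"
  have C: "is_category ?C" by (simp add: D0_category fin_groupoid_E0 X)
  note S = shr_E1[OF is_cell1_id1[OF X], simplified]
  have "push (id1 X) = iso_classes_map (fid ?C)"
    unfolding push_def
  proof (rule iso_classes_map_eq)
    fix x assume "x \<in> Ob (fdom (shr (E1 (id1 X))))"
    then have x: "x \<in> Ob ?C" by (simp add: S)
    have "univ_arrow (D1 D (E1 (id1 X))) x x (Idt ?C x)"
      by (simp add: D1_E1_id1 X univ_arrow_fid C x)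
    from isomorphic_shr[OF is_cell1_id1[OF X] this]
    show "isomorphic (fcod (shr (E1 (id1 X)))) (fob (shr (E1 (id1 X))) x) (fob (fid ?C) x)"
      by (simp add: S x)
  qed (simp_all add: S is_functor_fid C)
  then show ?thesis by (simp add: iso_classes_map_fid C M_def)
qed

text \<open>Restriction is contravariant, so a universal arrow for \<open>a\<close> followed by one
  for \<open>b\<close> is universal for the restriction along \<open>comp1 b a\<close>.\<close>

lemma push_comp1:
  assumes a: "is_cell1 a" and b: "is_cell1 b" and ab: "cod1 a = dom1 b"
  shows "push (comp1 b a) = compose (M (dom1 a)) (push b) (push a)"
proof -
  note c = is_cell1_comp1[OF a b ab]
  note S = shr_E1[OF a] shr_E1[OF b] shr_E1[OF c]
  have "push (comp1 b a) = iso_classes_map (fcomp (shr (E1 b)) (shr (E1 a)))"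
    unfolding push_def
  proof (rule iso_classes_map_eq)
    fix x assume "x \<in> Ob (fdom (shr (E1 (comp1 b a))))"
    then have x: "x \<in> Ob (D0 D (E0 (dom1 a)))" by (simp add: S)
    have y: "fob (shr (E1 a)) x \<in> Ob (D0 D (E0 (dom1 b)))"
      using fun_ob[OF S(1)] x S(2,3) ab by simp
    note u = univ_arrow_fcomp[OF D1_E1(1)[OF b] D1_E1(1)[OF a] _ univ_arrow_shr[OF a x] univ_arrow_shr[OF b y],
        folded D1_E1_comp1[OF a b ab]]
    from isomorphic_shr[OF c u]
    show "isomorphic (fcod (shr (E1 (comp1 b a)))) (fob (shr (E1 (comp1 b a))) x) (fob (fcomp (shr (E1 b)) (shr (E1 a))) x)"
      using S x D1_E1[OF a] D1_E1[OF b] ab by simp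
  qed (use S ab in \<open>simp_all add: is_functor_fcomp\<close>)
  then show ?thesis using S ab by (simp add: iso_classes_map_fcomp push_def M_def)
qed

lemma push_iso1:
  assumes "iso1 a b"
  shows "push a = push b"
proof -
  note ab = iso1D[OF assms]
  obtain e where e: "is_cell2 e" "src2 e = a" "tgt2 e = b" using assms by (rule iso1E)
  note S = shr_E1[OF ab(1)] shr_E1[OF ab(2)]
  note t = D2_nat_iso[OF gpd_nat_E2[OF e(1)], unfolded E2_simps e]
  show ?thesis
    unfolding push_def
  proof (rule iso_classes_map_eq)
    fix x assume "x \<in> Ob (fdom (shr (E1 a)))"
    then have x: "x \<in> Ob (D0 D (E0 (dom1 a)))" by (simp add: S)
    \<comment> \<open>The unit for \<open>a\<close>, carried along the isomorphism of restrictions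
      that \<open>e\<close> induces, becomes universal for \<open>b\<close>.\<close>
    note u = univ_arrow_nat_iso[OF t(1), unfolded t(2,3), OF univ_arrow_shr[OF ab(1) x]]
    from isomorphic_shr[OF ab(2) u]
    show "isomorphic (fcod (shr (E1 a))) (fob (shr (E1 a)) x) (fob (shr (E1 b)) x)"
      using S ab by (simp add: isomorphic_sym)
  qed (use S ab in auto)
qed

text \<open>
  Pulling back along an equivalence is fully faithful, so that \<open>y\<close> itself, with the identity, is a
  universal arrow from \<open>a\<^sup>* y\<close>; hence \<open>a\<^sub>! a\<^sup>* y\<close> is isomorphic to \<open>y\<close>.
\<close>

lemma push_pull_equivalence:
  assumes a: "is_cell1 a" and b: "is_cell1 b"
    and ba: "iso1 (comp1 b a) (id1 (dom1 a))" and ab: "iso1 (comp1 a b) (id1 (cod1 a))"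
    and d: "dom1 b = cod1 a" "cod1 b = dom1 a" and c: "c \<in> M (cod1 a)"
  shows "push a (pull a c) = c"
proof -
  let ?F = "D1 D (E1 a)" and ?G = "D1 D (E1 b)"
  note F = D1_E1[OF a] and G = D1_E1[OF b, unfolded d]
  obtain e where e: "is_cell2 e" "src2 e = comp1 a b" "tgt2 e = id1 (cod1 a)" using ab by (rule iso1E)
  obtain f where f: "is_cell2 f" "src2 f = comp1 b a" "tgt2 f = id1 (dom1 a)" using ba by (rule iso1E)
  \<comment> \<open>Contravariance swaps the composites: the 2-cell on \<open>comp1 a b\<close>
    gives \<open>?G\<close> after \<open>?F\<close>, and the one on \<open>comp1 b a\<close> gives
    \<open>?F\<close> after \<open>?G\<close>.\<close>
  note s = D2_nat_iso[OF gpd_nat_E2[OF e(1)], unfolded E2_simps e D1_E1_comp1[OF b a d(2)]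
      D1_E1_id1[OF c1_cod[OF a]]]
  note t = D2_nat_iso[OF gpd_nat_E2[OF f(1)], unfolded E2_simps f D1_E1_comp1[OF a b d(1)[symmetric]]
      D1_E1_id1[OF c1_dom[OF a]]]
  have bij: "bij_betw (far ?F x y) (Hom (fdom ?F) x y) (Hom (fcod ?F) (fob ?F x) (fob ?F y))"
    if "x \<in> Ob (fdom ?F)" "y \<in> Ob (fdom ?F)" for x y
    by (rule inverse_equivalence_bij_Hom[OF s(1,2) _ t(1,2)]) (use s t F G that in simp_all)
  obtain y where y: "y \<in> Ob (D0 D (E0 (cod1 a)))" "c = iso_class (D0 D (E0 (cod1 a))) y"
    using c unfolding M_def by (rule iso_classesE)
  have y': "y \<in> Ob (fdom ?F)" using y F by simp
  have C: "is_category (D0 D (E0 (cod1 a)))" by (simp add: D0_category fin_groupoid_E0 c1_cod a)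
  have i: "isomorphic (D0 D (E0 (cod1 a))) (fob (shr (E1 a)) (fob ?F y)) y"
    by (rule isomorphic_shr[OF a univ_arrow_fully_faithful[OF F(1) y' bij]]) (use y' in auto)
  note S = shr_E1[OF a]
  have Fy: "fob ?F y \<in> Ob (D0 D (E0 (dom1 a)))" using fun_ob[OF F(1) y'] F by simp
  have Sy: "fob (shr (E1 a)) (fob ?F y) \<in> Ob (D0 D (E0 (cod1 a)))" using fun_ob[OF S(1)] Fy S by simp
  have "push a (pull a c) = iso_class (D0 D (E0 (cod1 a))) (fob (shr (E1 a)) (fob ?F y))"
    using iso_classes_map_class[OF F(1) y'] iso_classes_map_class[OF S(1), of "fob ?F y"] F S Fy
    by (simp add: push_def pull_def y)
  also have "\<dots> = c" using i y Sy by (simp add: iso_class_eq_iff[OF C])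
  finally show ?thesis .
qed

text \<open>Here \<open>u\<close> and \<open>v\<close> are the \<open>I\<close> and \<open>J\<close>
  of (iii). The component of the invertible transformation at a representative of \<open>c\<close>
  is the isomorphism that makes the two classes equal.\<close>

lemma push_pull_comma_square:
  assumes cells: "is_cell1 u" "is_cell1 v" "is_cell1 p" "is_cell1 q"
    and d: "cod1 u = cod1 v" "cod1 p = dom1 u" "cod1 q = dom1 v" "dom1 p = dom1 q"
    and sq: "gpd_comma_square (E1 u) (E1 v) (E1 p) (E1 q) l" and c: "c \<in> M (dom1 u)"
  shows "pull v (push u c) = push q (pull p c)"
proof -
  note t = base_change[OF sq]
  note F = D1_E1[OF cells(2)] D1_E1[OF cells(3)] and S = shr_E1[OF cells(1)] shr_E1[OF cells(4)]
  obtain x where x: "x \<in> Ob (D0 D (E0 (dom1 u)))" "c = iso_class (D0 D (E0 (dom1 u))) x"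
    using c unfolding M_def by (rule iso_classesE)
  \<comment> \<open>The source and the target of \<open>lambda_shriek\<close> contain identity
    functors left by the unit and the counit; these facts let them be simplified away.\<close>
  have eta: "nsrc (\<eta> (E1 u)) = fid (D0 D (E0 (dom1 u)))" and eps: "ntgt (\<epsilon> (E1 q)) = fid (D0 D (E0 (cod1 q)))"
    using adjunction[OF gpd_functor_E1[OF cells(1)]] adjunction[OF gpd_functor_E1[OF cells(4)]] S
      D1_E1[OF cells(4)] by (simp_all add: is_adjunction_def)
  have px: "fob (D1 D (E1 p)) x \<in> Ob (D0 D (E0 (dom1 q)))" using fun_ob[OF F(4)] F x d by simp
  have qpx: "fob (shr (E1 q)) (fob (D1 D (E1 p)) x) \<in> Ob (D0 D (E0 (dom1 v)))" using fun_ob[OF S(4)] S px d by simp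
  have ux: "fob (shr (E1 u)) x \<in> Ob (D0 D (E0 (cod1 v)))" using fun_ob[OF S(1)] S x d by simp
  have vux: "fob (D1 D (E1 v)) (fob (shr (E1 u)) x) \<in> Ob (D0 D (E0 (dom1 v)))" using fun_ob[OF F(1)] F ux d by simp
  have C: "is_category (D0 D (E0 (dom1 v)))" by (simp add: D0_category fin_groupoid_E0 c1_dom cells)
  have "isomorphic (D0 D (E0 (dom1 v))) (fob (shr (E1 q)) (fob (D1 D (E1 p)) x)) (fob (D1 D (E1 v)) (fob (shr (E1 u)) x))"
    using nat_isoD(5)[OF t refl refl, of x] x F S d vux
    by (simp add: lambda_shriek_def vcomp_def whiskL_def whiskR_def eta eps)
  then show ?thesis
    using iso_classes_map_class[OF F(1), of "fob (shr (E1 u)) x"] iso_classes_map_class[OF F(4), of x]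
      iso_classes_map_class[OF S(1), of x] iso_classes_map_class[OF S(4), of "fob (D1 D (E1 p)) x"]
      F S d x px ux qpx vux
    by (simp add: push_def pull_def iso_class_eq_iff[OF C] isomorphic_sym)
qed

end

section \<open>Comma cells\<close>

text \<open>
  A pairing on \<open>'u\<close> makes room for products of groups and of sets inside the type that carries the cells.
\<close>

locale pairing =
  fixes pr :: "'u \<Rightarrow> 'u \<Rightarrow> 'u" and p1 p2 :: "'u \<Rightarrow> 'u"
  assumes p1 [simp]: "p1 (pr x y) = x" and p2 [simp]: "p2 (pr x y) = y"
begin

lemma pr_eq [simp]: "pr x y = pr x' y' \<longleftrightarrow> x = x' \<and> y = y'"
  by (metis p1 p2)

definition prod_grp :: "'u monoid \<Rightarrow> 'u monoid \<Rightarrow> 'u monoid" where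
  "prod_grp G H = \<lparr>carrier = (\<lambda>(g, h). pr g h) ` (carrier G \<times> carrier H),
     mult = (\<lambda>m n. pr (p1 m \<otimes>\<^bsub>G\<^esub> p1 n) (p2 m \<otimes>\<^bsub>H\<^esub> p2 n)), one = pr \<one>\<^bsub>G\<^esub> \<one>\<^bsub>H\<^esub>\<rparr>"

lemma prod_grp_simps [simp]:
  "pr g h \<in> carrier (prod_grp G H) \<longleftrightarrow> g \<in> carrier G \<and> h \<in> carrier H"
  "m \<otimes>\<^bsub>prod_grp G H\<^esub> n = pr (p1 m \<otimes>\<^bsub>G\<^esub> p1 n) (p2 m \<otimes>\<^bsub>H\<^esub> p2 n)"
  "\<one>\<^bsub>prod_grp G H\<^esub> = pr \<one>\<^bsub>G\<^esub> \<one>\<^bsub>H\<^esub>"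
  by (auto simp: prod_grp_def)

lemma prod_grpE:
  assumes "m \<in> carrier (prod_grp G H)"
  obtains g h where "m = pr g h" "g \<in> carrier G" "h \<in> carrier H"
  using assms by (auto simp: prod_grp_def)

lemma group_prod_grp:
  assumes "group G" "group H"
  shows "group (prod_grp G H)"
proof -
  interpret G: group G by fact
  interpret H: group H by fact
  show ?thesis
  proof (rule groupI)
    fix m assume "m \<in> carrier (prod_grp G H)"
    then obtain g h where m: "m = pr g h" "g \<in> carrier G" "h \<in> carrier H" by (rule prod_grpE)
    show "\<exists>n\<in>carrier (prod_grp G H). n \<otimes>\<^bsub>prod_grp G H\<^esub> m = \<one>\<^bsub>prod_grp G H\<^esub>"
      by (rule bexI[of _ "pr (inv\<^bsub>G\<^esub> g) (inv\<^bsub>H\<^esub> h)"]) (use m in simp_all)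
  qed (auto elim!: prod_grpE simp: G.m_assoc H.m_assoc)
qed

lemma finite_prod_grp:
  "finite (carrier G) \<Longrightarrow> finite (carrier H) \<Longrightarrow> finite (carrier (prod_grp G H))"
  by (simp add: prod_grp_def)

end

text \<open>Arrows run from the image of \<open>u\<close> to the image of \<open>v\<close>, the
  orientation in which (iii) yields restriction along \<open>v\<close> after transfer along
  \<open>u\<close>.\<close>

locale comma_cell = pairing +
  fixes u v :: "'a cell1"
  assumes u: "is_cell1 u" and v: "is_cell1 v" and uv: "cod1 v = cod1 u"
begin

abbreviation "G \<equiv> grp (dom1 u)"
abbreviation "H \<equiv> grp (dom1 v)"
abbreviation "K \<equiv> grp (cod1 u)"

text \<open>
  A point \<open>pr y (pr x c)\<close> is an arrow \<open>c : u y \<rightarrow> v x\<close> of the action groupoid of the common target, on which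
  \<open>pr g h\<close> acts by conjugation with the images of \<open>g\<close> and \<open>h\<close>.
\<close>

definition P :: "'a cell0" where
  "P = (let Q = {pr y (pr x c) | y x c. y \<in> pts (dom1 u) \<and> x \<in> pts (dom1 v) \<and>
      c \<in> carrier K \<and> act (cod1 u) c (map1 u y) = map1 v x} in
    \<lparr>grp = prod_grp G H, pts = Q,
     act = (\<lambda>m. \<lambda>z\<in>Q. pr (act (dom1 u) (p1 m) (p1 z)) (pr (act (dom1 v) (p2 m) (p1 (p2 z)))
       (tw1 v (p1 (p2 z)) (p2 m) \<otimes>\<^bsub>K\<^esub> p2 (p2 z) \<otimes>\<^bsub>K\<^esub> inv\<^bsub>K\<^esub> (tw1 u (p1 z) (p1 m)))))\<rparr>)"

lemma grp_P [simp]: "grp P = prod_grp G H"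
  by (simp add: P_def Let_def)

lemma pts_P [simp]:
  "pr y (pr x c) \<in> pts P \<longleftrightarrow> y \<in> pts (dom1 u) \<and> x \<in> pts (dom1 v) \<and> c \<in> carrier K \<and>
    act (cod1 u) c (map1 u y) = map1 v x"
  by (auto simp: P_def Let_def)

lemma pts_PE:
  assumes "z \<in> pts P"
  obtains y x c where "z = pr y (pr x c)" "y \<in> pts (dom1 u)" "x \<in> pts (dom1 v)" "c \<in> carrier K"
    "act (cod1 u) c (map1 u y) = map1 v x"
  using assms by (auto simp: P_def Let_def)

lemma act_P [simp]:
  "pr y (pr x c) \<in> pts P \<Longrightarrow> act P (pr g h) (pr y (pr x c)) =
    pr (act (dom1 u) g y) (pr (act (dom1 v) h x) (tw1 v x h \<otimes>\<^bsub>K\<^esub> c \<otimes>\<^bsub>K\<^esub> inv\<^bsub>K\<^esub> (tw1 u y g)))"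
  by (simp add: P_def Let_def)

sublocale K: group K
  by (rule cell0_group[OF c1_cod[OF u]])

lemmas cell_simps = c1_map[OF u] c1_tw[OF u] c1_act[OF u] c1_mult[OF u] c1_one[OF u]
  c1_map[OF v, unfolded uv] c1_tw[OF v, unfolded uv] c1_act[OF v, unfolded uv] c1_mult[OF v, unfolded uv]
  c1_one[OF v, unfolded uv] act_closed[OF c1_dom[OF u]] act_closed[OF c1_dom[OF v]] act_closed[OF c1_cod[OF u]]
  act_mult[OF c1_dom[OF u]] act_mult[OF c1_dom[OF v]] act_one[OF c1_dom[OF u]] act_one[OF c1_dom[OF v]]

text \<open>Undoing the twist of \<open>g\<close> leads from \<open>u (g y)\<close> back to
  \<open>u y\<close>, then \<open>c\<close> leads to \<open>v x\<close>, and the twist of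
  \<open>h\<close> on to \<open>v (h x)\<close>.\<close>

lemma act_P_mem:
  assumes z: "pr y (pr x c) \<in> pts P" and g: "g \<in> carrier G" and h: "h \<in> carrier H"
  shows "act P (pr g h) (pr y (pr x c)) \<in> pts P"
proof -
  have "act (cod1 u) (tw1 v x h \<otimes>\<^bsub>K\<^esub> c \<otimes>\<^bsub>K\<^esub> inv\<^bsub>K\<^esub> (tw1 u y g)) (act (cod1 u) (tw1 u y g) (map1 u y)) =
      act (cod1 u) (tw1 v x h) (act (cod1 u) c (act (cod1 u) (inv\<^bsub>K\<^esub> (tw1 u y g)) (act (cod1 u) (tw1 u y g) (map1 u y))))"
    using z g h by (simp add: cell_simps act_mult[OF c1_cod[OF u]])
  also have "\<dots> = act (cod1 u) (tw1 v x h) (map1 v x)"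
    using z g h by (simp add: cell_simps act_inv[OF c1_cod[OF u]])
  finally show ?thesis using z g h by (simp add: cell_simps)
qed

lemma is_cell0_P: "is_cell0 P"
proof (rule is_cell0I)
  have 0: "is_cell0 (dom1 u)" "is_cell0 (dom1 v)" "is_cell0 (cod1 u)"
    using u v c1_dom c1_cod by auto
  show "group (grp P)" using 0 by (simp add: group_prod_grp cell0_group)
  show "finite (carrier (grp P))" using 0 by (simp add: finite_prod_grp is_cell0_def)
  have "pts P \<subseteq> (\<lambda>(y, x, c). pr y (pr x c)) ` (pts (dom1 u) \<times> pts (dom1 v) \<times> carrier K)"
    by (rule subsetI, erule pts_PE, rule image_eqI) auto
  then show "finite (pts P)"
    by (rule finite_subset) (use 0 in \<open>simp add: is_cell0_def\<close>)
  fix m z assume m: "m \<in> carrier (grp P)" and z: "z \<in> pts P"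
  show "act P m z \<in> pts P"
    using m z by (auto elim!: prod_grpE pts_PE intro!: act_P_mem simp del: act_P)
next
  fix z assume "z \<in> pts P"
  then show "act P \<one>\<^bsub>grp P\<^esub> z = z"
    by (auto elim!: pts_PE simp: cell_simps)
next
  fix m n z assume m: "m \<in> carrier (grp P)" and n: "n \<in> carrier (grp P)" and z: "z \<in> pts P"
  obtain g h where m': "m = pr g h" "g \<in> carrier G" "h \<in> carrier H" using m by (auto elim: prod_grpE)
  obtain g' h' where n': "n = pr g' h'" "g' \<in> carrier G" "h' \<in> carrier H" using n by (auto elim: prod_grpE)
  obtain y x c where z': "z = pr y (pr x c)" "y \<in> pts (dom1 u)" "x \<in> pts (dom1 v)" "c \<in> carrier K"
    "act (cod1 u) c (map1 u y) = map1 v x" using z by (rule pts_PE)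
  show "act P (m \<otimes>\<^bsub>grp P\<^esub> n) z = act P m (act P n z)"
    \<comment> \<open>\<open>act_P\<close> rewrites only at points of \<open>P\<close>, so the
      intermediate point must be known to lie there.\<close>
    using act_P_mem[of y x c g' h'] m' n' z'
    by (simp add: cell_simps K.m_assoc K.inv_mult_group)
qed (simp add: P_def Let_def)

definition q1 :: "'a cell1" where
  "q1 = mk1 P (dom1 u) p1 (\<lambda>_. p1)"

definition q2 :: "'a cell1" where
  "q2 = mk1 P (dom1 v) (\<lambda>z. p1 (p2 z)) (\<lambda>_. p2)"

text \<open>The tautological 2-cell: each point of \<open>P\<close> carries its own
  component.\<close>

definition k :: "'a cell2" where
  "k = mk2 (comp1 u q1) (comp1 v q2) (\<lambda>z. p2 (p2 z))"

lemma q_simps [simp]: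
  "dom1 q1 = P" "cod1 q1 = dom1 u" "dom1 q2 = P" "cod1 q2 = dom1 v"
  "z \<in> pts P \<Longrightarrow> map1 q1 z = p1 z" "z \<in> pts P \<Longrightarrow> map1 q2 z = p1 (p2 z)"
  "z \<in> pts P \<Longrightarrow> m \<in> carrier (prod_grp G H) \<Longrightarrow> tw1 q1 z m = p1 m"
  "z \<in> pts P \<Longrightarrow> m \<in> carrier (prod_grp G H) \<Longrightarrow> tw1 q2 z m = p2 m"
  "src2 k = comp1 u q1" "tgt2 k = comp1 v q2" "z \<in> pts P \<Longrightarrow> cmp2 k z = p2 (p2 z)"
  by (simp_all add: q1_def q2_def k_def)

lemma is_cell1_q1: "is_cell1 q1"
  unfolding q1_def
  by (rule is_cell1_mk1[OF is_cell0_P c1_dom[OF u]]) (auto elim!: pts_PE prod_grpE)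

lemma is_cell1_q2: "is_cell1 q2"
  unfolding q2_def
  by (rule is_cell1_mk1[OF is_cell0_P c1_dom[OF v]]) (auto elim!: pts_PE prod_grpE)

lemma is_cell2_k: "is_cell2 k"
  unfolding k_def
proof (rule is_cell2_mk2)
  show "is_cell1 (comp1 u q1)" "is_cell1 (comp1 v q2)" by (simp_all add: is_cell1_comp1 is_cell1_q1 is_cell1_q2 u v)
  fix z g assume "z \<in> pts (dom1 (comp1 u q1))" and "g \<in> carrier (grp (dom1 (comp1 u q1)))"
  then show "p2 (p2 (act (dom1 (comp1 u q1)) g z)) \<otimes>\<^bsub>grp (cod1 (comp1 u q1))\<^esub> tw1 (comp1 u q1) z g =
    tw1 (comp1 v q2) z g \<otimes>\<^bsub>grp (cod1 (comp1 u q1))\<^esub> p2 (p2 z)"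
    by (auto elim!: pts_PE prod_grpE simp: cell_simps K.m_assoc)
qed (auto elim!: pts_PE simp: uv)

definition induced :: "'a cell1 \<Rightarrow> 'a cell1 \<Rightarrow> 'a cell2 \<Rightarrow> 'a cell1" where
  "induced s t f = mk1 (dom1 s) P (\<lambda>w. pr (map1 s w) (pr (map1 t w) (cmp2 f w)))
     (\<lambda>w g. pr (tw1 s w g) (tw1 t w g))"

text \<open>The one-dimensional universal property in strict form: both triangles commute on the
  nose, which keeps later composites with the comparison map free of correcting 2-cells.\<close>

lemma induced:
  assumes s: "is_cell1 s" "cod1 s = dom1 u" and t: "is_cell1 t" "cod1 t = dom1 v" "dom1 t = dom1 s"
    and f: "is_cell2 f" "src2 f = comp1 u s" "tgt2 f = comp1 v t"
  shows "is_cell1 (induced s t f)" "comp1 q1 (induced s t f) = s" "comp1 q2 (induced s t f) = t"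
    "\<And>w. w \<in> pts (dom1 s) \<Longrightarrow> p2 (p2 (map1 (induced s t f) w)) = cmp2 f w"
proof -
  note S = c1_map[OF s(1), unfolded s] c1_tw[OF s(1), unfolded s] c1_act[OF s(1), unfolded s] c1_mult[OF s(1), unfolded s]
  note T = c1_map[OF t(1), unfolded t] c1_tw[OF t(1), unfolded t] c1_act[OF t(1), unfolded t] c1_mult[OF t(1), unfolded t]
  note F = c2_cmp[OF f(1), unfolded f, simplified] c2_map[OF f(1), unfolded f, simplified t(3) comp1_simps]
  have mem: "pr (map1 s w) (pr (map1 t w) (cmp2 f w)) \<in> pts P" if "w \<in> pts (dom1 s)" for w
    using that S T F t(3) by simp
  \<comment> \<open>Naturality of \<open>f\<close>, solved for its value at \<open>g w\<close>, is
    exactly the action on the third coordinate.\<close>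
  have eq: "cmp2 f (act (dom1 s) g w) = tw1 v (map1 t w) (tw1 t w g) \<otimes>\<^bsub>K\<^esub> cmp2 f w \<otimes>\<^bsub>K\<^esub> inv\<^bsub>K\<^esub> (tw1 u (map1 s w) (tw1 s w g))"
    if w: "w \<in> pts (dom1 s)" and g: "g \<in> carrier (grp (dom1 s))" for w g
  proof -
    have w': "act (dom1 s) g w \<in> pts (dom1 s)" by (rule act_closed[OF c1_dom[OF s(1)] g w])
    have "cmp2 f (act (dom1 s) g w) \<otimes>\<^bsub>K\<^esub> tw1 u (map1 s w) (tw1 s w g) =
        tw1 v (map1 t w) (tw1 t w g) \<otimes>\<^bsub>K\<^esub> cmp2 f w"
      using c2_nat[OF f(1), of w g] w g t(3) by (simp add: f)
    then show ?thesis
      using F(1)[OF w] F(1)[OF w'] w g S T by (metis K.inv_solve_right K.m_closed cell_simps(2) cell_simps(7))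
  qed
  show c: "is_cell1 (induced s t f)"
    unfolding induced_def
    by (rule is_cell1_mk1[OF c1_dom[OF s(1)] is_cell0_P]) (use mem S T eq in simp_all)
  note d = is_cell1_comp1[OF c is_cell1_q1] is_cell1_comp1[OF c is_cell1_q2]
  show "comp1 q1 (induced s t f) = s" "comp1 q2 (induced s t f) = t"
    by (rule cell1_eqI; use s t d S T mem in \<open>simp add: induced_def\<close>)+
  show "\<And>w. w \<in> pts (dom1 s) \<Longrightarrow> p2 (p2 (map1 (induced s t f) w)) = cmp2 f w"
    by (simp add: induced_def)
qed

text \<open>The existence half of the two-dimensional universal property: \<open>mn\<close> says
  that \<open>m\<close> and \<open>n\<close> are compatible with the tautological 2-cell, and then
  their pairs are the components sought.\<close>

lemma iso1_P:
  assumes h: "is_cell1 h" "cod1 h = P" and h': "is_cell1 h'" "cod1 h' = P" "dom1 h' = dom1 h"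
    and m: "is_cell2 m" "src2 m = comp1 q1 h" "tgt2 m = comp1 q1 h'"
    and n: "is_cell2 n" "src2 n = comp1 q2 h" "tgt2 n = comp1 q2 h'"
    and mn: "\<And>w. w \<in> pts (dom1 h) \<Longrightarrow> p2 (p2 (map1 h' w)) \<otimes>\<^bsub>K\<^esub> tw1 u (p1 (map1 h w)) (cmp2 m w) =
      tw1 v (p1 (p2 (map1 h w))) (cmp2 n w) \<otimes>\<^bsub>K\<^esub> p2 (p2 (map1 h w))"
  shows "iso1 h h'"
proof (rule iso1_mk2[where \<epsilon> = "\<lambda>w. pr (cmp2 m w) (cmp2 n w)"], rule is_cell2_mk2)
  note A = c1_map[OF h(1), unfolded h] c1_tw[OF h(1), unfolded h]
  note A' = c1_map[OF h'(1), unfolded h'] c1_tw[OF h'(1), unfolded h']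
  note Mc = c2_cmp[OF m(1), unfolded m, simplified] and Nc = c2_cmp[OF n(1), unfolded n, simplified]
  fix w assume w: "w \<in> pts (dom1 h)"
  show "pr (cmp2 m w) (cmp2 n w) \<in> carrier (grp (cod1 h))" using Mc Nc w by (simp add: h)
  obtain y x c where z: "map1 h w = pr y (pr x c)" "y \<in> pts (dom1 u)" "x \<in> pts (dom1 v)" "c \<in> carrier K"
    "act (cod1 u) c (map1 u y) = map1 v x" using A(1)[OF w] by (rule pts_PE)
  obtain y' x' c' where z': "map1 h' w = pr y' (pr x' c')" "y' \<in> pts (dom1 u)" "x' \<in> pts (dom1 v)" "c' \<in> carrier K"
    using A'(1)[OF w] by (rule pts_PE)
  have y: "y' = act (dom1 u) (cmp2 m w) y" 
    using c2_map[OF m(1), of w] w A(1)[OF w] A'(1)[OF w] by (simp add: m h' z z')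
  have x: "x' = act (dom1 v) (cmp2 n w) x" 
    using c2_map[OF n(1), of w] w A(1)[OF w] A'(1)[OF w] by (simp add: n h' z z')
  have "c' \<otimes>\<^bsub>K\<^esub> tw1 u y (cmp2 m w) = tw1 v x (cmp2 n w) \<otimes>\<^bsub>K\<^esub> c"
    using mn[OF w] by (simp add: z z')
  \<comment> \<open>Solved for \<open>c'\<close>, compatibility is the action of the paired
    components on the third coordinate.\<close>
  then have c: "c' = tw1 v x (cmp2 n w) \<otimes>\<^bsub>K\<^esub> c \<otimes>\<^bsub>K\<^esub> inv\<^bsub>K\<^esub> (tw1 u y (cmp2 m w))"
    using z z' Mc[OF w] Nc[OF w] by (metis K.inv_solve_right K.m_closed cell_simps(2) cell_simps(7))
  show "map1 h' w = act (cod1 h) (pr (cmp2 m w) (cmp2 n w)) (map1 h w)"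
    using z z' y x c by (simp add: h)
  fix g assume g: "g \<in> carrier (grp (dom1 h))"
  have "tw1 h w g \<in> carrier (prod_grp G H)" "tw1 h' w g \<in> carrier (prod_grp G H)"
    using A(2)[OF w g] A'(2)[OF w g] by simp_all
  then show "pr (cmp2 m (act (dom1 h) g w)) (cmp2 n (act (dom1 h) g w)) \<otimes>\<^bsub>grp (cod1 h)\<^esub> tw1 h w g =
       tw1 h' w g \<otimes>\<^bsub>grp (cod1 h)\<^esub> pr (cmp2 m w) (cmp2 n w)"
    using c2_nat[OF m(1), of w g] c2_nat[OF n(1), of w g] w g A(1)[OF w] A'(1)[OF w]
    by (simp add: m n h h')
qed (simp_all add: h h')

end

section \<open>The comma square of action groupoids\<close>

lemma is_category_comma_cat:
  assumes I: "is_functor I" and J: "is_functor J" and IJ: "fcod J = fcod I"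
  shows "is_category (comma_cat I J)"
proof -
  note A = fun_dom[OF I] and B = fun_dom[OF J] and K = fun_cod[OF I]
  note i = fun_ob[OF I] fun_ar[OF I] fun_id[OF I] fun_comp[OF I]
  note j = fun_ob[OF J, unfolded IJ] fun_ar[OF J, unfolded IJ] fun_id[OF J, unfolded IJ] fun_comp[OF J, unfolded IJ]
  \<comment> \<open>Pasting two commuting squares: this is closure of the comma category under
    composition, the axiom with real content.\<close>
  have comp: "Cmp (fcod I) (fob I x) (fob I x'') (fob J y'') k''
        (Cmp (fcod I) (fob I x) (fob I x') (fob I x'') (far I x' x'' f') (far I x x' f)) =
      Cmp (fcod I) (fob I x) (fob J y) (fob J y'')
        (Cmp (fcod I) (fob J y) (fob J y') (fob J y'') (far J y' y'' g') (far J y y' g)) k"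
    if ob: "x \<in> Ob (fdom I)" "x' \<in> Ob (fdom I)" "x'' \<in> Ob (fdom I)"
      "y \<in> Ob (fdom J)" "y' \<in> Ob (fdom J)" "y'' \<in> Ob (fdom J)"
      "k \<in> Hom (fcod I) (fob I x) (fob J y)" "k' \<in> Hom (fcod I) (fob I x') (fob J y')" "k'' \<in> Hom (fcod I) (fob I x'') (fob J y'')"
      "f \<in> Hom (fdom I) x x'" "f' \<in> Hom (fdom I) x' x''" "g \<in> Hom (fdom J) y y'" "g' \<in> Hom (fdom J) y' y''"
      and e: "Cmp (fcod I) (fob I x) (fob I x') (fob J y') k' (far I x x' f) =
        Cmp (fcod I) (fob I x) (fob J y) (fob J y') (far J y y' g) k"
      and e': "Cmp (fcod I) (fob I x') (fob I x'') (fob J y'') k'' (far I x' x'' f') =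
        Cmp (fcod I) (fob I x') (fob J y') (fob J y'') (far J y' y'' g') k'"
    for x x' x'' y y' y'' k k' k'' f f' g g'
  proof -
    note o = ob i(1)[OF ob(1)] i(1)[OF ob(2)] i(1)[OF ob(3)] j(1)[OF ob(4)] j(1)[OF ob(5)] j(1)[OF ob(6)]
      i(2)[OF ob(1,2,10)] i(2)[OF ob(2,3,11)] j(2)[OF ob(4,5,12)] j(2)[OF ob(5,6,13)]
    have "Cmp (fcod I) (fob I x) (fob I x'') (fob J y'') k''
        (Cmp (fcod I) (fob I x) (fob I x') (fob I x'') (far I x' x'' f') (far I x x' f)) =
      Cmp (fcod I) (fob I x) (fob I x') (fob J y'') (Cmp (fcod I) (fob I x') (fob J y') (fob J y'') (far J y' y'' g') k') (far I x x' f)"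
      using o e' by (simp add: cat_assoc[OF K])
    also have "\<dots> = Cmp (fcod I) (fob I x) (fob J y') (fob J y'') (far J y' y'' g')
        (Cmp (fcod I) (fob I x) (fob J y) (fob J y') (far J y y' g) k)"
      using o e by (simp add: cat_assoc[OF K, symmetric])
    also have "\<dots> = Cmp (fcod I) (fob I x) (fob J y) (fob J y'')
        (Cmp (fcod I) (fob J y) (fob J y') (fob J y'') (far J y' y'' g') (far J y y' g)) k"
      using o by (simp add: cat_assoc[OF K])
    finally show ?thesis .
  qed
  show ?thesis
  proof (rule is_categoryI)
    fix x assume "x \<in> Ob (comma_cat I J)"
    then show "Idt (comma_cat I J) x \<in> Hom (comma_cat I J) x x"
      by (auto simp: comma_cat_def Let_def cat_id A B i j cat_idl[OF K] cat_idr[OF K])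
  next
    fix x y z f g
    assume "x \<in> Ob (comma_cat I J)" "y \<in> Ob (comma_cat I J)" "z \<in> Ob (comma_cat I J)"
      "f \<in> Hom (comma_cat I J) x y" "g \<in> Hom (comma_cat I J) y z"
    then show "Cmp (comma_cat I J) x y z g f \<in> Hom (comma_cat I J) x z"
      by (auto simp: comma_cat_def Let_def cat_comp[OF A] cat_comp[OF B] i(4) j(4) intro!: comp)
  next
    fix x y f
    assume "x \<in> Ob (comma_cat I J)" "y \<in> Ob (comma_cat I J)" "f \<in> Hom (comma_cat I J) x y"
    then show "Cmp (comma_cat I J) x x y f (Idt (comma_cat I J) x) = f"
        "Cmp (comma_cat I J) x y y (Idt (comma_cat I J) y) f = f"
      by (auto simp: comma_cat_def Let_def cat_idl[OF A] cat_idl[OF B] cat_idr[OF A] cat_idr[OF B])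
  next
    fix w x y z f g h
    assume "w \<in> Ob (comma_cat I J)" "x \<in> Ob (comma_cat I J)" "y \<in> Ob (comma_cat I J)" "z \<in> Ob (comma_cat I J)"
      "f \<in> Hom (comma_cat I J) w x" "g \<in> Hom (comma_cat I J) x y" "h \<in> Hom (comma_cat I J) y z"
    then show "Cmp (comma_cat I J) w y z h (Cmp (comma_cat I J) w x y g f) =
        Cmp (comma_cat I J) w x z (Cmp (comma_cat I J) x y z h g) f"
      by (auto simp: comma_cat_def Let_def cat_assoc[OF A] cat_assoc[OF B])
  qed
qed

context comma_cell
begin

text \<open>Multiplying out the inverse in the action on \<open>P\<close> gives the commuting square
  that defines an arrow of the comma category. Hence the comparison functor merely unpacks
  \<open>pr\<close> into tuples, bijectively on objects and on arrows.\<close>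

lemma gpd_comma_square_P: "gpd_comma_square (E1 u) (E1 v) (E1 q1) (E1 q2) (E2 k)"
proof -
  let ?C = "comma_comparison (E1 u) (E1 v) (E1 q1) (E1 q2) (E2 k)"
  let ?T = "comma_cat (E1 u) (E1 v)"
  let ?ob = "\<lambda>z. (p1 z, p1 (p2 z), p2 (p2 z))"
  have fob: "fob ?C z = ?ob z" if "z \<in> pts P" for z
    using that by (simp add: comma_comparison_def)
  have far: "far ?C z z' m = (p1 m, p2 m)"
    if "z \<in> pts P" "z' \<in> pts P" "m \<in> carrier (prod_grp G H)" "act P m z = z'" for z z' m
    using that by (simp add: comma_comparison_def)
  have d: "fdom ?C = E0 P" "fcod ?C = ?T" by (simp_all add: comma_comparison_def)
  have ObT: "Ob ?T = {(y, x, c). y \<in> pts (dom1 u) \<and> x \<in> pts (dom1 v) \<and> c \<in> carrier K \<and> act (cod1 u) c (map1 u y) = map1 v x}"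
    by (auto simp: comma_cat_def Let_def)
  have HomT: "Hom ?T (y, x, c) (y', x', c') = {(g, h). g \<in> carrier G \<and> act (dom1 u) g y = y' \<and>
      h \<in> carrier H \<and> act (dom1 v) h x = x' \<and> c' \<otimes>\<^bsub>K\<^esub> tw1 u y g = tw1 v x h \<otimes>\<^bsub>K\<^esub> c}"
    if "y \<in> pts (dom1 u)" "y' \<in> pts (dom1 u)" "x \<in> pts (dom1 v)" "x' \<in> pts (dom1 v)" for y x c y' x' c'
    using that by (auto simp: comma_cat_def Let_def)
  have HomP: "Hom (E0 P) (pr y (pr x c)) (pr y' (pr x' c')) = {m. \<exists>g h. m = pr g h \<and> (g, h) \<in> Hom ?T (y, x, c) (y', x', c')}"
    if z: "pr y (pr x c) \<in> pts P" and z': "pr y' (pr x' c') \<in> pts P" for y x c y' x' c'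
  proof -
    have "tw1 v x h \<otimes>\<^bsub>K\<^esub> c \<otimes>\<^bsub>K\<^esub> inv\<^bsub>K\<^esub> (tw1 u y g) = c' \<longleftrightarrow> c' \<otimes>\<^bsub>K\<^esub> tw1 u y g = tw1 v x h \<otimes>\<^bsub>K\<^esub> c"
      if "g \<in> carrier G" "h \<in> carrier H" for g h
      using z z' that K.inv_solve_right[of c' "tw1 v x h \<otimes>\<^bsub>K\<^esub> c" "tw1 u y g"] by (auto simp: cell_simps)
    then show ?thesis
      using z z' by (auto elim!: prod_grpE simp: HomT)
  qed
  have F: "is_functor ?C"
    unfolding comma_comparison_def
  proof (rule is_functor_mk)
    show "is_category ?T"
      by (rule is_category_comma_cat) (simp_all add: is_functor_E1 u v uv)
    show "is_category (fdom (E1 q1))" by (simp add: is_category_E0 is_cell0_P)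
    fix z assume "z \<in> Ob (fdom (E1 q1))"
    then have z: "z \<in> pts P" by simp
    then show "(fob (E1 q1) z, fob (E1 q2) z, ncmp (E2 k) z) \<in> Ob ?T"
      by (auto simp: ObT elim!: pts_PE)
    show "(far (E1 q1) z z (Idt (fdom (E1 q1)) z), far (E1 q2) z z (Idt (fdom (E1 q1)) z)) =
         Idt ?T (fob (E1 q1) z, fob (E1 q2) z, ncmp (E2 k) z)"
      using z act_one[OF is_cell0_P z] group_prod_grp[of G H, THEN group.is_monoid, THEN monoid.one_closed]
        cell0_group[OF c1_dom[OF u]] cell0_group[OF c1_dom[OF v]]
      by (simp add: comma_cat_def Let_def)
  next
    fix z z' m assume a: "z \<in> Ob (fdom (E1 q1))" "z' \<in> Ob (fdom (E1 q1))" "m \<in> Hom (fdom (E1 q1)) z z'"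
    then have z: "z \<in> pts P" "z' \<in> pts P" and m: "m \<in> carrier (prod_grp G H)" "act P m z = z'" by simp_all
    obtain y x c where y: "z = pr y (pr x c)" using z(1) by (rule pts_PE)
    obtain y' x' c' where y': "z' = pr y' (pr x' c')" using z(2) by (rule pts_PE)
    have "m \<in> Hom (E0 P) (pr y (pr x c)) (pr y' (pr x' c'))" using a y y' by simp
    then show "(far (E1 q1) z z' m, far (E1 q2) z z' m) \<in> Hom ?T (fob (E1 q1) z, fob (E1 q2) z, ncmp (E2 k) z)
        (fob (E1 q1) z', fob (E1 q2) z', ncmp (E2 k) z')"
      using z m unfolding HomP[OF z[unfolded y y']] by (auto simp: y y')
  next
    fix w x y f g
    assume a: "w \<in> Ob (fdom (E1 q1))" "x \<in> Ob (fdom (E1 q1))" "y \<in> Ob (fdom (E1 q1))"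
      "f \<in> Hom (fdom (E1 q1)) w x" "g \<in> Hom (fdom (E1 q1)) x y"
    then have "Cmp (fdom (E1 q1)) w x y g f \<in> Hom (fdom (E1 q1)) w y"
      using cat_comp[OF is_category_E0[OF is_cell0_P]] by simp
    with a show "(far (E1 q1) w y (Cmp (fdom (E1 q1)) w x y g f), far (E1 q2) w y (Cmp (fdom (E1 q1)) w x y g f)) =
       Cmp ?T (fob (E1 q1) w, fob (E1 q2) w, ncmp (E2 k) w)
        (fob (E1 q1) x, fob (E1 q2) x, ncmp (E2 k) x) (fob (E1 q1) y, fob (E1 q2) y, ncmp (E2 k) y)
        (far (E1 q1) x y g, far (E1 q2) x y g) (far (E1 q1) w x f, far (E1 q2) w x f)"
      by (simp add: comma_cat_def Let_def)
  qed
  have "is_iso_functor ?C"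
    unfolding is_iso_functor_def d
  proof (intro conjI F ballI)
    show "bij_betw (fob ?C) (Ob (E0 P)) (Ob ?T)"
      by (rule bij_betw_byWitness[where f' = "\<lambda>(y, x, c). pr y (pr x c)"])
        (auto simp: fob ObT elim!: pts_PE)
    fix z z' assume "z \<in> Ob (E0 P)" "z' \<in> Ob (E0 P)"
    then have z: "z \<in> pts P" "z' \<in> pts P" by simp_all
    obtain y x c where y: "z = pr y (pr x c)" using z(1) by (rule pts_PE)
    obtain y' x' c' where y': "z' = pr y' (pr x' c')" using z(2) by (rule pts_PE)
    note H = HomP[OF z[unfolded y y']]
    have far': "far ?C (pr y (pr x c)) (pr y' (pr x' c')) (pr g h) = (g, h)"
      if "(g, h) \<in> Hom ?T (y, x, c) (y', x', c')" for g h
    proof -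
      have "pr g h \<in> Hom (E0 P) z z'" unfolding y y' H using that by blast
      then show ?thesis using far[OF z, of "pr g h"] by (simp add: y y')
    qed
    have "bij_betw (far ?C z z') (Hom (E0 P) z z') (Hom ?T (y, x, c) (y', x', c'))"
      by (rule bij_betw_byWitness[where f' = "\<lambda>(g, h). pr g h"])
        (unfold y y' H, auto simp: far')
    then show "bij_betw (far ?C z z') (Hom (E0 P) z z') (Hom ?T (fob ?C z) (fob ?C z'))"
      using fob[OF z(1)] fob[OF z(2)] by (simp only: y y' p1 p2)
  qed
  then show ?thesis
    unfolding gpd_comma_square_def
    using gpd_nat_E2[OF is_cell2_k] by (simp add: gpd_functor_E1 is_cell1_q1 is_cell1_q2 u v uv E1_comp1)
qed

end

text \<open>
  The comma cell of \<open>b\<close> and \<open>a\<close> has the universal property of a bipullback of \<open>a\<close> and \<open>b\<close>, except that its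
  2-cell points the other way: hence the inverses of \<open>k\<close> and \<open>C.k\<close>.
\<close>

lemma (in pairing) bipullback_comma:
  fixes a b c d :: "'u cell1"
  assumes bp: "is_bipullback a b c d k"
  obtains P e q1 q2 l i where "gpd_comma_square (E1 b) (E1 a) (E1 q1) (E1 q2) l"
    "is_cell1 q1" "is_cell1 q2" "dom1 q1 = P" "dom1 q2 = P" "cod1 q1 = dom1 b" "cod1 q2 = dom1 a"
    "is_cell1 e" "dom1 e = dom1 c" "cod1 e = P" "is_cell1 i" "dom1 i = P" "cod1 i = dom1 c"
    "comp1 q1 e = d" "comp1 q2 e = c" "iso1 (comp1 i e) (id1 (dom1 c))" "iso1 (comp1 e i) (id1 P)"
proof -
  have a: "is_cell1 a" and b: "is_cell1 b" and c: "is_cell1 c" and d: "is_cell1 d"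
    and dc: "cod1 a = cod1 b" "cod1 c = dom1 a" "cod1 d = dom1 b" "dom1 c = dom1 d"
    and k: "is_cell2 k" "src2 k = comp1 a c" "tgt2 k = comp1 b d"
    and ex: "\<And>s t f. is_cell1 s \<Longrightarrow> is_cell1 t \<Longrightarrow> dom1 s = dom1 t \<Longrightarrow> cod1 s = dom1 a \<Longrightarrow> cod1 t = dom1 b \<Longrightarrow>
       is_cell2 f \<Longrightarrow> src2 f = comp1 a s \<Longrightarrow> tgt2 f = comp1 b t \<Longrightarrow>
       \<exists>h m n. is_cell1 h \<and> dom1 h = dom1 s \<and> cod1 h = dom1 c \<and>
          is_cell2 m \<and> src2 m = comp1 c h \<and> tgt2 m = s \<and>
          is_cell2 n \<and> src2 n = comp1 d h \<and> tgt2 n = t \<and>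
          vcomp2 f (whiskL2 a m) = vcomp2 (whiskL2 b n) (whiskR2 k h)"
    and un: "\<And>h h' m n. is_cell1 h \<Longrightarrow> is_cell1 h' \<Longrightarrow> dom1 h = dom1 h' \<Longrightarrow> cod1 h = dom1 c \<Longrightarrow> cod1 h' = dom1 c \<Longrightarrow>
       is_cell2 m \<Longrightarrow> src2 m = comp1 c h \<Longrightarrow> tgt2 m = comp1 c h' \<Longrightarrow>
       is_cell2 n \<Longrightarrow> src2 n = comp1 d h \<Longrightarrow> tgt2 n = comp1 d h' \<Longrightarrow>
       vcomp2 (whiskR2 k h') (whiskL2 a m) = vcomp2 (whiskL2 b n) (whiskR2 k h) \<Longrightarrow>
       \<exists>!r. is_cell2 r \<and> src2 r = h \<and> tgt2 r = h' \<and> whiskL2 c r = m \<and> whiskL2 d r = n"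
    using bp unfolding is_bipullback_def by ((elim conjE, blast)+)
  interpret C: comma_cell pr p1 p2 b a
    by unfold_locales (simp_all add: a b dc)
  \<comment> \<open>The comparison into the comma cell, with strict triangles
    \<open>comp1 C.q1 e = d\<close> and \<open>comp1 C.q2 e = c\<close>.\<close>
  define e where "e = C.induced d c (inv2 k)"
  note e' = C.induced[OF d dc(3) c dc(2,4) is_cell2_inv2[OF k(1)], unfolded inv2_simps, OF k(3,2), folded e_def]
  have e: "is_cell1 e" "comp1 C.q1 e = d" "comp1 C.q2 e = c" "dom1 e = dom1 d" "cod1 e = C.P"
    using e' by (simp_all add: e_def C.induced_def)
  have e3: "p2 (p2 (map1 e w)) = inv\<^bsub>grp (cod1 b)\<^esub> (cmp2 k w)" if "w \<in> pts (dom1 d)" for w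
    using e'(4)[OF that] cmp2_inv2[OF k(1), of w] that dc by (simp add: k)
  note f = is_cell2_inv2[OF C.is_cell2_k]
  \<comment> \<open>The comparison back comes from the universal property of the bipullback, so its
    triangles commute only up to \<open>m\<close> and \<open>n\<close>.\<close>
  obtain i m n where i: "is_cell1 i" "dom1 i = C.P" "cod1 i = dom1 c"
    and m: "is_cell2 m" "src2 m = comp1 c i" "tgt2 m = C.q2"
    and n: "is_cell2 n" "src2 n = comp1 d i" "tgt2 n = C.q1"
    and mn: "vcomp2 (inv2 C.k) (whiskL2 a m) = vcomp2 (whiskL2 b n) (whiskR2 k i)"
    using ex[OF C.is_cell1_q2 C.is_cell1_q1 _ _ _ f] by auto
  note I = c1_map[OF i(1), unfolded i dc] and Ec = c1_map[OF e(1), unfolded e]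
  note Mc = c2_cmp[OF m(1), unfolded m, simplified, unfolded i dc]
    and Nc = c2_cmp[OF n(1), unfolded n, simplified, unfolded i dc]
  note kc = c2_cmp[OF k(1), unfolded k, simplified, unfolded dc]
  \<comment> \<open>The coherence between \<open>m\<close> and \<open>n\<close>, read at one point.
    Both round trips reduce to this equation.\<close>
  have eq: "inv\<^bsub>grp (cod1 b)\<^esub> (p2 (p2 z)) \<otimes>\<^bsub>grp (cod1 b)\<^esub> tw1 a (map1 c (map1 i z)) (cmp2 m z) =
      tw1 b (map1 d (map1 i z)) (cmp2 n z) \<otimes>\<^bsub>grp (cod1 b)\<^esub> cmp2 k (map1 i z)" if z: "z \<in> pts C.P" for z
  proof -
    have "cmp2 (vcomp2 (inv2 C.k) (whiskL2 a m)) z = cmp2 (vcomp2 (whiskL2 b n) (whiskR2 k i)) z"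
      using mn by simp
    then show ?thesis
      using z cmp2_inv2[OF C.is_cell2_k, of z] by (simp add: m n k i dc)
  qed
  \<comment> \<open>Since the triangles of \<open>e\<close> are strict, \<open>m\<close> and
    \<open>n\<close> themselves connect the projections of \<open>comp1 e i\<close> with those of
    the identity.\<close>
  have ei: "iso1 (comp1 e i) (id1 C.P)"
  proof (rule C.iso1_P)
    show "is_cell1 (comp1 e i)" by (simp add: is_cell1_comp1 i e dc)
    show "is_cell1 (id1 C.P)" by (rule is_cell1_id1[OF C.is_cell0_P])
    show "is_cell2 n" "is_cell2 m" by fact+
    have q: "comp1 C.q1 (id1 C.P) = C.q1" "comp1 C.q2 (id1 C.P) = C.q2"
      using comp1_id1(1)[OF C.is_cell1_q1] comp1_id1(1)[OF C.is_cell1_q2] by simp_all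
    show "tgt2 n = comp1 C.q1 (id1 C.P)" "tgt2 m = comp1 C.q2 (id1 C.P)"
      by (simp_all add: q m n)
    have "cod1 i = dom1 e" using i e dc by simp
    then show "src2 n = comp1 C.q1 (comp1 e i)" "src2 m = comp1 C.q2 (comp1 e i)"
      using comp1_assoc[OF i(1) e(1) C.is_cell1_q1] comp1_assoc[OF i(1) e(1) C.is_cell1_q2]
      by (simp_all add: e m n)
    fix z assume "z \<in> pts (dom1 (comp1 e i))"
    then have z: "z \<in> pts C.P" by (simp add: i)
    have iz: "map1 i z \<in> pts (dom1 d)" by (rule I[OF z])
    have p: "p1 (map1 e (map1 i z)) = map1 d (map1 i z)" "p1 (p2 (map1 e (map1 i z))) = map1 c (map1 i z)"
      using comp1_simps(3)[of "map1 i z" e C.q1] comp1_simps(3)[of "map1 i z" e C.q2] iz Ec[OF iz]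
      by (simp_all add: e)
    let ?m = "\<lambda>u v. u \<otimes>\<^bsub>grp (cod1 b)\<^esub> v" and ?i = "\<lambda>u. inv\<^bsub>grp (cod1 b)\<^esub> u"
    let ?A = "tw1 a (map1 c (map1 i z)) (cmp2 m z)" and ?B = "tw1 b (map1 d (map1 i z)) (cmp2 n z)"
    let ?c = "p2 (p2 z)" and ?k = "cmp2 k (map1 i z)"
    have cl: "?A \<in> carrier (grp (cod1 b))" "?B \<in> carrier (grp (cod1 b))" "?c \<in> carrier (grp (cod1 b))" "?k \<in> carrier (grp (cod1 b))"
      using c1_tw[OF a, unfolded dc] c1_tw[OF b] c1_map[OF c, unfolded dc] c1_map[OF d, unfolded dc] iz Mc[OF z] Nc[OF z]
        kc z by (auto elim!: C.pts_PE)
    \<comment> \<open>\<open>eq\<close> is multiplied by \<open>?c\<close> on the left and by the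
      inverse of \<open>?k\<close> on the right.\<close>
    have "?m ?c ?B = ?m ?c (?m (?m ?B ?k) (?i ?k))" using cl by (simp add: C.K.m_assoc)
    also have "\<dots> = ?m ?c (?m (?m (?i ?c) ?A) (?i ?k))" by (simp only: eq[OF z])
    also have "\<dots> = ?m ?A (?i ?k)" using cl by (simp add: C.K.m_assoc[symmetric])
    finally show "p2 (p2 (map1 (id1 C.P) z)) \<otimes>\<^bsub>grp (cod1 b)\<^esub> tw1 b (p1 (map1 (comp1 e i) z)) (cmp2 n z) =
        tw1 a (p1 (p2 (map1 (comp1 e i) z))) (cmp2 m z) \<otimes>\<^bsub>grp (cod1 b)\<^esub> p2 (p2 (map1 (comp1 e i) z))"
      using z iz by (simp add: i p e3)
  qed (simp_all add: i e)
  have ie: "iso1 (comp1 i e) (id1 (dom1 c))"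
  proof -
    have ce: "is_cell1 (comp1 i e)" by (simp add: is_cell1_comp1 i e)
    have cid: "is_cell1 (id1 (dom1 c))" by (rule is_cell1_id1[OF c1_dom[OF c]])
    have ass: "comp1 c (comp1 i e) = comp1 (comp1 c i) e" "comp1 d (comp1 i e) = comp1 (comp1 d i) e"
      by (rule comp1_assoc; simp add: i e c d dc)+
    have me: "is_cell2 (whiskR2 m e)" "is_cell2 (whiskR2 n e)"
      by (simp_all add: is_cell2_whiskR2 m n e i)
    have ids: "comp1 c (id1 (dom1 c)) = c" "comp1 d (id1 (dom1 c)) = d"
      using comp1_id1(1)[OF c] comp1_id1(1)[OF d] dc by simp_all
    have ac: "is_cell1 (comp1 a c)" "is_cell1 (comp1 b d)" by (simp_all add: is_cell1_comp1 a b c d dc)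
    \<comment> \<open>At \<open>w\<close> this is \<open>eq\<close> at \<open>map1 e w\<close>,
      whose third coordinate is the inverse of \<open>cmp2 k w\<close> by \<open>e3\<close>.\<close>
    have "vcomp2 (whiskR2 k (id1 (dom1 c))) (whiskL2 a (whiskR2 m e)) = vcomp2 (whiskL2 b (whiskR2 n e)) (whiskR2 k (comp1 i e))"
    proof (rule cell2_eqI)
      show "is_cell2 (vcomp2 (whiskR2 k (id1 (dom1 c))) (whiskL2 a (whiskR2 m e)))"
        by (intro is_cell2_vcomp2 is_cell2_whiskL2 is_cell2_whiskR2 m k a e cid)
          (simp_all add: m k i e dc, metis comp1_id1(1) ac(1) comp1_simps(1) dc(4))
      show "is_cell2 (vcomp2 (whiskL2 b (whiskR2 n e)) (whiskR2 k (comp1 i e)))"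
        by (intro is_cell2_vcomp2 is_cell2_whiskL2 is_cell2_whiskR2 n k b e ce)
          (simp_all add: n k i e dc, simp add: ass(2)[symmetric] comp1_assoc[OF ce d b] i e dc)
      show "src2 (vcomp2 (whiskR2 k (id1 (dom1 c))) (whiskL2 a (whiskR2 m e))) = src2 (vcomp2 (whiskL2 b (whiskR2 n e)) (whiskR2 k (comp1 i e)))"
        using comp1_assoc[OF ce c a] ass by (simp add: m k dc i e)
      show "tgt2 (vcomp2 (whiskR2 k (id1 (dom1 c))) (whiskL2 a (whiskR2 m e))) = tgt2 (vcomp2 (whiskL2 b (whiskR2 n e)) (whiskR2 k (comp1 i e)))"
        using comp1_id1(1)[OF ac(2)] by (simp add: n k dc e)
      fix w assume "w \<in> pts (dom1 (src2 (vcomp2 (whiskR2 k (id1 (dom1 c))) (whiskL2 a (whiskR2 m e)))))"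
      then have w: "w \<in> pts (dom1 d)" by (simp add: m e)
      have ew: "map1 e w \<in> pts C.P" by (rule Ec[OF w])
      show "cmp2 (vcomp2 (whiskR2 k (id1 (dom1 c))) (whiskL2 a (whiskR2 m e))) w =
          cmp2 (vcomp2 (whiskL2 b (whiskR2 n e)) (whiskR2 k (comp1 i e))) w"
        using eq[OF ew] e3[OF w] kc w ew by (simp add: m n k e i dc)
    qed
    \<comment> \<open>The two-dimensional universal property of the bipullback turns the whiskered
      \<open>m\<close> and \<open>n\<close> into one 2-cell from \<open>comp1 i e\<close> to the
      identity.\<close>
    then have "\<exists>!r. is_cell2 r \<and> src2 r = comp1 i e \<and> tgt2 r = id1 (dom1 c) \<and>
        whiskL2 c r = whiskR2 m e \<and> whiskL2 d r = whiskR2 n e"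
      by (intro un[OF ce cid _ _ _ me(1) _ _ me(2)]) (simp_all add: e i m n dc ass ids[unfolded dc])
    then show ?thesis unfolding iso1_def by blast
  qed
  show ?thesis
    by (rule that[OF C.gpd_comma_square_P C.is_cell1_q1 C.is_cell1_q2 _ _ _ _ e(1) _ e(5) i e(2,3) ie ei])
      (simp_all add: e dc)
qed

section \<open>Coproducts of cells\<close>

text \<open>
  The group \<open>L\<close> is \<open>G \<times> H\<close>, given by projections \<open>\<rho>\<close>, \<open>\<sigma>\<close> and pairing \<open>\<iota>\<close> so that the lemma applies to
  either factor. The tag \<open>t\<close> keeps the points of two inflated cells disjoint.
\<close>

lemma (in pairing) inflate:
  fixes X :: "'u cell0" and H L :: "'u monoid" and t :: 'u
  assumes X: "is_cell0 X" and H: "group H" "finite (carrier H)" and L: "group L" "finite (carrier L)"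
    and \<rho>: "\<rho> \<in> hom L (grp X)" and \<sigma>: "\<sigma> \<in> hom L H"
    and \<iota>: "\<And>g h. g \<in> carrier (grp X) \<Longrightarrow> h \<in> carrier H \<Longrightarrow> \<iota> g h \<in> carrier L"
      "\<And>g h. g \<in> carrier (grp X) \<Longrightarrow> h \<in> carrier H \<Longrightarrow> \<rho> (\<iota> g h) = g"
      "\<And>g h. g \<in> carrier (grp X) \<Longrightarrow> h \<in> carrier H \<Longrightarrow> \<sigma> (\<iota> g h) = h"
      "\<And>l. l \<in> carrier L \<Longrightarrow> \<iota> (\<rho> l) (\<sigma> l) = l"
  obtains X' r s where "is_cell0 X'" "grp X' = L" "pts X' \<subseteq> range (pr t)"
    "is_cell1 r" "dom1 r = X" "cod1 r = X'" "is_cell1 s" "dom1 s = X'" "cod1 s = X"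
    "iso1 (comp1 s r) (id1 X)" "iso1 (comp1 r s) (id1 X')"
proof -
  interpret G: group "grp X" by (rule cell0_group[OF X])
  interpret H: group H by fact
  interpret L: group L by fact
  interpret \<rho>: group_hom L "grp X" \<rho> by unfold_locales (rule \<rho>)
  interpret \<sigma>: group_hom L H \<sigma> by unfold_locales (rule \<sigma>)
  \<comment> \<open>\<open>\<iota>\<close> inverts the bijective homomorphism
    \<open>(\<rho>, \<sigma>)\<close>, hence is multiplicative.\<close>
  have \<iota>_mult: "\<iota> g h \<otimes>\<^bsub>L\<^esub> \<iota> g' h' = \<iota> (g \<otimes>\<^bsub>grp X\<^esub> g') (h \<otimes>\<^bsub>H\<^esub> h')"
    if "g \<in> carrier (grp X)" "h \<in> carrier H" "g' \<in> carrier (grp X)" "h' \<in> carrier H" for g h g' h'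
    using \<iota>(4)[of "\<iota> g h \<otimes>\<^bsub>L\<^esub> \<iota> g' h'"] \<iota>(1-3) that by simp
  \<comment> \<open>The points are those of \<open>X \<times> H\<close>, with \<open>L\<close>
    acting on \<open>H\<close> by left translation through \<open>\<sigma>\<close>. Left translation
    is free, so enlarging the group adds no automorphisms to the action groupoid.\<close>
  define Q where "Q = (\<lambda>(x, h). pr t (pr x h)) ` (pts X \<times> carrier H)"
  define X' where "X' = \<lparr>grp = L, pts = Q,
    act = (\<lambda>l. \<lambda>z\<in>Q. pr t (pr (act X (\<rho> l) (p1 (p2 z))) (\<sigma> l \<otimes>\<^bsub>H\<^esub> p2 (p2 z))))\<rparr>"
  have g: "grp X' = L" by (simp add: X'_def)
  have Q: "pr t (pr x h) \<in> pts X' \<longleftrightarrow> x \<in> pts X \<and> h \<in> carrier H" for x h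
    by (auto simp: X'_def Q_def)
  have QE: thesis if "z \<in> pts X'" "\<And>x h. z = pr t (pr x h) \<Longrightarrow> x \<in> pts X \<Longrightarrow> h \<in> carrier H \<Longrightarrow> thesis" for z thesis
    using that by (auto simp: X'_def Q_def)
  have a: "act X' l (pr t (pr x h)) = pr t (pr (act X (\<rho> l) x) (\<sigma> l \<otimes>\<^bsub>H\<^esub> h))"
    if "x \<in> pts X" "h \<in> carrier H" for l x h
    using Q[of x h] that by (simp add: X'_def)
  note ac = act_closed[OF X] act_one[OF X] act_mult[OF X]
  have X': "is_cell0 X'"
  proof (rule is_cell0I)
    show "group (grp X')" "finite (carrier (grp X'))" using L by (simp_all add: g)
    show "finite (pts X')" using X H(2) by (simp add: X'_def Q_def is_cell0_def)
    show "act X' l \<in> extensional (pts X')" for l by (simp add: X'_def)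
  qed (auto simp: g Q a ac H.m_assoc elim!: QE)
  define r where "r = mk1 X X' (\<lambda>x. pr t (pr x \<one>\<^bsub>H\<^esub>)) (\<lambda>_ g. \<iota> g \<one>\<^bsub>H\<^esub>)"
  define s where "s = mk1 X' X (\<lambda>z. p1 (p2 z)) (\<lambda>_. \<rho>)"
  have r: "is_cell1 r"
    unfolding r_def by (rule is_cell1_mk1[OF X X']) (auto simp: Q a \<iota> \<iota>_mult g ac)
  have s: "is_cell1 s"
    unfolding s_def by (rule is_cell1_mk1[OF X' X]) (auto simp: a g elim!: QE)
  have d: "dom1 r = X" "cod1 r = X'" "dom1 s = X'" "cod1 s = X" by (simp_all add: r_def s_def)
  have sr: "comp1 s r = id1 X"
    by (rule cell1_eqI)
      (simp_all add: is_cell1_comp1 r s d is_cell1_id1 X, simp_all add: r_def s_def Q \<iota> g)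
  \<comment> \<open>\<open>comp1 r s\<close> sends \<open>(x, h)\<close> to
    \<open>(x, \<one>)\<close>, and the group element \<open>\<iota> \<one> h\<close> moves it
    back.\<close>
  have rs: "is_cell2 (mk2 (comp1 r s) (id1 X') (\<lambda>z. \<iota> \<one>\<^bsub>grp X\<^esub> (p2 (p2 z))))"
  proof (rule is_cell2_mk2)
    fix z l assume "z \<in> pts (dom1 (comp1 r s))" "l \<in> carrier (grp (dom1 (comp1 r s)))"
    then have z: "z \<in> pts X'" and l: "l \<in> carrier L" by (simp_all add: d g)
    obtain x h where xh: "z = pr t (pr x h)" "x \<in> pts X" "h \<in> carrier H" using z by (rule QE)
    \<comment> \<open>Both sides multiply out to
      \<open>\<iota> (\<rho> l) (\<sigma> l \<otimes> h)\<close>.\<close>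
    have "\<iota> \<one>\<^bsub>grp X\<^esub> (\<sigma> l \<otimes>\<^bsub>H\<^esub> h) \<otimes>\<^bsub>L\<^esub> \<iota> (\<rho> l) \<one>\<^bsub>H\<^esub> = \<iota> (\<rho> l) (\<sigma> l) \<otimes>\<^bsub>L\<^esub> \<iota> \<one>\<^bsub>grp X\<^esub> h"
      using xh l by (simp only: \<iota>_mult \<rho>.hom_closed \<sigma>.hom_closed G.one_closed H.one_closed H.m_closed G.l_one G.r_one H.r_one)
    then show "\<iota> \<one>\<^bsub>grp X\<^esub> (p2 (p2 (act (dom1 (comp1 r s)) l z))) \<otimes>\<^bsub>grp (cod1 (comp1 r s))\<^esub> tw1 (comp1 r s) z l =
       tw1 (id1 X') z l \<otimes>\<^bsub>grp (cod1 (comp1 r s))\<^esub> \<iota> \<one>\<^bsub>grp X\<^esub> (p2 (p2 z))"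
      using xh l z by (simp add: d g a \<iota>(4), simp add: r_def s_def g Q)
  next
    fix z assume "z \<in> pts (dom1 (comp1 r s))"
    then have z: "z \<in> pts X'" by (simp add: d)
    obtain x h where xh: "z = pr t (pr x h)" "x \<in> pts X" "h \<in> carrier H" using z by (rule QE)
    show "\<iota> \<one>\<^bsub>grp X\<^esub> (p2 (p2 z)) \<in> carrier (grp (cod1 (comp1 r s)))" using xh by (simp add: d g \<iota>)
    show "map1 (id1 X') z = act (cod1 (comp1 r s)) (\<iota> \<one>\<^bsub>grp X\<^esub> (p2 (p2 z))) (map1 (comp1 r s) z)"
      using xh z by (simp add: d, simp add: r_def s_def a ac \<iota>)
  qed (simp_all add: is_cell1_comp1 r s d is_cell1_id1 X')
  show ?thesis
  proof (rule that[OF X' g _ r d(1,2) s d(3,4)])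
    show "pts X' \<subseteq> range (pr t)" by (auto elim!: QE)
    show "iso1 (comp1 s r) (id1 X)" by (simp add: sr iso1_refl is_cell1_id1 X)
    show "iso1 (comp1 r s) (id1 X')" by (rule iso1_mk2[OF rs])
  qed
qed

section \<open>Disjoint sums over a common group\<close>

locale disjoint_sum =
  fixes A B :: "'u cell0"
  assumes A: "is_cell0 A" and B: "is_cell0 B" and grp_eq: "grp B = grp A" and disj: "pts A \<inter> pts B = {}"
begin

definition S :: "'u cell0" where
  "S = \<lparr>grp = grp A, pts = pts A \<union> pts B,
     act = (\<lambda>g. \<lambda>z\<in>pts A \<union> pts B. if z \<in> pts A then act A g z else act B g z)\<rparr>"

lemma notin_A: "z \<in> pts B \<Longrightarrow> z \<notin> pts A"
  using disj by blast

lemma S_simps [simp]: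
  "grp S = grp A" "pts S = pts A \<union> pts B" "z \<in> pts A \<Longrightarrow> act S g z = act A g z"
  "z \<in> pts B \<Longrightarrow> act S g z = act B g z"
  using notin_A by (auto simp: S_def)

lemmas act_simps = act_closed[OF A] act_one[OF A] act_mult[OF A]
  act_closed[OF B, unfolded grp_eq] act_one[OF B, unfolded grp_eq] act_mult[OF B, unfolded grp_eq]

lemma is_cell0_S: "is_cell0 S"
proof (rule is_cell0I)
  show "group (grp S)" "finite (carrier (grp S))" "finite (pts S)"
    using A B by (simp_all add: is_cell0_def)
  show "act S g \<in> extensional (pts S)" for g by (simp add: S_def)
qed (auto simp: act_simps)

definition iA :: "'u cell1" where
  "iA = mk1 A S (\<lambda>z. z) (\<lambda>_ g. g)"

definition iB :: "'u cell1" where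
  "iB = mk1 B S (\<lambda>z. z) (\<lambda>_ g. g)"

lemma incl_simps [simp]:
  "dom1 iA = A" "cod1 iA = S" "z \<in> pts A \<Longrightarrow> map1 iA z = z"
  "z \<in> pts A \<Longrightarrow> g \<in> carrier (grp A) \<Longrightarrow> tw1 iA z g = g"
  "dom1 iB = B" "cod1 iB = S" "z \<in> pts B \<Longrightarrow> map1 iB z = z"
  "z \<in> pts B \<Longrightarrow> g \<in> carrier (grp A) \<Longrightarrow> tw1 iB z g = g"
  by (simp_all add: iA_def iB_def grp_eq)

lemma is_cell1_iA: "is_cell1 iA"
  unfolding iA_def by (rule is_cell1_mk1[OF A is_cell0_S]) simp_all

lemma is_cell1_iB: "is_cell1 iB"
  unfolding iB_def by (rule is_cell1_mk1[OF B is_cell0_S]) (simp_all add: grp_eq)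

text \<open>The twist of a 1-cell may vary from point to point, so the twists of \<open>f\<close>
  and \<open>g\<close> need not agree in any way.\<close>

lemma glue1:
  assumes f: "is_cell1 f" "dom1 f = A" and g: "is_cell1 g" "dom1 g = B" "cod1 g = cod1 f"
  obtains h where "is_cell1 h" "dom1 h = S" "cod1 h = cod1 f" "comp1 h iA = f" "comp1 h iB = g"
proof -
  note F = c1_map[OF f(1), unfolded f] c1_tw[OF f(1), unfolded f] c1_act[OF f(1), unfolded f] c1_mult[OF f(1), unfolded f]
  note G = c1_map[OF g(1), unfolded g grp_eq] c1_tw[OF g(1), unfolded g grp_eq] c1_act[OF g(1), unfolded g grp_eq]
    c1_mult[OF g(1), unfolded g grp_eq]
  define h where "h = mk1 S (cod1 f) (\<lambda>z. if z \<in> pts A then map1 f z else map1 g z)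
    (\<lambda>z. if z \<in> pts A then tw1 f z else tw1 g z)"
  have d: "dom1 h = S" "cod1 h = cod1 f" by (simp_all add: h_def)
  have h: "is_cell1 h"
    unfolding h_def by (rule is_cell1_mk1[OF is_cell0_S c1_cod[OF f(1)]]) (auto simp: F G act_simps notin_A)
  have "comp1 h iA = f"
    by (rule cell1_eqI) (simp_all add: is_cell1_comp1 is_cell1_iA h f d, simp_all add: h_def)
  moreover have "comp1 h iB = g"
    by (rule cell1_eqI) (simp_all add: is_cell1_comp1 is_cell1_iB h g d grp_eq, simp_all add: h_def notin_A)
  ultimately show ?thesis using that h d by blast
qed

text \<open>Every orbit lies inside \<open>A\<close> or inside \<open>B\<close>, so components
  chosen separately on the two parts stay natural. Together with \<open>glue1\<close> this lets
  \<open>S\<close> act as a bicoproduct.\<close>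

lemma glue2:
  assumes h: "is_cell1 h" "dom1 h = S" and h': "is_cell1 h'" "dom1 h' = S" "cod1 h' = cod1 h"
    and "iso1 (comp1 h iA) (comp1 h' iA)" "iso1 (comp1 h iB) (comp1 h' iB)"
  shows "iso1 h h'"
proof -
  obtain m where m: "is_cell2 m" "src2 m = comp1 h iA" "tgt2 m = comp1 h' iA" using assms(6) by (rule iso1E)
  obtain n where n: "is_cell2 n" "src2 n = comp1 h iB" "tgt2 n = comp1 h' iB" using assms(7) by (rule iso1E)
  note M = c2_cmp[OF m(1), unfolded m, simplified] c2_map[OF m(1), unfolded m, simplified] c2_nat[OF m(1), unfolded m, simplified]
  note N = c2_cmp[OF n(1), unfolded n, simplified] c2_map[OF n(1), unfolded n, simplified] c2_nat[OF n(1), unfolded n, simplified]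
  have "is_cell2 (mk2 h h' (\<lambda>z. if z \<in> pts A then cmp2 m z else cmp2 n z))"
  proof (rule is_cell2_mk2)
    fix z g assume "z \<in> pts (dom1 h)" "g \<in> carrier (grp (dom1 h))"
    then show "(if act (dom1 h) g z \<in> pts A then cmp2 m (act (dom1 h) g z) else cmp2 n (act (dom1 h) g z)) \<otimes>\<^bsub>grp (cod1 h)\<^esub>
       tw1 h z g = tw1 h' z g \<otimes>\<^bsub>grp (cod1 h)\<^esub> (if z \<in> pts A then cmp2 m z else cmp2 n z)"
      using M(3)[of z g] N(3)[of z g] by (auto simp: h act_simps notin_A grp_eq)
  next
    fix z assume "z \<in> pts (dom1 h)"
    then have z: "z \<in> pts A \<or> z \<in> pts B" by (simp add: h)
    show "(if z \<in> pts A then cmp2 m z else cmp2 n z) \<in> carrier (grp (cod1 h))"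
      using z M(1)[of z] N(1)[of z] by auto
    show "map1 h' z = act (cod1 h) (if z \<in> pts A then cmp2 m z else cmp2 n z) (map1 h z)"
      using z M(2)[of z] N(2)[of z] by auto
  qed (simp_all add: h h')
  then show ?thesis by (rule iso1_mk2)
qed

text \<open>No arrow of the action groupoid of \<open>S\<close> joins \<open>A\<close> to
  \<open>B\<close>, so a functor out of it is strictly the same as a pair of functors. This is the
  form of coproduct that (i) accepts.\<close>

lemma is_coproduct_finGpd: "is_coproduct finGpd (E0 A) (E0 B) (E0 S) (E1 iA) (E1 iB)"
proof -
  have ex: "\<exists>!h. (gpd_functor h \<and> fdom h = E0 S \<and> fcod h = T) \<and> fcomp h (E1 iA) = f \<and> fcomp h (E1 iB) = g"
    if T: "fin_groupoid T" and f: "gpd_functor f" "fdom f = E0 A" "fcod f = T"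
      and g: "gpd_functor g" "fdom g = E0 B" "fcod g = T" for T f g
  proof (rule ex1I)
    have f': "is_functor f" and g': "is_functor g" using f g by (auto simp: gpd_functor_def)
    note F = fun_ob[OF f', unfolded f, simplified] fun_ar[OF f', unfolded f, simplified] fun_id[OF f', unfolded f, simplified]
      fun_comp[OF f', unfolded f, simplified]
    note G = fun_ob[OF g', unfolded g, simplified grp_eq E0_simps] fun_ar[OF g', unfolded g, simplified grp_eq E0_simps]
      fun_id[OF g', unfolded g, simplified grp_eq E0_simps] fun_comp[OF g', unfolded g, simplified grp_eq E0_simps]
    define h where "h = mk_functor (E0 S) T (\<lambda>z. if z \<in> pts A then fob f z else fob g z)
      (\<lambda>z w m. if z \<in> pts A then far f z w m else far g z w m)"
    have "is_functor h"
      unfolding h_def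
      by (rule is_functor_mk) (use T in \<open>auto simp: is_category_E0 is_cell0_S fin_groupoid_def F G act_simps notin_A\<close>)
    then have h: "gpd_functor h" "fdom h = E0 S" "fcod h = T"
      using T fin_groupoid_E0[OF is_cell0_S] by (auto simp: gpd_functor_def h_def)
    have fA: "is_functor (fcomp k (E1 iA))" and fB: "is_functor (fcomp k (E1 iB))"
      if "gpd_functor k" "fdom k = E0 S" for k
      using that by (auto simp: is_functor_fcomp is_functor_E1 is_cell1_iA is_cell1_iB gpd_functor_def)
    have "fcomp h (E1 iA) = f"
      by (rule functor_eqI[OF fA f']) (use h f in \<open>auto simp: h_def act_simps\<close>)
    moreover have "fcomp h (E1 iB) = g"
      by (rule functor_eqI[OF fB g']) (use h g in \<open>auto simp: h_def act_simps notin_A grp_eq\<close>)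
    ultimately show "(gpd_functor h \<and> fdom h = E0 S \<and> fcod h = T) \<and> fcomp h (E1 iA) = f \<and> fcomp h (E1 iB) = g"
      using h by simp
    fix h' assume "(gpd_functor h' \<and> fdom h' = E0 S \<and> fcod h' = T) \<and> fcomp h' (E1 iA) = f \<and> fcomp h' (E1 iB) = g"
    then have h': "gpd_functor h'" "fdom h' = E0 S" "fcod h' = T" "fcomp h' (E1 iA) = f" "fcomp h' (E1 iB) = g" by auto
    have oA: "fob f z = fob h' z" if "z \<in> pts A" for z
      using that fcomp_simps(3)[of z "E1 iA" h'] h' by simp
    have oB: "fob g z = fob h' z" if "z \<in> pts B" for z
      using that fcomp_simps(3)[of z "E1 iB" h'] h' by simp
    \<comment> \<open>Naming the target \<open>act A m z\<close> covers all arrows out of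
      \<open>z\<close>, as a group element and its source determine the target.\<close>
    have aA: "far f z (act A m z) m = far h' z (act A m z) m" if "z \<in> pts A" "m \<in> carrier (grp A)" for z m
      using that fcomp_simps(4)[of z "E1 iA" "act A m z" m h'] h' by (simp add: act_simps)
    have aB: "far g z (act B m z) m = far h' z (act B m z) m" if "z \<in> pts B" "m \<in> carrier (grp A)" for z m
      using that fcomp_simps(4)[of z "E1 iB" "act B m z" m h'] h' by (simp add: act_simps grp_eq)
    show "h' = h"
      by (rule functor_eqI)
        (use h h'(1-3) in \<open>auto simp: gpd_functor_def h_def oA oB aA aB act_simps notin_A\<close>)
  qed
  show ?thesis
    unfolding is_coproduct_def finGpd_def
    using ex by (simp add: fin_groupoid_E0 A B is_cell0_S gpd_functor_E1 is_cell1_iA is_cell1_iB)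
qed

end

section \<open>The category of cells and the transfer functors\<close>

lemma scat_simps [simp]:
  "Ob scat = {X. is_cell0 X}"
  "Hom scat X Y = {class1 a | a. is_cell1 a \<and> dom1 a = X \<and> cod1 a = Y}"
  "Idt scat X = class1 (id1 X)"
  by (simp_all add: scat_def)

text \<open>By whiskering, all representatives have isomorphic composites, so the union that defines
  composition in \<open>scat\<close> consists of copies of one class.\<close>

lemma Cmp_scat:
  assumes a: "is_cell1 a" and b: "is_cell1 b" and ab: "cod1 a = dom1 b"
  shows "Cmp scat x y z (class1 b) (class1 a) = class1 (comp1 b a)"
proof -
  have "class1 (comp1 b' a') = class1 (comp1 b a)" if "iso1 b b'" "iso1 a a'" for a' b'
  proof -
    note i = iso1D[OF that(1)] iso1D[OF that(2)]
    have "iso1 (comp1 b a) (comp1 b a')" using iso1_compL[OF that(2) b ab] .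
    moreover have "iso1 (comp1 b a') (comp1 b' a')" using iso1_compR[OF that(1) i(6)] i ab by simp
    ultimately show ?thesis using iso1_trans class1_eq_iff is_cell1_comp1[OF a b ab] by metis
  qed
  then have "(\<Union>b'\<in>class1 b. \<Union>a'\<in>class1 a. class1 (comp1 b' a')) = (\<Union>b'\<in>class1 b. \<Union>a'\<in>class1 a. class1 (comp1 b a))"
    by (auto simp: class1_iff)
  \<comment> \<open>The index sets are nonempty, as each 1-cell lies in its own class.\<close>
  also have "\<dots> = class1 (comp1 b a)"
    using iso1_refl[OF a] iso1_refl[OF b] by (auto simp: class1_iff)
  finally show ?thesis by (simp add: scat_def)
qed

lemma is_category_scat: "is_category scat"
proof (rule is_categoryI)
  fix x :: "'u cell0" assume "x \<in> Ob scat"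
  then show "Idt scat x \<in> Hom scat x x" using is_cell1_id1[of x] by force
next
  fix x y z :: "'u cell0" and f g
  assume "f \<in> Hom scat x y" "g \<in> Hom scat y z"
  then obtain a b where ab: "is_cell1 a" "is_cell1 b" "cod1 a = dom1 b" "x = dom1 a" "z = cod1 b" "f = class1 a" "g = class1 b"
    by auto
  then show "Cmp scat x y z g f \<in> Hom scat x z"
    using is_cell1_comp1[OF ab(1-3)] comp1_simps(1,2)[of b a] by (auto simp: Cmp_scat simp del: comp1_simps)
next
  fix x y :: "'u cell0" and f assume "f \<in> Hom scat x y"
  then obtain a where a: "is_cell1 a" "x = dom1 a" "y = cod1 a" "f = class1 a" by auto
  then show "Cmp scat x x y f (Idt scat x) = f" "Cmp scat x y y (Idt scat y) f = f"
    by (simp_all add: Cmp_scat is_cell1_id1 c1_dom c1_cod comp1_id1)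
next
  fix w x y z :: "'u cell0" and f g h
  assume "f \<in> Hom scat w x" "g \<in> Hom scat x y" "h \<in> Hom scat y z"
  then obtain a b c where "is_cell1 a" "is_cell1 b" "is_cell1 c" "cod1 a = dom1 b" "cod1 b = dom1 c"
    "f = class1 a" "g = class1 b" "h = class1 c" by auto
  then show "Cmp scat w y z h (Cmp scat w x y g f) = Cmp scat w x z (Cmp scat x y z h g) f"
    by (simp add: Cmp_scat is_cell1_comp1 comp1_assoc)
qed

lemma is_category_op_cat:
  assumes "is_category C"
  shows "is_category (op_cat C)"
  by (rule is_categoryI)
    (simp_all add: op_cat_def cat_id[OF assms] cat_comp[OF assms] cat_idl[OF assms] cat_idr[OF assms] cat_assoc[OF assms])

lemma is_category_set_cat: "is_category set_cat"
  by (rule is_categoryI)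
    (auto simp: set_cat_def compose_def PiE_iff extensional_def fun_eq_iff)

text \<open>A one-element type has a pairing too; \<open>infinite\<close> supplies the two distinct
  tags that separate inflated cells.\<close>

locale transfer = derivator D shr \<eta> \<epsilon> + pairing pr p1 p2
  for D :: "('u, 'o, 'm) gpd_2functor" and shr \<eta> \<epsilon> and pr :: "'u \<Rightarrow> 'u \<Rightarrow> 'u" and p1 p2 +
  assumes infinite: "infinite (UNIV :: 'u set)"
    and coproduct: "\<And>I J S i j. is_coproduct finGpd I J S i j \<Longrightarrow> is_equivalence (fpair (D1 D i) (D1 D j))"
begin

text \<open>Base change settles the comma cell. Then \<open>push e\<close> after
  \<open>pull e\<close>, trivial for the equivalence \<open>e\<close>, is inserted between
  \<open>q2\<close> and \<open>q1\<close>, and the strict triangles fuse it into \<open>c\<close>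
  and \<open>d\<close>.\<close>

lemma push_pull_bipullback:
  assumes bp: "is_bipullback a b c d k" and y: "y \<in> M (dom1 b)"
  shows "pull a (push b y) = push c (pull d y)"
proof -
  have a: "is_cell1 a" and b: "is_cell1 b" and ab: "cod1 a = cod1 b"
    using bp by (simp_all add: is_bipullback_def)
  obtain P e q1 q2 l i where sq: "gpd_comma_square (E1 b) (E1 a) (E1 q1) (E1 q2) l"
    and q: "is_cell1 q1" "is_cell1 q2" "dom1 q1 = P" "dom1 q2 = P" "cod1 q1 = dom1 b" "cod1 q2 = dom1 a"
    and e: "is_cell1 e" "dom1 e = dom1 c" "cod1 e = P" and i: "is_cell1 i" "dom1 i = P" "cod1 i = dom1 c"
    and cd: "comp1 q1 e = d" "comp1 q2 e = c" and ie: "iso1 (comp1 i e) (id1 (dom1 c))" "iso1 (comp1 e i) (id1 P)"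
    using bipullback_comma[OF bp] .
  have q1y: "pull q1 y \<in> M P" using pull_in[OF q(1)] y q by simp
  have "pull a (push b y) = push q2 (pull q1 y)"
    by (rule push_pull_comma_square[OF b a q(1,2) _ _ _ _ sq y]) (simp_all add: ab q)
  also have "\<dots> = push q2 (push e (pull e (pull q1 y)))"
    using push_pull_equivalence[OF e(1) i(1), of "pull q1 y"] ie q1y e i by simp
  also have "\<dots> = push c (pull d y)"
    using pull_comp1[OF e(1) q(1)] push_comp1[OF e(1) q(2)] pull_in[OF e(1), of "pull q1 y"] e q y q1y
    by (simp add: cd compose_def)
  finally show ?thesis .
qed

text \<open>Restriction is functorial and sees 1-cells only up to 2-cells, so \<open>pull b\<close>
  is a two-sided inverse.\<close>

lemma bij_pull:
  assumes a: "is_cell1 a" and b: "is_cell1 b"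
    and ba: "iso1 (comp1 b a) (id1 (dom1 a))" and ab: "iso1 (comp1 a b) (id1 (cod1 a))"
    and d: "dom1 b = cod1 a" "cod1 b = dom1 a"
  shows "bij_betw (pull a) (M (cod1 a)) (M (dom1 a))"
proof (rule bij_betw_byWitness[where f' = "pull b"])
  have "compose (M (dom1 a)) (pull a) (pull b) = (\<lambda>c\<in>M (dom1 a). c)"
    using pull_comp1[OF a b] pull_iso1[OF ba] d by (simp add: pull_id1 c1_dom a)
  then show "\<forall>c\<in>M (dom1 a). pull a (pull b c) = c"
    by (metis compose_eq restrict_apply')
  have "compose (M (cod1 a)) (pull b) (pull a) = (\<lambda>c\<in>M (cod1 a). c)"
    using pull_comp1[OF b a] pull_iso1[OF ab] d by (simp add: pull_id1 c1_cod a)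
  then show "\<forall>c\<in>M (cod1 a). pull b (pull a c) = c"
    by (metis compose_eq restrict_apply')
qed (use pull_in[OF a] pull_in[OF b] d in auto)

text \<open>
  After inflation to a common group \<open>G \<times> H\<close>, with \<open>X/G \<simeq> (X \<times> H)/(G \<times> H)\<close> and likewise for \<open>Y/H\<close>,
  the coproduct is a disjoint union of sets, which the 2-functor to groupoids takes to a
  coproduct of groupoids.
\<close>

lemma bij_pull_coproduct:
  assumes cop: "is_coproduct scat X Y S (class1 i) (class1 j)"
    and i: "is_cell1 i" "dom1 i = X" "cod1 i = S" and j: "is_cell1 j" "dom1 j = Y" "cod1 j = S"
  shows "bij_betw (\<lambda>m. (pull i m, pull j m)) (M S) (M X \<times> M Y)"
proof -
  obtain t t' :: 'u where t: "t \<noteq> t'"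
    using infinite by (metis finite.simps finite_subset subsetI singletonI)
  have X: "is_cell0 X" and Y: "is_cell0 Y" and S: "is_cell0 S"
    using cop by (simp_all add: is_coproduct_def)
  let ?G = "grp X" and ?H = "grp Y"
  let ?L = "prod_grp ?G ?H"
  note G = cell0_group[OF X] and H = cell0_group[OF Y]
  have fin: "finite (carrier ?G)" "finite (carrier ?H)" using X Y by (simp_all add: is_cell0_def)
  note L = group_prod_grp[OF G H] finite_prod_grp[OF fin]
  have hom: "p1 \<in> hom ?L ?G" "p2 \<in> hom ?L ?H" by (auto intro!: homI elim!: prod_grpE)
  obtain A r s where A: "is_cell0 A" "grp A = ?L" "pts A \<subseteq> range (pr t)"
    and r: "is_cell1 r" "dom1 r = X" "cod1 r = A" and s: "is_cell1 s" "dom1 s = A" "cod1 s = X"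
    and rs: "iso1 (comp1 s r) (id1 X)" "iso1 (comp1 r s) (id1 A)"
    by (rule inflate[OF X H fin(2) L hom, of pr t]) (auto elim: prod_grpE)
  obtain B r' s' where B: "is_cell0 B" "grp B = ?L" "pts B \<subseteq> range (pr t')"
    and r': "is_cell1 r'" "dom1 r' = Y" "cod1 r' = B" and s': "is_cell1 s'" "dom1 s' = B" "cod1 s' = Y"
    and rs': "iso1 (comp1 s' r') (id1 Y)" "iso1 (comp1 r' s') (id1 B)"
    \<comment> \<open>The same group with its factors exchanged: the projections swap and the
      pairing takes its arguments in reverse.\<close>
    by (rule inflate[OF Y G fin(1) L hom(2,1), of "\<lambda>h g. pr g h" t']) (auto elim: prod_grpE)
  have "z \<notin> pts B" if "z \<in> pts A" for z
    using subsetD[OF A(3) that] subsetD[OF B(3), of z] t by auto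
  then interpret U: disjoint_sum A B
    by unfold_locales (use A B in auto)
  have ex1: "\<exists>!h. h \<in> Hom scat S T \<and> Cmp scat X S T h (class1 i) = class1 f \<and> Cmp scat Y S T h (class1 j) = class1 g"
    if "is_cell1 f" "dom1 f = X" "cod1 f = T" "is_cell1 g" "dom1 g = Y" "cod1 g = T" for T f g
  proof -
    have f: "class1 f \<in> Hom scat X T" and g: "class1 g \<in> Hom scat Y T" and T: "T \<in> Ob scat"
      using that c1_cod by auto
    have "\<forall>T\<in>Ob scat. \<forall>f\<in>Hom scat X T. \<forall>g\<in>Hom scat Y T.
        \<exists>!h. h \<in> Hom scat S T \<and> Cmp scat X S T h (class1 i) = f \<and> Cmp scat Y S T h (class1 j) = g"
      using cop unfolding is_coproduct_def by (elim conjE)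
    from bspec[OF bspec[OF bspec[OF this T] f] g] show ?thesis .
  qed
  have cr: "is_cell1 (comp1 U.iA r)" "is_cell1 (comp1 U.iB r')"
    using is_cell1_comp1[OF r(1) U.is_cell1_iA] is_cell1_comp1[OF r'(1) U.is_cell1_iB] r r' by simp_all
  \<comment> \<open>Into the disjoint sum by the given coproduct in \<open>scat\<close>;
    compatibility with the injections holds only up to 2-cells.\<close>
  obtain h where h: "is_cell1 h" "dom1 h = S" "cod1 h = U.S"
      "Cmp scat X S U.S (class1 h) (class1 i) = class1 (comp1 U.iA r)"
      "Cmp scat Y S U.S (class1 h) (class1 j) = class1 (comp1 U.iB r')"
    using ex1_implies_ex[OF ex1[OF cr(1) _ _ cr(2)]] r r' by auto
  have hi: "iso1 (comp1 h i) (comp1 U.iA r)" and hj: "iso1 (comp1 h j) (comp1 U.iB r')"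
    using h i j by (simp_all add: Cmp_scat class1_eq_iff[symmetric] is_cell1_comp1)
  have cs: "is_cell1 (comp1 i s)" "is_cell1 (comp1 j s')"
    using is_cell1_comp1 i j s s' by metis+
  \<comment> \<open>Back by gluing, with strict compatibility.\<close>
  obtain k where k: "is_cell1 k" "dom1 k = U.S" "cod1 k = S" "comp1 k U.iA = comp1 i s" "comp1 k U.iB = comp1 j s'"
    by (rule U.glue1[OF cs(1) _ cs(2)]) (simp_all add: i j s s')
  \<comment> \<open>\<open>comp1 k h\<close> and the identity have the same classes after
    composition with \<open>i\<close> and with \<open>j\<close>, so uniqueness in
    \<open>scat\<close> identifies them.\<close>
  have kh: "iso1 (comp1 k h) (id1 S)"
  proof -
    have ckh: "is_cell1 (comp1 k h)" using is_cell1_comp1 h k by metis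
    have "iso1 (comp1 (comp1 k h) i) i"
    proof -
      have "iso1 (comp1 k (comp1 h i)) (comp1 k (comp1 U.iA r))" by (rule iso1_compL[OF hi k(1)]) (simp add: h k)
      moreover have "comp1 k (comp1 U.iA r) = comp1 i (comp1 s r)"
        using comp1_assoc[OF r(1) U.is_cell1_iA k(1)] comp1_assoc[OF r(1) s(1) i(1)] r s i k by simp
      moreover have "iso1 (comp1 i (comp1 s r)) (comp1 i (id1 X))" by (rule iso1_compL[OF rs(1) i(1)]) (simp add: s i)
      moreover have "comp1 i (id1 X) = i" using comp1_id1(1)[OF i(1)] i by simp
      moreover have "comp1 k (comp1 h i) = comp1 (comp1 k h) i" using comp1_assoc[OF i(1) h(1) k(1)] i h k by simp
      ultimately show ?thesis using iso1_trans by metis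
    qed
    moreover have "iso1 (comp1 (comp1 k h) j) j"
    proof -
      have "iso1 (comp1 k (comp1 h j)) (comp1 k (comp1 U.iB r'))" by (rule iso1_compL[OF hj k(1)]) (simp add: h k)
      moreover have "comp1 k (comp1 U.iB r') = comp1 j (comp1 s' r')"
        using comp1_assoc[OF r'(1) U.is_cell1_iB k(1)] comp1_assoc[OF r'(1) s'(1) j(1)] r' s' j k by simp
      moreover have "iso1 (comp1 j (comp1 s' r')) (comp1 j (id1 Y))" by (rule iso1_compL[OF rs'(1) j(1)]) (simp add: s' j)
      moreover have "comp1 j (id1 Y) = j" using comp1_id1(1)[OF j(1)] j by simp
      moreover have "comp1 k (comp1 h j) = comp1 (comp1 k h) j" using comp1_assoc[OF j(1) h(1) k(1)] j h k by simp
      ultimately show ?thesis using iso1_trans by metis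
    qed
    ultimately have 1: "class1 (comp1 k h) \<in> Hom scat S S \<and> Cmp scat X S S (class1 (comp1 k h)) (class1 i) = class1 i \<and>
        Cmp scat Y S S (class1 (comp1 k h)) (class1 j) = class1 j"
      using ckh h k i j by (auto simp: Cmp_scat class1_eq_iff is_cell1_comp1 iso1_refl intro!: exI[of _ "comp1 k h"])
    have 2: "class1 (id1 S) \<in> Hom scat S S \<and> Cmp scat X S S (class1 (id1 S)) (class1 i) = class1 i \<and>
        Cmp scat Y S S (class1 (id1 S)) (class1 j) = class1 j"
      using cat_id[OF is_category_scat, of S] cat_idl[OF is_category_scat, of X S "class1 i"]
        cat_idl[OF is_category_scat, of Y S "class1 j"] S X Y i j by auto
    have "class1 (comp1 k h) = class1 (id1 S)"
      using ex1[OF i j] 1 2 by blast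
    then show ?thesis by (simp add: class1_eq_iff ckh)
  qed
  \<comment> \<open>On the side of the disjoint sum, \<open>glue2\<close> plays the part of
    uniqueness.\<close>
  have hk: "iso1 (comp1 h k) (id1 U.S)"
  proof (rule U.glue2)
    show "is_cell1 (comp1 h k)" using is_cell1_comp1 h k by metis
    show "is_cell1 (id1 U.S)" by (rule is_cell1_id1[OF U.is_cell0_S])
    have idA: "comp1 (id1 U.S) U.iA = U.iA" "comp1 (id1 U.S) U.iB = U.iB"
      using comp1_id1(2)[OF U.is_cell1_iA] comp1_id1(2)[OF U.is_cell1_iB] by simp_all
    show "iso1 (comp1 (comp1 h k) U.iA) (comp1 (id1 U.S) U.iA)"
    proof -
      have "comp1 (comp1 h k) U.iA = comp1 (comp1 h i) s"
        using comp1_assoc[OF U.is_cell1_iA k(1) h(1)] comp1_assoc[OF s(1) i(1) h(1)] s i k h by simp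
      moreover have "iso1 (comp1 (comp1 h i) s) (comp1 (comp1 U.iA r) s)" by (rule iso1_compR[OF hi s(1)]) (simp add: i s)
      moreover have "comp1 (comp1 U.iA r) s = comp1 U.iA (comp1 r s)"
        using comp1_assoc[OF s(1) r(1) U.is_cell1_iA] r s by simp
      moreover have "iso1 (comp1 U.iA (comp1 r s)) (comp1 U.iA (id1 A))" by (rule iso1_compL[OF rs(2) U.is_cell1_iA]) (simp add: r)
      moreover have "comp1 U.iA (id1 A) = U.iA" using comp1_id1(1)[OF U.is_cell1_iA] by simp
      ultimately show ?thesis using iso1_trans idA by metis
    qed
    show "iso1 (comp1 (comp1 h k) U.iB) (comp1 (id1 U.S) U.iB)"
    proof -
      have "comp1 (comp1 h k) U.iB = comp1 (comp1 h j) s'"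
        using comp1_assoc[OF U.is_cell1_iB k(1) h(1)] comp1_assoc[OF s'(1) j(1) h(1)] s' j k h by simp
      moreover have "iso1 (comp1 (comp1 h j) s') (comp1 (comp1 U.iB r') s')" by (rule iso1_compR[OF hj s'(1)]) (simp add: j s')
      moreover have "comp1 (comp1 U.iB r') s' = comp1 U.iB (comp1 r' s')"
        using comp1_assoc[OF s'(1) r'(1) U.is_cell1_iB] r' s' by simp
      moreover have "iso1 (comp1 U.iB (comp1 r' s')) (comp1 U.iB (id1 B))" by (rule iso1_compL[OF rs'(2) U.is_cell1_iB]) (simp add: r')
      moreover have "comp1 U.iB (id1 B) = U.iB" using comp1_id1(1)[OF U.is_cell1_iB] by simp
      ultimately show ?thesis using iso1_trans idA by metis
    qed
  qed (simp_all add: h k)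
  have bh: "bij_betw (pull h) (M U.S) (M S)"
    using bij_pull[OF h(1) k(1)] kh hk h k by simp
  have br: "bij_betw (pull r) (M A) (M X)" "bij_betw (pull r') (M B) (M Y)"
    using bij_pull[OF r(1) s(1)] bij_pull[OF r'(1) s'(1)] rs rs' r s r' s' by simp_all
  have bU: "bij_betw (\<lambda>c. (pull U.iA c, pull U.iB c)) (M U.S) (M A \<times> M B)"
    using bij_iso_classes_fpair[OF coproduct[OF U.is_coproduct_finGpd] D1_E1(1)[OF U.is_cell1_iA] D1_E1(1)[OF U.is_cell1_iB]]
      D1_E1[OF U.is_cell1_iA] D1_E1[OF U.is_cell1_iB]
    by (simp add: pull_def M_def)
  \<comment> \<open>The map in question, preceded by the bijection \<open>pull h\<close>, equals the
    bijection from (i) followed by restriction along the two inflations; hence it is bijective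
    itself.\<close>
  have "bij_betw (map_prod (pull r) (pull r')) (M A \<times> M B) (M X \<times> M Y)"
    using br unfolding bij_betw_def by (simp add: map_prod_inj_on map_prod_surj_on)
  from bij_betw_trans[OF bU this]
  have "bij_betw (map_prod (pull r) (pull r') \<circ> (\<lambda>c. (pull U.iA c, pull U.iB c))) (M U.S) (M X \<times> M Y)" .
  moreover have "(map_prod (pull r) (pull r') \<circ> (\<lambda>c. (pull U.iA c, pull U.iB c))) c = ((\<lambda>m. (pull i m, pull j m)) \<circ> pull h) c"
    if c: "c \<in> M U.S" for c
  proof -
    have "pull (comp1 h i) c = pull (comp1 U.iA r) c" "pull (comp1 h j) c = pull (comp1 U.iB r') c"
      using pull_iso1[OF hi] pull_iso1[OF hj] by simp_all
    then show ?thesis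
      using pull_comp1[OF i(1) h(1)] pull_comp1[OF j(1) h(1)] pull_comp1[OF r(1) U.is_cell1_iA] pull_comp1[OF r'(1) U.is_cell1_iB]
        c h i j r r' by (simp add: compose_def)
  qed
  ultimately have "bij_betw ((\<lambda>m. (pull i m, pull j m)) \<circ> pull h) (M U.S) (M X \<times> M Y)"
    by (subst bij_betw_cong[symmetric]) auto
  then show ?thesis using bij_betw_comp_iff[OF bh] by blast
qed

text \<open>A morphism of \<open>scat\<close> is a set of 1-cells, and the choice of a
  representative is harmless by \<open>push_iso1\<close>.\<close>

definition Mlower :: "('u cell0, 'u cell1 set, 'o set set, 'o set \<Rightarrow> 'o set) cat_functor" where
  "Mlower = mk_functor scat set_cat M (\<lambda>_ _ A. push (SOME a. a \<in> A))"

definition Mupper :: "('u cell0, 'u cell1 set, 'o set set, 'o set \<Rightarrow> 'o set) cat_functor" where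
  "Mupper = mk_functor (op_cat scat) set_cat M (\<lambda>_ _ A. pull (SOME a. a \<in> A))"

lemma some_class1: "is_cell1 a \<Longrightarrow> iso1 a (SOME b. b \<in> class1 a)"
  unfolding class1_iff by (rule someI) (rule iso1_refl)

lemma push_some: "is_cell1 a \<Longrightarrow> push (SOME b. b \<in> class1 a) = push a"
  and pull_some: "is_cell1 a \<Longrightarrow> pull (SOME b. b \<in> class1 a) = pull a"
  using push_iso1 pull_iso1 some_class1 by metis+

lemma far_Mlower: "is_cell1 a \<Longrightarrow> far Mlower (dom1 a) (cod1 a) (class1 a) = push a"
  unfolding Mlower_def by (subst mk_functor_simps) (auto simp: c1_dom c1_cod push_some)

lemma far_Mupper: "is_cell1 a \<Longrightarrow> far Mupper (cod1 a) (dom1 a) (class1 a) = pull a"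
  unfolding Mupper_def by (subst mk_functor_simps) (auto simp: c1_dom c1_cod pull_some op_cat_def)

lemma fob_simps [simp]: "is_cell0 X \<Longrightarrow> fob Mlower X = M X" "is_cell0 X \<Longrightarrow> fob Mupper X = M X"
  by (simp_all add: Mlower_def Mupper_def op_cat_def)

lemma is_functor_Mlower: "is_functor Mlower"
  unfolding Mlower_def
proof (rule is_functor_mk[OF is_category_scat is_category_set_cat])
  show "M x \<in> Ob set_cat" for x by (simp add: set_cat_def)
next
  fix x y :: "'u cell0" and f assume "f \<in> Hom scat x y"
  then obtain a where "is_cell1 a" "x = dom1 a" "y = cod1 a" "f = class1 a" by auto
  then show "push (SOME a. a \<in> f) \<in> Hom set_cat (M x) (M y)"
    by (simp add: set_cat_def push_some push_mem)
next
  fix x :: "'u cell0" assume "x \<in> Ob scat"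
  then show "push (SOME a. a \<in> Idt scat x) = Idt set_cat (M x)"
    by (simp add: push_some is_cell1_id1 push_id1 set_cat_def)
next
  fix x y z :: "'u cell0" and f g assume "f \<in> Hom scat x y" "g \<in> Hom scat y z"
  then obtain a b where "is_cell1 a" "is_cell1 b" "cod1 a = dom1 b" "x = dom1 a" "f = class1 a" "g = class1 b"
    by auto
  then show "push (SOME a. a \<in> Cmp scat x y z g f) = Cmp set_cat (M x) (M y) (M z) (push (SOME a. a \<in> g)) (push (SOME a. a \<in> f))"
    by (simp add: Cmp_scat push_some is_cell1_comp1 push_comp1 set_cat_def)
qed

lemma is_functor_Mupper: "is_functor Mupper"
  unfolding Mupper_def
proof (rule is_functor_mk[OF is_category_op_cat[OF is_category_scat] is_category_set_cat])
  show "M x \<in> Ob set_cat" for x by (simp add: set_cat_def)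
next
  fix x y :: "'u cell0" and f assume "f \<in> Hom (op_cat scat) x y"
  then obtain a where "is_cell1 a" "x = cod1 a" "y = dom1 a" "f = class1 a" by (auto simp: op_cat_def)
  then show "pull (SOME a. a \<in> f) \<in> Hom set_cat (M x) (M y)"
    by (simp add: set_cat_def pull_some pull_mem)
next
  fix x :: "'u cell0" assume "x \<in> Ob (op_cat scat)"
  then show "pull (SOME a. a \<in> Idt (op_cat scat) x) = Idt set_cat (M x)"
    by (simp add: pull_some is_cell1_id1 pull_id1 set_cat_def op_cat_def)
next
  fix x y z :: "'u cell0" and f g assume "f \<in> Hom (op_cat scat) x y" "g \<in> Hom (op_cat scat) y z"
  then obtain a b where "is_cell1 a" "is_cell1 b" "cod1 b = dom1 a" "x = cod1 a" "f = class1 a" "g = class1 b"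
    by (auto simp: op_cat_def)
  then show "pull (SOME a. a \<in> Cmp (op_cat scat) x y z g f) =
      Cmp set_cat (M x) (M y) (M z) (pull (SOME a. a \<in> g)) (pull (SOME a. a \<in> f))"
    by (simp add: Cmp_scat pull_some is_cell1_comp1 pull_comp1 set_cat_def op_cat_def)
qed

lemma semi_mackey:
  assumes empty: "\<And>K. fin_groupoid K \<Longrightarrow> Ob K = {} \<Longrightarrow> equivalent_cats (D0 D K) one_cat"
  shows "semi_mackey Mlower Mupper"
  unfolding semi_mackey_def
proof (intro conjI allI impI ballI is_functor_Mlower is_functor_Mupper)
  show "fdom Mlower = scat" "fcod Mlower = set_cat" "fdom Mupper = op_cat scat" "fcod Mupper = set_cat"
    by (simp_all add: Mlower_def Mupper_def)
  show "\<And>X. is_cell0 X \<Longrightarrow> fob Mlower X = fob Mupper X" by simp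
next
  fix X Y S :: "'u cell0" and I J assume cop: "is_coproduct scat X Y S I J"
  then have "I \<in> Hom scat X S" "J \<in> Hom scat Y S" by (simp_all add: is_coproduct_def)
  then obtain i j where ij: "is_cell1 i" "dom1 i = X" "cod1 i = S" "is_cell1 j" "dom1 j = Y" "cod1 j = S"
    "I = class1 i" "J = class1 j" by auto
  have "is_cell0 X" "is_cell0 Y" "is_cell0 S" using ij c1_dom c1_cod by auto
  then show "bij_betw (\<lambda>m. (far Mupper S X I m, far Mupper S Y J m)) (fob Mupper S) (fob Mupper X \<times> fob Mupper Y)"
    using bij_pull_coproduct[OF cop[unfolded ij(7,8)] ij(1-6)] far_Mupper[OF ij(1)] far_Mupper[OF ij(4)] ij by simp
next
  fix Z :: "'u cell0" assume "empty_cell0 Z"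
  then have Z: "is_cell0 Z" "pts Z = {}" by (simp_all add: empty_cell0_def)
  show "\<exists>m. fob Mupper Z = {m}"
    using iso_classes_equivalent_one_cat[OF empty, of "E0 Z"] Z by (simp add: fin_groupoid_E0 D0_category M_def)
next
  fix W X Y Z :: "'u cell0" and A B C E m assume "natural_weak_pullback W X Y Z A B C E" and m: "m \<in> fob Mupper Y"
  then obtain a b c d k where bp: "is_bipullback a b c d k" and
    w: "dom1 c = W" "dom1 a = X" "dom1 b = Y" "cod1 a = Z" "A = class1 a" "B = class1 b" "C = class1 c" "E = class1 d"
    by (auto simp: natural_weak_pullback_def)
  have cells: "is_cell1 a" "is_cell1 b" "is_cell1 c" "is_cell1 d" "cod1 b = Z" "cod1 c = X" "cod1 d = Y" "dom1 d = W"
    using bp w by (simp_all add: is_bipullback_def)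
  have "is_cell0 Y" using c1_dom[OF cells(2)] w by simp
  then have "m \<in> M (dom1 b)" using m w by simp
  from push_pull_bipullback[OF bp this]
  show "far Mupper Z X A (far Mlower Y Z B m) = far Mlower W X C (far Mupper Y W E m)"
    using far_Mupper[OF cells(1)] far_Mupper[OF cells(4)] far_Mlower[OF cells(2)] far_Mlower[OF cells(3)] w cells
    by simp
qed

end

text \<open>An infinite set is equipotent to its square, and the projections come from inverting the
  bijection.\<close>

lemma infinite_pairing:
  assumes "infinite (UNIV :: 'u set)"
  shows "\<exists>pr p1 p2 :: 'u \<Rightarrow> _. pairing pr p1 p2"
proof -
  obtain f :: "'u \<times> 'u \<Rightarrow> 'u" where "bij_betw f (UNIV \<times> UNIV) UNIV"
    using card_of_Times_same_infinite[OF assms] unfolding card_of_ordIso[symmetric] by blast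
  then have "inj f" by (simp add: bij_betw_def)
  then have "pairing (\<lambda>x y. f (x, y)) (\<lambda>z. fst (inv_into UNIV f z)) (\<lambda>z. snd (inv_into UNIV f z))"
    by unfold_locales simp_all
  then show ?thesis by blast
qed

text \<open>The last equations quantify over all 1-cells \<open>a\<close>, so they also assert that
  both maps depend only on \<open>class1 a\<close>.\<close>

theorem proposition2p7:
  fixes D :: "('u, 'o, 'm) gpd_2functor"
    and shr :: "('u, 'u, 'u, 'u) cat_functor \<Rightarrow> ('o, 'm, 'o, 'm) cat_functor"
    and \<eta> \<epsilon> :: "('u, 'u, 'u, 'u) cat_functor \<Rightarrow> ('o, 'm, 'o, 'm) nat_trans"
  assumes universe: "infinite (UNIV :: 'u set)"
    and D: "strict_2functor D"
    and i_empty: "\<And>K. fin_groupoid K \<Longrightarrow> Ob K = {} \<Longrightarrow> equivalent_cats (D0 D K) one_cat"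
    and i_coproduct: "\<And>I J S i j. is_coproduct finGpd I J S i j \<Longrightarrow>
          is_equivalence (fpair (D1 D i) (D1 D j))"
    and ii: "\<And>u. gpd_functor u \<Longrightarrow> is_adjunction (shr u) (D1 D u) (\<eta> u) (\<epsilon> u)"
    and iii: "\<And>I J p q l. gpd_comma_square I J p q l \<Longrightarrow>
          is_nat_iso (lambda_shriek D shr \<eta> \<epsilon> I J p q l)"
  shows "\<exists>Ml Mu :: ('u cell0, 'u cell1 set, 'o set set, 'o set \<Rightarrow> 'o set) cat_functor.
      semi_mackey Ml Mu \<and>
      (\<forall>X. is_cell0 X \<longrightarrow>
         fob Ml X = iso_classes (D0 D (E0 X)) \<and> fob Mu X = iso_classes (D0 D (E0 X))) \<and>
      (\<forall>a. is_cell1 a \<longrightarrow>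
         far Mu (cod1 a) (dom1 a) (class1 a) = iso_classes_map (D1 D (E1 a)) \<and>
         far Ml (dom1 a) (cod1 a) (class1 a) = iso_classes_map (shr (E1 a)))"
proof -
  obtain pr p1 p2 :: "'u \<Rightarrow> _" where pairing: "pairing pr p1 p2"
    using infinite_pairing[OF universe] by blast
  interpret transfer D shr \<eta> \<epsilon> pr p1 p2
    unfolding transfer_def transfer_axioms_def derivator_def
    using universe pairing D ii iii i_coproduct by blast
  show ?thesis
    using semi_mackey[OF i_empty] far_Mlower far_Mupper
    by (intro exI[of _ Mlower] exI[of _ Mupper]) (simp add: M_def push_def pull_def)
qed

end
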